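(* Let $k\ge0$ and $n\ge k$ ($n\geq1$) be integers, let $\lambda\in\mathcal P_n^{(k)}$ with characteristic index $\chi=(\chi_1,\ldots,\chi_{n-k})$, and let $\Delta_{n-k}=\{(i,j)\mid 1\le i<j\le n-k\}$. (a) If $D(\lambda)=\Delta_{n-k}$, in particular, if $\lambda$ is contained in the $(n-k)\times k$ rectangle, then $\mathfrak C_{w_\lambda^{(k)}}$ is the single determinant $$\mathfrak C_{w_\lambda^{(k)}}=\det\left({}_k\vartheta_{\lambda_i+j-i}^{(\chi_i)}\right)_{1\le i,j\le n-k}.$$ (b) If $D(\lambda)=\emptyset$, in particular, if $\lambda$ is a strict partition containing the $(n-k)\times k$ rectangle, then $\mathfrak C_{w_\lambda^{(k)}}$ is the single Pfaffian $$\mathfrak C_{w_\lambda^{(k)}}=\mathrm{Pf}\left[{}_k\vartheta_{\lambda_1}^{(\chi_1)}\cdots{}_k\vartheta_{\lambda_{n-k}}^{(\chi_{n-k})}\right].$$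
   Context: **Group.** $W_\infty$ is the group (under composition) of permutations $w$ of $\{1,2,\ldots\}\cup\{\bar1,\bar2,\ldots\}$, where $\bar i=-i$, with $w(\bar i)=\overline{w(i)}$ for all $i$ and $w(i)\ne i$ for only finitely many $i$. It is a Coxeter group with generators $s_0=(1,\bar1)$ and $s_i=(i,i+1)(\bar i,\overline{i+1})$ for $i\ge1$; $\ell$ is the length. $W_n=\{w\in W_\infty\mid w(i)=i\ \forall i>n\}$, with elements written in one-line notation $w(1)\cdots w(n)$. **Ring and operators.** $x,z,t$ are infinite sequences of variables. $Q_r(x)$ is defined by $\sum_{r\ge0}Q_r(x)u^r=\prod_{i\ge1}\frac{1+x_iu}{1-x_iu}$, $\Gamma=\mathbb Z[Q_1(x),Q_2(x),\ldots]$, and $\mathcal R_\infty=\Gamma[t_1,t_2,\ldots,z_1,z_2,\ldots]$. For $i\ge1$, $s_i^z$ is the ring automorphism of $\mathcal R_\infty$ exchanging $z_i,z_{i+1}$ and fixing the other $z_j$, all $t_j$ and all $Q_r(x)$; $s_0^z$ is the ring automorphism fixing all $t_j$ and all $z_j$ with $j\ge2$, with $s_0^z(z_1)=-z_1$ and $\sum_r s_0^z(Q_r(x))u^r=\frac{1+z_1u}{1-z_1u}\prod_{i\ge1}\frac{1+x_iu}{1-x_iu}$. Let $\omega$ be the ring automorphism with $\omega(t_i)=-z_i$, $\omega(z_i)=-t_i$, $\omega(Q_r(x))=Q_r(x)$, and put $s_i^t=\omega s_i^z\omega$ $(i\ge0)$. Put $\alpha_0=2t_1$, $\alpha_i=t_{i+1}-t_i$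 $(i\ge1)$, and $\partial_if=\frac{f-s_i^zf}{\omega(\alpha_i)}$, $\delta_if=\frac{f-s_i^tf}{\alpha_i}$. **Double Schubert polynomials.** $\{\mathfrak C_w=\mathfrak C_w(z,t;x)\mid w\in W_\infty\}$ is the unique $\mathbb Z[t]$-basis of $\mathcal R_\infty$ such that for all $i\ge0$: $\partial_i\mathfrak C_w=\mathfrak C_{ws_i}$ if $\ell(ws_i)<\ell(w)$ and $0$ otherwise; $\delta_i\mathfrak C_w=\mathfrak C_{s_iw}$ if $\ell(s_iw)<\ell(w)$ and $0$ otherwise; and $\mathfrak C_w$ has no constant term except $\mathfrak C_e=1$. **$k$-strict partitions.** A partition is strict if its nonzero parts are pairwise distinct, and $k$-strict if no part greater than $k$ is repeated. $\mathcal P_n^{(k)}$ is the set of $k$-strict partitions with Young diagram inside the $(n-k)\times(n+k)$ rectangle; $\lambda\in\mathcal P_n^{(k)}$ is written $(\lambda_1,\ldots,\lambda_{n-k})$ with zeros allowed. $W_\infty^{(k)}=\{w\in W_\infty\mid \ell(w)<\ell(ws_i)\ \forall i\ge0,\ i\ne k\}$ and $W_n^{(k)}=W_n\cap W_\infty^{(k)}$. Elements of $W_n^{(k)}$ have one-line form $w=v_1\cdots v_k|\overline{\zeta_1}\cdots\overline{\zeta_s}u_1\cdots u_{n-k-s}$ with $0<v_1<\cdots<v_k$, $\zeta_1>\cdots>\zeta_s>0$, $0<u_1<\cdots<u_{n-k-s}$. There is a bijection $\mathcal P_n^{(k)}\to W_n^{(k)}$, $\lambda\mapsto w_\lambda^{(k)}$,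 whose inverse sends $w$ to $\lambda$ with $\lambda_i=\zeta_i+k$ for $1\le i\le s$ and $\lambda_{s+j}=\#\{p\mid v_p>u_j\}$ for $1\le j\le n-k-s$. For $w=w_\lambda^{(k)}$, the characteristic index is $\chi=(\zeta_1-1,\ldots,\zeta_s-1,-u_1,\ldots,-u_{n-k-s})\in\mathbb Z^{n-k}$, and $D(\lambda)=\{(i,j)\mid 1\le i<j\le n-k,\ \chi_i+\chi_j<0\}$. **Theta polynomials.** For $l\ge0$, $\sum_{r\ge0}{}_k\vartheta_r^{(l)}u^r=\prod_{i\ge1}\frac{1+x_iu}{1-x_iu}\prod_{i=1}^k(1+z_iu)\prod_{i=1}^l(1-t_iu)$ and $\sum_{r\ge0}{}_k\vartheta_r^{(-l)}u^r=\prod_{i\ge1}\frac{1+x_iu}{1-x_iu}\prod_{i=1}^k(1+z_iu)\prod_{i=1}^l\frac1{1+t_iu}$; ${}_k\vartheta_r^{(l)}=0$ for $r<0$. **Multi Schur-Pfaffian.** For sequences of variables $c^{(i)}=(c_r^{(i)})_{r\in\mathbb Z}$, $1\le i\le m$: $\mathrm{Pf}[c_r^{(1)}]=c_r^{(1)}$; $\mathrm{Pf}[c_{r_1}^{(1)}c_{r_2}^{(2)}]=c_{r_1}^{(1)}c_{r_2}^{(2)}+2\sum_{s=1}^{r_2}(-1)^sc_{r_1+s}^{(1)}c_{r_2-s}^{(2)}$; for even $m\ge4$, $\mathrm{Pf}[c_{r_1}^{(1)}\cdots c_{r_m}^{(m)}]=\sum_{s=2}^m(-1)^s\mathrm{Pf}[c_{r_1}^{(1)}c_{r_s}^{(s)}]\,\mathrm{Pf}[c_{r_2}^{(2)}\cdots\widehat{c_{r_s}^{(s)}}\cdots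 c_{r_m}^{(m)}]$; for odd $m\ge3$, $\mathrm{Pf}[c_{r_1}^{(1)}\cdots c_{r_m}^{(m)}]=\sum_{s=1}^m(-1)^{s-1}c_{r_s}^{(s)}\mathrm{Pf}[c_{r_1}^{(1)}\cdots\widehat{c_{r_s}^{(s)}}\cdots c_{r_m}^{(m)}]$. The empty Pfaffian and empty determinant ($m=0$) are $1$. $\mathrm{Pf}[{}_k\vartheta_{r_1}^{(l_1)}\cdots{}_k\vartheta_{r_m}^{(l_m)}]$ is obtained by first expanding $\mathrm{Pf}[c_{r_1}^{(1)}\cdots c_{r_m}^{(m)}]$ and then substituting ${}_k\vartheta_s^{(l_i)}$ for $c_s^{(i)}$ for all $i$ and all $s\in\mathbb Z$.
   Formalization: In (b), the "in particular" clause is corrected: a strict partition containing the (n-k)×k rectangle is also required to have no part equal to k (zero parts count) for D(λ)=∅, and for the Pfaffian formula unless k=0; as written it fails for k=1, n=3, λ=(2,1). *)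

theory Defs
  imports
    "HOL-Library.Poly_Mapping"
    "HOL-Computational_Algebra.Formal_Power_Series"
    "HOL-Combinatorics.Permutations"
    "Jordan_Normal_Form.Determinant"
begin

section \<open>Formal power series in arbitrarily many variables\<close>

text \<open>
  A monomial in variables \<open>'v\<close> is a finitely supported exponent function; a power series is an
  arbitrary family of coefficients indexed by the monomials.
\<close>

typedef ('v, 'a) mfps = "UNIV :: (('v \<Rightarrow>\<^sub>0 nat) \<Rightarrow> 'a) set"
  morphisms mcoeff Abs_mfps ..

setup_lifting type_definition_mfps

lemma mfps_eqI: "(\<And>m. mcoeff f m = mcoeff g m) \<Longrightarrow> f = g"
  by transfer auto

lemma finite_monomial_factors: "finite {(a, b). a + b = (m :: 'v \<Rightarrow>\<^sub>0 nat)}"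
proof -
  let ?l = "Poly_Mapping.lookup :: ('v \<Rightarrow>\<^sub>0 nat) \<Rightarrow> 'v \<Rightarrow> nat"
  let ?K = "Poly_Mapping.keys m"
  let ?S = "{(a, b). a + b = m}"
  let ?F = "{f. \<forall>x. (x \<in> ?K \<longrightarrow> f x \<in> (\<Union>y\<in>?K. {..?l m y})) \<and> (x \<notin> ?K \<longrightarrow> f x = 0)}"
  have "finite ?F"
    by (intro finite_set_of_finite_funs finite_UN_I finite_keys) simp_all
  moreover have "(\<lambda>p. ?l (fst p)) ` ?S \<subseteq> ?F"
  proof (rule image_subsetI)
    fix p
    assume "p \<in> ?S"
    then have le: "?l (fst p) x \<le> ?l m x" for x
      by (auto simp: lookup_add)
    have "?l (fst p) x \<in> (\<Union>y\<in>?K. {..?l m y})" if "x \<in> ?K" for x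
      using that le[of x] by (intro UN_I) simp_all
    moreover have "?l (fst p) x = 0" if "x \<notin> ?K" for x
      using that le[of x] by (simp add: in_keys_iff)
    ultimately show "?l (fst p) \<in> ?F"
      by blast
  qed
  ultimately have "finite ((\<lambda>p. ?l (fst p)) ` ?S)"
    by (rule rev_finite_subset)
  moreover have "inj_on (\<lambda>p. ?l (fst p)) ?S"
    by (rule inj_onI) (auto simp: lookup_inject)
  ultimately show ?thesis
    by (rule finite_imageD)
qed

instantiation mfps :: (type, comm_ring_1) comm_ring_1
begin

lift_definition zero_mfps :: "('a, 'b) mfps" is "\<lambda>_. 0" .

lift_definition one_mfps :: "('a, 'b) mfps" is "\<lambda>m. if m = 0 then 1 else 0" .

lift_definition plus_mfps :: "('a, 'b) mfps \<Rightarrow> ('a, 'b) mfps \<Rightarrow> ('a, 'b) mfps"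
  is "\<lambda>f g m. f m + g m" .

lift_definition uminus_mfps :: "('a, 'b) mfps \<Rightarrow> ('a, 'b) mfps"
  is "\<lambda>f m. - f m" .

lift_definition minus_mfps :: "('a, 'b) mfps \<Rightarrow> ('a, 'b) mfps \<Rightarrow> ('a, 'b) mfps"
  is "\<lambda>f g m. f m - g m" .

lift_definition times_mfps :: "('a, 'b) mfps \<Rightarrow> ('a, 'b) mfps \<Rightarrow> ('a, 'b) mfps"
  is "\<lambda>f g m. \<Sum>(a, b)\<in>{(a, b). a + b = m}. f a * g b" .

instance
proof
  fix f g h :: "('a, 'b) mfps"
  show "f * g * h = f * (g * h)"
  proof (rule mfps_eqI)
    fix m :: "'a \<Rightarrow>\<^sub>0 nat"
    let ?dec = "\<lambda>m :: 'a \<Rightarrow>\<^sub>0 nat. {(a, b). a + b = m}"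
    have fin: "finite (?dec q)" for q
      by (rule finite_monomial_factors)
    have "mcoeff (f * g * h) m =
        (\<Sum>p\<in>?dec m. \<Sum>q\<in>?dec (fst p). mcoeff f (fst q) * (mcoeff g (snd q) * mcoeff h (snd p)))"
      by (simp only: times_mfps.rep_eq sum_distrib_right case_prod_unfold mult.assoc)
    also have "\<dots> = (\<Sum>(p, q)\<in>Sigma (?dec m) (\<lambda>p. ?dec (fst p)).
        mcoeff f (fst q) * (mcoeff g (snd q) * mcoeff h (snd p)))"
      by (rule sum.Sigma) (use fin in blast)+
    also have "\<dots> = (\<Sum>(p, q)\<in>Sigma (?dec m) (\<lambda>p. ?dec (snd p)).
        mcoeff f (fst p) * (mcoeff g (fst q) * mcoeff h (snd q)))"
      by (rule sum.reindex_bij_witness[where i = "\<lambda>(p, q). ((fst p + fst q, snd q), (fst p, fst q))"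
            and j = "\<lambda>(p, q). ((fst q, snd q + snd p), (snd q, snd p))"])
        (auto simp: add.assoc)
    also have "\<dots> = (\<Sum>p\<in>?dec m. \<Sum>q\<in>?dec (snd p). mcoeff f (fst p) * (mcoeff g (fst q) * mcoeff h (snd q)))"
      by (rule sum.Sigma[symmetric]) (use fin in blast)+
    also have "\<dots> = mcoeff (f * (g * h)) m"
      by (simp only: times_mfps.rep_eq sum_distrib_left case_prod_unfold)
    finally show "mcoeff (f * g * h) m = mcoeff (f * (g * h)) m" .
  qed
  show "f * g = g * f"
    by (rule mfps_eqI, unfold times_mfps.rep_eq,
        rule sum.reindex_bij_witness[where i = prod.swap and j = prod.swap])
      (auto simp: ac_simps)
  show "1 * f = f"
  proof (rule mfps_eqI)
    fix m :: "'a \<Rightarrow>\<^sub>0 nat"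
    have "mcoeff (1 * f) m = (\<Sum>(a, b)\<in>{(0, m)}. mcoeff 1 a * mcoeff f b)"
      unfolding times_mfps.rep_eq
      by (rule sum.mono_neutral_right) (auto simp: finite_monomial_factors one_mfps.rep_eq split: if_splits)
    then show "mcoeff (1 * f) m = mcoeff f m"
      by (simp add: one_mfps.rep_eq)
  qed
  show "(f + g) * h = f * h + g * h"
    by (rule mfps_eqI)
      (simp add: times_mfps.rep_eq plus_mfps.rep_eq distrib_right sum.distrib case_prod_unfold)
  show "(0 :: ('a, 'b) mfps) \<noteq> 1"
    by transfer (auto simp: fun_eq_iff)
qed (transfer; auto simp: fun_eq_iff)+

end

lift_definition mvar :: "'v \<Rightarrow> ('v, 'a::comm_ring_1) mfps"
  is "\<lambda>v m. if m = Poly_Mapping.single v 1 then 1 else 0" .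


section \<open>The ring \<open>R\<^sub>\<infinity> = \<Gamma>[t, z]\<close>\<close>

text \<open>All families of variables are indexed from 1; the index 0 is never used.\<close>

datatype var = X nat | Z nat | T nat

inductive_set subring_gen :: "'a::comm_ring_1 set \<Rightarrow> 'a set" for G where
  one: "1 \<in> subring_gen G"
| gen: "g \<in> G \<Longrightarrow> g \<in> subring_gen G"
| diff: "a \<in> subring_gen G \<Longrightarrow> b \<in> subring_gen G \<Longrightarrow> a - b \<in> subring_gen G"
| mult: "a \<in> subring_gen G \<Longrightarrow> b \<in> subring_gen G \<Longrightarrow> a * b \<in> subring_gen G"

lemma subring_gen_zero: "0 \<in> subring_gen G"
  using subring_gen.diff[OF subring_gen.one subring_gen.one] by simp

lemma subring_gen_uminus: "a \<in> subring_gen G \<Longrightarrow> - a \<in> subring_gen G"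
  using subring_gen.diff[OF subring_gen_zero] by force

lemma subring_gen_add: "a \<in> subring_gen G \<Longrightarrow> b \<in> subring_gen G \<Longrightarrow> a + b \<in> subring_gen G"
  using subring_gen.diff[OF _ subring_gen_uminus] by force

text \<open>\<open>1 + a u\<close> and \<open>1 / (1 - a u)\<close> as power series in \<open>u\<close>.\<close>

definition fps_lin :: "'a::comm_ring_1 \<Rightarrow> 'a fps" where
  "fps_lin a = 1 + fps_const a * fps_X"

definition fps_geom :: "'a::comm_ring_1 \<Rightarrow> 'a fps" where
  "fps_geom a = Abs_fps (\<lambda>n. a ^ n)"

lemma fps_geom_inverse: "fps_lin (- a) * fps_geom a = 1"
proof (rule fps_ext)
  fix n
  show "fps_nth (fps_lin (- a) * fps_geom a) n = fps_nth 1 n"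
    by (cases n) (simp_all add: fps_lin_def fps_geom_def distrib_right mult.assoc)
qed

text \<open>
  The infinite product \<open>\<Prod>\<^bsub>i\<ge>1\<^esub> (1 + x\<^sub>i u) / (1 - x\<^sub>i u)\<close> is a limit of finite products in which
  the coefficient of every monomial is eventually constant.
\<close>

definition Qfin :: "nat \<Rightarrow> nat \<Rightarrow> (var, int) mfps" where
  "Qfin N r = fps_nth (\<Prod>i=1..N. fps_lin (mvar (X i)) * fps_geom (mvar (X i))) r"

definition Qser :: "nat \<Rightarrow> (var, int) mfps" where
  "Qser r = Abs_mfps (\<lambda>m. THE c. eventually (\<lambda>N. mcoeff (Qfin N r) m = c) sequentially)"

typedef rinf = "subring_gen
    (range Qser \<union> {mvar (Z i) | i. i \<ge> 1} \<union> {mvar (T i) | i. i \<ge> 1}) :: (var, int) mfps set"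
  morphisms series_of Abs_rinf
  using subring_gen.one by blast

setup_lifting type_definition_rinf

instantiation rinf :: comm_ring_1
begin

lift_definition zero_rinf :: rinf is 0 by (rule subring_gen_zero)

lift_definition one_rinf :: rinf is 1 by (rule subring_gen.one)

lift_definition plus_rinf :: "rinf \<Rightarrow> rinf \<Rightarrow> rinf" is "(+)" by (rule subring_gen_add)

lift_definition uminus_rinf :: "rinf \<Rightarrow> rinf" is uminus by (rule subring_gen_uminus)

lift_definition minus_rinf :: "rinf \<Rightarrow> rinf \<Rightarrow> rinf" is "(-)" by (rule subring_gen.diff)

lift_definition times_rinf :: "rinf \<Rightarrow> rinf \<Rightarrow> rinf" is "(*)" by (rule subring_gen.mult)

instance
  by standard (transfer; simp add: algebra_simps)+

end

lift_definition Qpol :: "nat \<Rightarrow> rinf" is Qser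
  by (auto intro: subring_gen.gen)

lift_definition zvar :: "nat \<Rightarrow> rinf" is "\<lambda>i. if i = 0 then 0 else mvar (Z i)"
  by (auto intro!: subring_gen.gen subring_gen_zero)

lift_definition tvar :: "nat \<Rightarrow> rinf" is "\<lambda>i. if i = 0 then 0 else mvar (T i)"
  by (auto intro!: subring_gen.gen subring_gen_zero)

definition constant_term :: "rinf \<Rightarrow> int" where
  "constant_term f = mcoeff (series_of f) 0"

definition Zt :: "rinf set" where
  "Zt = subring_gen {tvar i | i. i \<ge> 1}"


section \<open>Automorphisms and divided differences\<close>

definition ring_aut :: "('a::comm_ring_1 \<Rightarrow> 'a) \<Rightarrow> bool" where
  "ring_aut f \<longleftrightarrow> bij f \<and> f 1 = 1 \<and> (\<forall>a b. f (a + b) = f a + f b) \<and> (\<forall>a b. f (a * b) = f a * f b)"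

definition s_z :: "nat \<Rightarrow> rinf \<Rightarrow> rinf" where
  "s_z i = (THE f. ring_aut f \<and> (\<forall>j\<ge>1. f (tvar j) = tvar j) \<and>
     (if i = 0 then
        f (zvar 1) = - zvar 1 \<and> (\<forall>j\<ge>2. f (zvar j) = zvar j) \<and>
        Abs_fps (\<lambda>r. f (Qpol r)) = fps_lin (zvar 1) * fps_geom (zvar 1) * Abs_fps Qpol
      else
        f (zvar i) = zvar (i + 1) \<and> f (zvar (i + 1)) = zvar i \<and>
        (\<forall>j\<ge>1. j \<noteq> i \<and> j \<noteq> i + 1 \<longrightarrow> f (zvar j) = zvar j) \<and> (\<forall>r. f (Qpol r) = Qpol r)))"

definition omega :: "rinf \<Rightarrow> rinf" where
  "omega = (THE f. ring_aut f \<and>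
     (\<forall>j\<ge>1. f (tvar j) = - zvar j) \<and> (\<forall>j\<ge>1. f (zvar j) = - tvar j) \<and> (\<forall>r. f (Qpol r) = Qpol r))"

definition s_t :: "nat \<Rightarrow> rinf \<Rightarrow> rinf" where
  "s_t i = omega \<circ> s_z i \<circ> omega"

definition alpha :: "nat \<Rightarrow> rinf" where
  "alpha i = (if i = 0 then 2 * tvar 1 else tvar (i + 1) - tvar i)"

text \<open>The exact quotient in the integral domain \<open>R\<^sub>\<infinity>\<close>.\<close>

definition exact_quot :: "rinf \<Rightarrow> rinf \<Rightarrow> rinf" where
  "exact_quot f a = (THE g. g * a = f)"

definition ddiff_z :: "nat \<Rightarrow> rinf \<Rightarrow> rinf" where
  "ddiff_z i f = exact_quot (f - s_z i f) (omega (alpha i))"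

definition ddiff_t :: "nat \<Rightarrow> rinf \<Rightarrow> rinf" where
  "ddiff_t i f = exact_quot (f - s_t i f) (alpha i)"


section \<open>The group \<open>W\<^sub>\<infinity>\<close>\<close>

text \<open>Barred numbers are negative integers; a permutation of the nonzero integers fixes 0.\<close>

definition W_inf :: "(int \<Rightarrow> int) set" where
  "W_inf = {w. w permutes (- {0}) \<and> (\<forall>i. w (- i) = - w i) \<and> finite {i. w i \<noteq> i}}"

definition W_fin :: "nat \<Rightarrow> (int \<Rightarrow> int) set" where
  "W_fin n = {w \<in> W_inf. \<forall>i > int n. w i = i}"

definition gen_s :: "nat \<Rightarrow> int \<Rightarrow> int" where
  "gen_s i = (if i = 0 then transpose 1 (- 1)
     else transpose (int i) (int i + 1) \<circ> transpose (- int i) (- (int i + 1)))"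

definition len :: "(int \<Rightarrow> int) \<Rightarrow> nat" where
  "len w = (LEAST m. \<exists>is. length is = m \<and> w = foldr (\<circ>) (map gen_s is) id)"

definition W_inf_k :: "nat \<Rightarrow> (int \<Rightarrow> int) set" where
  "W_inf_k k = {w \<in> W_inf. \<forall>i. i \<noteq> k \<longrightarrow> len w < len (w \<circ> gen_s i)}"

definition W_k :: "nat \<Rightarrow> nat \<Rightarrow> (int \<Rightarrow> int) set" where
  "W_k k n = W_fin n \<inter> W_inf_k k"


section \<open>Double Schubert polynomials\<close>

definition is_Zt_basis :: "'w set \<Rightarrow> ('w \<Rightarrow> rinf) \<Rightarrow> bool" where
  "is_Zt_basis I C \<longleftrightarrow>
     (\<forall>f. \<exists>!a. (\<forall>w\<in>I. a w \<in> Zt) \<and> (\<forall>w. w \<notin> I \<longrightarrow> a w = 0) \<and> finite {w. a w \<noteq> 0} \<and>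
        f = (\<Sum>w | a w \<noteq> 0. a w * C w))"

text \<open>Values of \<open>C\<close> outside \<open>W\<^sub>\<infinity>\<close> are irrelevant.\<close>

definition double_schubert :: "((int \<Rightarrow> int) \<Rightarrow> rinf) \<Rightarrow> bool" where
  "double_schubert C \<longleftrightarrow>
     is_Zt_basis W_inf C \<and>
     (\<forall>w\<in>W_inf. \<forall>i. ddiff_z i (C w) = (if len (w \<circ> gen_s i) < len w then C (w \<circ> gen_s i) else 0)) \<and>
     (\<forall>w\<in>W_inf. \<forall>i. ddiff_t i (C w) = (if len (gen_s i \<circ> w) < len w then C (gen_s i \<circ> w) else 0)) \<and>
     C id = 1 \<and>
     (\<forall>w\<in>W_inf. w \<noteq> id \<longrightarrow> constant_term (C w) = 0)"


section \<open>\<open>k\<close>-strict partitions\<close>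

text \<open>
  A partition in \<open>P_set k n\<close> is the list of its first \<open>n - k\<close> parts, zeros included.
\<close>

definition diagram :: "nat list \<Rightarrow> (nat \<times> nat) set" where
  "diagram lam = {(i, j). 1 \<le> i \<and> i \<le> length lam \<and> 1 \<le> j \<and> j \<le> lam ! (i - 1)}"

definition rectangle :: "nat \<Rightarrow> nat \<Rightarrow> (nat \<times> nat) set" where
  "rectangle a b = {1..a} \<times> {1..b}"

definition strict_partition :: "nat list \<Rightarrow> bool" where
  "strict_partition lam \<longleftrightarrow> sorted_wrt (\<ge>) lam \<and> distinct (filter (\<lambda>p. p \<noteq> 0) lam)"

definition k_strict_partition :: "nat \<Rightarrow> nat list \<Rightarrow> bool" where
  "k_strict_partition k lam \<longleftrightarrow> sorted_wrt (\<ge>) lam \<and> distinct (filter (\<lambda>p. p > k) lam)"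

definition P_set :: "nat \<Rightarrow> nat \<Rightarrow> nat list set" where
  "P_set k n = {lam. length lam = n - k \<and> k_strict_partition k lam \<and>
     diagram lam \<subseteq> rectangle (n - k) (n + k)}"

text \<open>
  For \<open>w \<in> W_k k n\<close> with one-line form \<open>v\<^sub>1 \<dots> v\<^sub>k | -\<zeta>\<^sub>1 \<dots> -\<zeta>\<^sub>s u\<^sub>1 \<dots> u\<^bsub>n-k-s\<^esub>\<close>, the value \<open>w (k + i)\<close>
  is \<open>- \<zeta>\<^sub>i\<close> if it is negative, and \<open>u\<^bsub>i-s\<^esub>\<close> otherwise; moreover \<open>w p = v\<^sub>p\<close> for \<open>p \<le> k\<close>.
\<close>

definition shape :: "nat \<Rightarrow> nat \<Rightarrow> (int \<Rightarrow> int) \<Rightarrow> nat list" where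
  "shape k n w = map (\<lambda>i. let a = w (int (k + i)) in
     if a < 0 then nat (- a) + k else card {p \<in> {1..k}. w (int p) > a}) [1..<n - k + 1]"

definition w_of :: "nat \<Rightarrow> nat \<Rightarrow> nat list \<Rightarrow> (int \<Rightarrow> int)" where
  "w_of k n = inv_into (W_k k n) (shape k n)"

definition chi :: "nat \<Rightarrow> nat \<Rightarrow> nat list \<Rightarrow> int list" where
  "chi k n lam = map (\<lambda>i. let a = w_of k n lam (int (k + i)) in
     if a < 0 then - a - 1 else - a) [1..<n - k + 1]"

definition Delta :: "nat \<Rightarrow> (nat \<times> nat) set" where
  "Delta m = {(i, j). 1 \<le> i \<and> i < j \<and> j \<le> m}"

definition D_set :: "nat \<Rightarrow> nat \<Rightarrow> nat list \<Rightarrow> (nat \<times> nat) set" where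
  "D_set k n lam = {(i, j) \<in> Delta (n - k). chi k n lam ! (i - 1) + chi k n lam ! (j - 1) < 0}"


section \<open>Theta polynomials and the multi Schur-Pfaffian\<close>

definition theta_ser :: "nat \<Rightarrow> int \<Rightarrow> rinf fps" where
  "theta_ser k l = Abs_fps Qpol * (\<Prod>i=1..k. fps_lin (zvar i)) *
     (if l \<ge> 0 then \<Prod>i=1..nat l. fps_lin (- tvar i) else \<Prod>i=1..nat (- l). fps_geom (- tvar i))"

definition theta :: "nat \<Rightarrow> int \<Rightarrow> int \<Rightarrow> rinf" where
  "theta k l r = (if r < 0 then 0 else fps_nth (theta_ser k l) (nat r))"

text \<open>
  The \<open>i\<close>-th list entry is the pair of the whole sequence \<open>c\<^sup>(\<^sup>i\<^sup>)\<close> and the index \<open>r\<^sub>i\<close>, so the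
  recursion expands formally in the \<open>c\<^sup>(\<^sup>i\<^sup>)\<close>. List positions count from 0, hence the shifted signs.
\<close>

function schur_pf :: "((int \<Rightarrow> 'a::comm_ring_1) \<times> int) list \<Rightarrow> 'a" where
  "schur_pf [] = 1"
| "schur_pf [(c, r)] = c r"
| "schur_pf [(c, r), (d, q)] = c r * d q + 2 * (\<Sum>s=1..nat q. (-1) ^ s * c (r + int s) * d (q - int s))"
| "schur_pf (x # y # v # ps) =
     (let xs = x # y # v # ps; m = length xs in
      if even m then
        (\<Sum>s\<in>{1..<m}. (-1) ^ (s + 1) * schur_pf [x, xs ! s] * schur_pf (tl (take s xs @ drop (s + 1) xs)))
      else
        (\<Sum>s\<in>{0..<m}. (-1) ^ s * (case xs ! s of (c, r) \<Rightarrow> c r) * schur_pf (take s xs @ drop (s + 1) xs)))"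
  by pat_completeness auto
termination
  by (relation "measure length") simp_all

end

theory Submission
  imports Defs
begin

text \<open>
  The divided differences act on theta polynomials by \<open>\<delta>\<^sub>i \<theta>\<^sub>r\<^sup>(\<^sup>l\<^sup>) = \<theta>\<^sub>r\<^sub>-\<^sub>1\<^sup>(\<^sup>l\<^sup>-\<^sup>1\<^sup>)\<close> if \<open>\<bar>l\<bar> = i\<close>, and by \<open>0\<close>
  otherwise. Consequently the raising operators \<open>1 + R\<^sub>i\<^sub>j\<close>, \<open>(i, j) \<in> D(\<lambda>)\<close>, applied to
  the Pfaffian with rows \<open>(\<lambda>\<^sub>i, \<chi>\<^sub>i)\<close> give a polynomial that satisfies the same left recursion as
  \<open>C\<^sub>w\<close>, for all \<open>k\<close>-Grassmannian \<open>w\<close>; it is the Pfaffian if \<open>D(\<lambda>)\<close> is empty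
  and the determinant if \<open>D(\<lambda>)\<close> contains all pairs. By induction on the length, the
  difference of the two is killed by all \<open>\<delta>\<^sub>i\<close>. Since the \<open>C\<^sub>w\<close> form a basis, such an element is
  determined by its localization at \<open>x = 0\<close>, \<open>z = t\<close>, which vanishes on both
  sides unless \<open>w\<close> is the identity.
\<close>

section \<open>Monomial substitutions in power series\<close>

text \<open>The difficulty lies in the ascents: if left multiplication by \<open>gen_s i\<close>
  lengthens w although some row has |chi| = i, then delta_i does shift that row, and the shifted
  raised Pfaffian has to vanish. The shifted row then either gets the same chi as the next one, or
  is a last row of negative index. Rows of equal chi cancel because the Pfaffian is antisymmetric up
  to coefficients of theta(u) theta(-u), a polynomial in u for nonnegative chi; for negative chi
  these coefficients survive and are cancelled by the factor 1 + R of the pair formed by the two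
  rows. The sign condition defining D(lambda) is forced by the remaining case: when rows with chi =
  i and chi = -i move together, their sum drops from 0 to -2 and delta_i yields two terms, which is
  what one additional factor 1 + R produces. The determinant is not extracted from the raised
  Pfaffian; it is checked against the same recursion, on those w for which every pair lies in
  D(lambda). \<open>s_z\<close> and \<open>omega\<close> are given by definite descriptions, so
  their existence has to be established too; substitutions of variables in power series provide
  it.\<close>

definition mon_map :: "('v \<Rightarrow> 'w) \<Rightarrow> ('v \<Rightarrow>\<^sub>0 nat) \<Rightarrow> ('w \<Rightarrow>\<^sub>0 nat)" where
  "mon_map \<tau> m = (\<Sum>v\<in>Poly_Mapping.keys m. Poly_Mapping.single (\<tau> v) (Poly_Mapping.lookup m v))"

definition mon_wt :: "('v \<Rightarrow> int) \<Rightarrow> ('v \<Rightarrow>\<^sub>0 nat) \<Rightarrow> int" where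
  "mon_wt c m = (\<Prod>v\<in>Poly_Mapping.keys m. c v ^ Poly_Mapping.lookup m v)"

lemma mon_map_superset:
  assumes "finite S" "Poly_Mapping.keys m \<subseteq> S"
  shows "mon_map \<tau> m = (\<Sum>v\<in>S. Poly_Mapping.single (\<tau> v) (Poly_Mapping.lookup m v))"
  unfolding mon_map_def by (rule sum.mono_neutral_left) (use assms in \<open>auto simp: in_keys_iff\<close>)

lemma mon_wt_superset:
  assumes "finite S" "Poly_Mapping.keys m \<subseteq> S"
  shows "mon_wt c m = (\<Prod>v\<in>S. c v ^ Poly_Mapping.lookup m v)"
  unfolding mon_wt_def by (rule prod.mono_neutral_left) (use assms in \<open>auto simp: in_keys_iff\<close>)

lemma mon_map_add: "mon_map \<tau> (a + b) = mon_map \<tau> a + mon_map \<tau> b"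
proof -
  let ?S = "Poly_Mapping.keys a \<union> Poly_Mapping.keys b"
  show ?thesis
    by (subst (1 2 3) mon_map_superset[of ?S])
      (auto simp: lookup_add single_add sum.distrib dest: subsetD[OF keys_add])
qed

lemma mon_wt_add: "mon_wt c (a + b) = mon_wt c a * mon_wt c b"
proof -
  let ?S = "Poly_Mapping.keys a \<union> Poly_Mapping.keys b"
  show ?thesis
    by (subst (1 2 3) mon_wt_superset[of ?S])
      (auto simp: lookup_add power_add prod.distrib dest: subsetD[OF keys_add])
qed

lemma mon_map_zero [simp]: "mon_map \<tau> 0 = 0" by (simp add: mon_map_def)
lemma mon_wt_zero [simp]: "mon_wt c 0 = 1" by (simp add: mon_wt_def)
lemma mon_map_single [simp]: "mon_map \<tau> (Poly_Mapping.single v n) = Poly_Mapping.single (\<tau> v) n"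
  by (subst mon_map_superset[of "{v}"]) auto
lemma mon_wt_single [simp]: "mon_wt c (Poly_Mapping.single v n) = c v ^ n"
  by (subst mon_wt_superset[of "{v}"]) auto

lemma mon_wt_nonzero: "mon_wt c m \<noteq> 0 \<longleftrightarrow> (\<forall>v\<in>Poly_Mapping.keys m. c v \<noteq> 0)"
  by (auto simp: mon_wt_def in_keys_iff)

lemma lookup_le_mon_map: "Poly_Mapping.lookup m v \<le> Poly_Mapping.lookup (mon_map \<tau> m) (\<tau> v)"
proof (cases "v \<in> Poly_Mapping.keys m")
  case True
  have "Poly_Mapping.lookup m v = Poly_Mapping.lookup (Poly_Mapping.single (\<tau> v) (Poly_Mapping.lookup m v)) (\<tau> v)"
    by simp
  also have "\<dots> \<le> (\<Sum>u\<in>Poly_Mapping.keys m. Poly_Mapping.lookup (Poly_Mapping.single (\<tau> u) (Poly_Mapping.lookup m u)) (\<tau> v))"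
    by (rule member_le_sum[OF True]) auto
  finally show ?thesis by (simp add: mon_map_def lookup_sum)
qed (simp add: in_keys_iff)

lemma mon_map_eq_0: "mon_map \<tau> m = 0 \<longleftrightarrow> m = 0"
proof
  assume "mon_map \<tau> m = 0"
  then have "Poly_Mapping.lookup m v = 0" for v
    using lookup_le_mon_map[of m v \<tau>] by simp
  then show "m = 0" by (intro poly_mapping_eqI) simp
qed simp

lemma finite_bounded_monomials:
  assumes "finite A"
  shows "finite {m :: 'v \<Rightarrow>\<^sub>0 nat. Poly_Mapping.keys m \<subseteq> A \<and> (\<forall>v\<in>A. Poly_Mapping.lookup m v \<le> B v)}"
    (is "finite ?S")
proof -
  let ?F = "{f. \<forall>x. (x \<in> A \<longrightarrow> f x \<in> (\<Union>y\<in>A. {..B y})) \<and> (x \<notin> A \<longrightarrow> f x = 0)}"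
  have "finite ?F"
    using assms by (intro finite_set_of_finite_funs finite_UN_I) simp_all
  moreover have "Poly_Mapping.lookup ` ?S \<subseteq> ?F"
    by (auto simp: in_keys_iff subset_iff)
  ultimately have "finite (Poly_Mapping.lookup ` ?S)"
    by (rule rev_finite_subset)
  then show ?thesis
    by (rule finite_imageD) (auto intro!: inj_onI simp: lookup_inject)
qed

text \<open>Replacing v by \<open>c v\<close> times \<open>\<tau> v\<close> makes sense on arbitrary
  power series when only finitely many variables with nonzero scalar land on each w, so that every
  coefficient of the image is a finite sum. Variables with scalar 0 are exempt, which admits setting
  x = 0.\<close>

definition subst_ok :: "('v \<Rightarrow> int) \<Rightarrow> ('v \<Rightarrow> 'w) \<Rightarrow> bool" where
  "subst_ok c \<tau> \<longleftrightarrow> (\<forall>w. finite {v. c v \<noteq> 0 \<and> \<tau> v = w})"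

definition fib :: "('v \<Rightarrow> int) \<Rightarrow> ('v \<Rightarrow> 'w) \<Rightarrow> ('w \<Rightarrow>\<^sub>0 nat) \<Rightarrow> ('v \<Rightarrow>\<^sub>0 nat) set" where
  "fib c \<tau> m = {m'. mon_wt c m' \<noteq> 0 \<and> mon_map \<tau> m' = m}"

text \<open>A contributing preimage of m is supported on the finitely many variables of nonzero
  scalar lying over the support of m, and its exponents are bounded by those of m.\<close>

lemma finite_fib:
  assumes "subst_ok c \<tau>"
  shows "finite (fib c \<tau> m)"
proof -
  let ?A = "\<Union>w\<in>Poly_Mapping.keys m. {v. c v \<noteq> 0 \<and> \<tau> v = w}"
  have "finite ?A" using assms by (auto simp: subst_ok_def)
  then have "finite {m' :: 'a \<Rightarrow>\<^sub>0 nat. Poly_Mapping.keys m' \<subseteq> ?A \<and>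
      (\<forall>v\<in>?A. Poly_Mapping.lookup m' v \<le> Poly_Mapping.lookup m (\<tau> v))}"
    by (rule finite_bounded_monomials)
  moreover have "fib c \<tau> m \<subseteq> {m'. Poly_Mapping.keys m' \<subseteq> ?A \<and>
      (\<forall>v\<in>?A. Poly_Mapping.lookup m' v \<le> Poly_Mapping.lookup m (\<tau> v))}"
  proof
    fix m' assume "m' \<in> fib c \<tau> m"
    then have wt: "\<forall>v\<in>Poly_Mapping.keys m'. c v \<noteq> 0" and m: "m = mon_map \<tau> m'"
      by (auto simp: fib_def mon_wt_nonzero)
    have le: "Poly_Mapping.lookup m' v \<le> Poly_Mapping.lookup m (\<tau> v)" for v
      unfolding m by (rule lookup_le_mon_map)
    have "v \<in> ?A" if "v \<in> Poly_Mapping.keys m'" for v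
      using wt that le[of v] by (auto simp: in_keys_iff)
    with le show "m' \<in> {m'. Poly_Mapping.keys m' \<subseteq> ?A \<and>
      (\<forall>v\<in>?A. Poly_Mapping.lookup m' v \<le> Poly_Mapping.lookup m (\<tau> v))}" by blast
  qed
  ultimately show ?thesis by (rule rev_finite_subset)
qed

definition msub :: "('v \<Rightarrow> int) \<Rightarrow> ('v \<Rightarrow> 'w) \<Rightarrow> ('v, int) mfps \<Rightarrow> ('w, int) mfps" where
  "msub c \<tau> f = Abs_mfps (\<lambda>m. \<Sum>m'\<in>fib c \<tau> m. mon_wt c m' * mcoeff f m')"

lemma mcoeff_msub: "mcoeff (msub c \<tau> f) m = (\<Sum>m'\<in>fib c \<tau> m. mon_wt c m' * mcoeff f m')"
  by (simp add: msub_def Abs_mfps_inverse)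

lemma fib_zero: "fib c \<tau> 0 = {0}"
  by (auto simp: fib_def mon_map_eq_0)

lemma mcoeff_msub_0 [simp]: "mcoeff (msub c \<tau> f) 0 = mcoeff f 0"
  by (simp add: mcoeff_msub fib_zero)

lemma msub_add: "msub c \<tau> (f + g) = msub c \<tau> f + msub c \<tau> g"
  by (rule mfps_eqI) (simp add: mcoeff_msub plus_mfps.rep_eq distrib_left sum.distrib)

lemma msub_zero [simp]: "msub c \<tau> 0 = 0"
  by (rule mfps_eqI) (simp add: mcoeff_msub zero_mfps.rep_eq)

text \<open>Factorizing a preimage of m amounts to factorizing m and choosing a preimage of each
  factor. Weights are multiplicative with integer values, hence nonzero on a product exactly when
  nonzero on both factors.\<close>

lemma msub_mult:
  assumes ok: "subst_ok c \<tau>"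
  shows "msub c \<tau> (f * g) = msub c \<tau> f * msub c \<tau> g"
proof (rule mfps_eqI)
  fix m
  let ?dec = "\<lambda>m. {(a, b). a + b = m}"
  have "mcoeff (msub c \<tau> (f * g)) m =
      (\<Sum>m'\<in>fib c \<tau> m. \<Sum>p\<in>?dec m'. mon_wt c (fst p + snd p) * (mcoeff f (fst p) * mcoeff g (snd p)))"
    unfolding mcoeff_msub times_mfps.rep_eq sum_distrib_left
    by (intro sum.cong refl) auto
  also have "\<dots> = (\<Sum>(m', p)\<in>Sigma (fib c \<tau> m) ?dec. mon_wt c (fst p + snd p) * (mcoeff f (fst p) * mcoeff g (snd p)))"
    by (rule sum.Sigma) (auto simp: finite_fib[OF ok] finite_monomial_factors)
  also have "\<dots> = (\<Sum>(q, p)\<in>Sigma (?dec m) (\<lambda>q. fib c \<tau> (fst q) \<times> fib c \<tau> (snd q)).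
      mon_wt c (fst p + snd p) * (mcoeff f (fst p) * mcoeff g (snd p)))"
    by (rule sum.reindex_bij_witness[where
          i = "\<lambda>(q, p). (fst p + snd p, p)" and j = "\<lambda>(m', p). ((mon_map \<tau> (fst p), mon_map \<tau> (snd p)), p)"])
       (auto simp: fib_def mon_map_add mon_wt_add)
  also have "\<dots> = (\<Sum>q\<in>?dec m. \<Sum>p\<in>fib c \<tau> (fst q) \<times> fib c \<tau> (snd q).
      mon_wt c (fst p + snd p) * (mcoeff f (fst p) * mcoeff g (snd p)))"
    by (rule sum.Sigma[symmetric]) (auto simp: finite_fib[OF ok] finite_monomial_factors)
  also have "\<dots> = (\<Sum>q\<in>?dec m. mcoeff (msub c \<tau> f) (fst q) * mcoeff (msub c \<tau> g) (snd q))"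
    unfolding mcoeff_msub sum_product sum.cartesian_product
    by (intro sum.cong refl) (auto simp: mon_wt_add mult_ac)
  finally show "mcoeff (msub c \<tau> (f * g)) m = mcoeff (msub c \<tau> f * msub c \<tau> g) m"
    by (simp add: times_mfps.rep_eq case_prod_unfold)
qed

lemma msub_one [simp]:
  assumes ok: "subst_ok c \<tau>"
  shows "msub c \<tau> 1 = 1"
proof (rule mfps_eqI)
  fix m
  have "mcoeff (msub c \<tau> 1) m = (\<Sum>m'\<in>fib c \<tau> m. if m' = 0 then 1 else 0)"
    unfolding mcoeff_msub by (rule sum.cong) (auto simp: one_mfps.rep_eq)
  also have "\<dots> = mcoeff 1 m"
    using finite_fib[OF ok, of m] by (simp add: one_mfps.rep_eq sum.delta) (auto simp: fib_def)
  finally show "mcoeff (msub c \<tau> 1) m = mcoeff 1 m" .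
qed

lemma msub_mvar:
  assumes ok: "subst_ok c \<tau>"
  shows "msub c \<tau> (mvar v) = of_int (c v) * mvar (\<tau> v)"
proof (rule mfps_eqI)
  have of_int: "mcoeff (of_int i * f) m = i * mcoeff f m" for i and f :: "('x, int) mfps" and m
  proof -
    have nat: "mcoeff (of_nat j * f) m = int j * mcoeff f m" for j
      by (induction j) (simp_all add: distrib_right plus_mfps.rep_eq zero_mfps.rep_eq)
    show ?thesis
      by (cases i rule: int_cases2) (simp_all add: nat uminus_mfps.rep_eq)
  qed
  fix m
  have "mcoeff (msub c \<tau> (mvar v)) m = (\<Sum>m'\<in>fib c \<tau> m. if m' = Poly_Mapping.single v 1 then c v else 0)"
    unfolding mcoeff_msub by (rule sum.cong) (auto simp: mvar.rep_eq)
  also have "\<dots> = c v * mcoeff (mvar (\<tau> v)) m"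
    using finite_fib[OF ok, of m] by (simp add: mvar.rep_eq sum.delta) (auto simp: fib_def)
  finally show "mcoeff (msub c \<tau> (mvar v)) m = mcoeff (of_int (c v) * mvar (\<tau> v)) m"
    by (simp add: of_int)
qed

section \<open>Coefficientwise limits\<close>

text \<open>The sense in which \<open>Qser r\<close> is a limit of the finite products
  \<open>Qfin N r\<close>: each coefficient becomes constant. Products and substitutions respect
  such limits, so identities between finite products carry over to Q.\<close>

definition mlim :: "(nat \<Rightarrow> ('v, 'a::comm_ring_1) mfps) \<Rightarrow> ('v, 'a) mfps \<Rightarrow> bool" where
  "mlim F f \<longleftrightarrow> (\<forall>m. eventually (\<lambda>N. mcoeff (F N) m = mcoeff f m) sequentially)"

lemma mlim_unique: "mlim F f \<Longrightarrow> mlim F g \<Longrightarrow> f = g"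
proof (rule mfps_eqI)
  fix m assume "mlim F f" "mlim F g"
  then have "eventually (\<lambda>N. mcoeff (F N) m = mcoeff f m) sequentially" "eventually (\<lambda>N. mcoeff (F N) m = mcoeff g m) sequentially"
    unfolding mlim_def by blast+
  then have "eventually (\<lambda>N. mcoeff f m = mcoeff g m) sequentially"
    by eventually_elim simp
  then show "mcoeff f m = mcoeff g m" by simp
qed

lemma mlim_const: "mlim (\<lambda>_. f) f" by (simp add: mlim_def)

lemma mlim_Suc: "mlim (\<lambda>N. F (Suc N)) f \<longleftrightarrow> mlim F f"
  unfolding mlim_def by (subst eventually_sequentially_Suc) (rule refl)

lemma mlim_add:
  fixes f g :: "('v, 'a::comm_ring_1) mfps"
  assumes "mlim F f" "mlim G g"
  shows "mlim (\<lambda>N. F N + G N) (f + g)"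
  unfolding mlim_def
proof
  fix m :: "'v \<Rightarrow>\<^sub>0 nat"
  have "eventually (\<lambda>N. mcoeff (F N) m = mcoeff f m) sequentially"
    "eventually (\<lambda>N. mcoeff (G N) m = mcoeff g m) sequentially"
    using assms by (simp_all add: mlim_def)
  then show "eventually (\<lambda>N. mcoeff (F N + G N) m = mcoeff (f + g) m) sequentially"
    by eventually_elim (simp add: plus_mfps.rep_eq)
qed

lemma mlim_mult: 
  fixes f g :: "('a, 'b::comm_ring_1) mfps"
  assumes "mlim F f" "mlim G g" 
  shows "mlim (\<lambda>N. F N * G N) (f * g)"
  unfolding mlim_def
proof
  fix m :: "'a \<Rightarrow>\<^sub>0 nat"
  let ?dec = "{(a, b). a + b = m}"
  have "eventually (\<lambda>N. \<forall>p\<in>?dec. mcoeff (F N) (fst p) = mcoeff f (fst p) \<and> mcoeff (G N) (snd p) = mcoeff g (snd p)) sequentially"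
    using assms by (intro eventually_ball_finite finite_monomial_factors ballI eventually_conj) (auto simp: mlim_def)
  then show "eventually (\<lambda>N. mcoeff (F N * G N) m = mcoeff (f * g) m) sequentially"
    by eventually_elim (auto simp: times_mfps.rep_eq intro!: sum.cong)
qed

lemma mlim_sum: "(\<And>i. i \<in> A \<Longrightarrow> mlim (\<lambda>N. F N i) (f i)) \<Longrightarrow> mlim (\<lambda>N. \<Sum>i\<in>A. F N i) (\<Sum>i\<in>A. f i)"
  by (induction A rule: infinite_finite_induct) (auto intro: mlim_const mlim_add)

lemma mlim_msub:
  assumes "subst_ok c \<tau>" "mlim F f" 
  shows "mlim (\<lambda>N. msub c \<tau> (F N)) (msub c \<tau> f)"
  unfolding mlim_def
proof
  fix m
  have "eventually (\<lambda>N. \<forall>p\<in>fib c \<tau> m. mcoeff (F N) p = mcoeff f p) sequentially"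
    using assms by (intro eventually_ball_finite finite_fib) (auto simp: mlim_def)
  then show "eventually (\<lambda>N. mcoeff (msub c \<tau> (F N)) m = mcoeff (msub c \<tau> f) m) sequentially"
    by eventually_elim (auto simp: mcoeff_msub intro!: sum.cong)
qed

lemma mcoeff_mult_mvar:
  "mcoeff (f * mvar v) m = (if Poly_Mapping.lookup m v = 0 then 0 else mcoeff f (m - Poly_Mapping.single v 1))"
proof -
  let ?dec = "{(a, b). a + b = m}"
  have "mcoeff (f * mvar v) m = (\<Sum>p\<in>?dec. if snd p = Poly_Mapping.single v 1 then mcoeff f (fst p) else 0)"
    unfolding times_mfps.rep_eq by (rule sum.cong) (auto simp: mvar.rep_eq)
  also have "\<dots> = (\<Sum>p\<in>{p\<in>?dec. snd p = Poly_Mapping.single v 1}. mcoeff f (fst p))"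
    by (rule sum.inter_filter[symmetric]) (rule finite_monomial_factors)
  also have "\<dots> = (if Poly_Mapping.lookup m v = 0 then 0 else mcoeff f (m - Poly_Mapping.single v 1))"
  proof (cases "Poly_Mapping.lookup m v = 0")
    case True
    then have "{p\<in>?dec. snd p = Poly_Mapping.single v 1} = {}"
      by (auto simp: lookup_add)
    then show ?thesis using True by (simp only: sum.empty if_True refl)
  next
    case False
    have "(m - Poly_Mapping.single v 1) + Poly_Mapping.single v 1 = m"
      by (rule poly_mapping_eqI) (use False in \<open>auto simp: lookup_add lookup_minus lookup_single when_def\<close>)
    then have "{p\<in>?dec. snd p = Poly_Mapping.single v 1} = {(m - Poly_Mapping.single v 1, Poly_Mapping.single v 1)}"
      by auto
    then show ?thesis using False by (simp only: sum.insert sum.empty finite.emptyI empty_iff not_False_eq_True fst_conv add_0_right if_False refl)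
  qed
  finally show ?thesis .
qed

section \<open>Ring homomorphisms\<close>

text \<open>Unlike \<open>ring_aut\<close>, this asks for no bijectivity and allows two different
  rings, so that it also covers substitutions, the embedding \<open>series_of\<close>, the
  localization \<open>ev\<close> and the induced maps on power series in u.\<close>

definition rhom :: "('a::comm_ring_1 \<Rightarrow> 'b::comm_ring_1) \<Rightarrow> bool" where
  "rhom h \<longleftrightarrow> h 1 = 1 \<and> (\<forall>a b. h (a + b) = h a + h b) \<and> (\<forall>a b. h (a * b) = h a * h b)"

lemma rhom_one: "rhom h \<Longrightarrow> h 1 = 1"
  and rhom_add: "rhom h \<Longrightarrow> h (a + b) = h a + h b"
  and rhom_mult: "rhom h \<Longrightarrow> h (a * b) = h a * h b"
  by (simp_all add: rhom_def)

lemma rhom_zero: "rhom h \<Longrightarrow> h 0 = 0"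
  using rhom_add[of h 0 0] by simp

lemma rhom_uminus: "rhom h \<Longrightarrow> h (- a) = - h a"
  using rhom_add[of h a "- a"] by (simp add: rhom_zero eq_neg_iff_add_eq_0 add.commute)

lemma rhom_diff: "rhom h \<Longrightarrow> h (a - b) = h a - h b"
  using rhom_add[of h a "- b"] by (simp add: rhom_uminus)

lemma rhom_sum: "rhom h \<Longrightarrow> h (sum f A) = (\<Sum>i\<in>A. h (f i))"
  by (induction A rule: infinite_finite_induct) (auto simp: rhom_zero rhom_add)

lemma rhom_prod: "rhom h \<Longrightarrow> h (prod f A) = (\<Prod>i\<in>A. h (f i))"
  by (induction A rule: infinite_finite_induct) (auto simp: rhom_one rhom_mult)

lemma rhom_power: "rhom h \<Longrightarrow> h (a ^ n) = h a ^ n"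
  by (induction n) (auto simp: rhom_one rhom_mult)

lemma rhom_numeral: "rhom h \<Longrightarrow> h (numeral n) = numeral n"
proof -
  assume h: "rhom h"
  have "h (of_nat k) = of_nat k" for k
    by (induction k) (auto simp: rhom_zero[OF h] rhom_one[OF h] rhom_add[OF h])
  from this[of "numeral n"] show ?thesis by simp
qed

lemmas rhom_simps = rhom_one rhom_add rhom_mult rhom_zero rhom_uminus rhom_diff rhom_sum
  rhom_prod rhom_power rhom_numeral

lemma rhom_comp: "rhom f \<Longrightarrow> rhom g \<Longrightarrow> rhom (f \<circ> g)"
  by (simp add: rhom_def)

lemma rhom_id: "rhom (\<lambda>x. x)"
  by (simp add: rhom_def)

lemma subring_gen_hom:
  assumes "rhom h" "\<And>g. g \<in> G \<Longrightarrow> h g \<in> subring_gen G'" "f \<in> subring_gen G"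
  shows "h f \<in> subring_gen G'"
  using assms(3)
  by induction (auto simp: rhom_simps[OF assms(1)] assms(2) intro: subring_gen.intros)

section \<open>Homomorphisms acting on power series in u, and the linear and geometric
  factors\<close>

definition fps_map :: "('a \<Rightarrow> 'b) \<Rightarrow> 'a fps \<Rightarrow> 'b::zero fps" where
  "fps_map h f = Abs_fps (\<lambda>n. h (fps_nth f n))"

lemma fps_nth_map [simp]: "fps_nth (fps_map h f) n = h (fps_nth f n)"
  by (simp add: fps_map_def)

lemma rhom_fps_map:
  assumes "rhom h"
  shows "rhom (fps_map h)"
  unfolding rhom_def
  by (auto simp: fps_eq_iff fps_mult_nth rhom_simps[OF assms])

lemma fps_map_X: "rhom h \<Longrightarrow> fps_map h fps_X = fps_X"
  by (auto simp: fps_eq_iff fps_X_def rhom_simps)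

lemma fps_map_const: "rhom h \<Longrightarrow> fps_map h (fps_const a) = fps_const (h a)"
  by (auto simp: fps_eq_iff rhom_simps)

lemma fps_map_lin: "rhom h \<Longrightarrow> fps_map h (fps_lin a) = fps_lin (h a)"
  by (simp add: fps_lin_def rhom_simps[OF rhom_fps_map] fps_map_X fps_map_const)

lemma fps_map_geom: "rhom h \<Longrightarrow> fps_map h (fps_geom a) = fps_geom (h a)"
  by (simp add: fps_geom_def fps_eq_iff rhom_simps)

lemma fps_lin_0 [simp]: "fps_lin 0 = 1"
  by (simp add: fps_lin_def)

lemma fps_geom_0 [simp]: "fps_geom 0 = 1"
  using fps_geom_inverse[of 0] by simp

lemma fps_lin_mult_geom: "fps_lin a * fps_geom (- a) = 1"
  using fps_geom_inverse[of "- a"] by simp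

text \<open>(1 + au)/(1 - au) is 1 plus a multiple of 2a. The factor a explains why the coefficients
  of Q stabilize, the factor 2a why s_0 changes Q by a multiple of the root 2 z_1.\<close>

lemma fps_lin_geom_eq: "fps_lin a * fps_geom a = 1 + 2 * (fps_const a * (fps_X * fps_geom a))"
proof -
  have "fps_geom a = 1 + fps_const a * (fps_X * fps_geom a)"
    using fps_geom_inverse[of a] by (simp add: fps_lin_def algebra_simps fps_const_neg[symmetric] del: fps_const_neg)
  then show ?thesis
    by (simp add: fps_lin_def algebra_simps)
qed

section \<open>The series \<open>Q\<^sub>r\<close>\<close>

definition Qprod :: "nat \<Rightarrow> (var, int) mfps fps" where
  "Qprod N = (\<Prod>i=1..N. fps_lin (mvar (X i)) * fps_geom (mvar (X i)))"

lemma Qfin_eq: "Qfin N r = fps_nth (Qprod N) r"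
  by (simp add: Qfin_def Qprod_def)

lemma Qprod_Suc: "Qprod (Suc N) = Qprod N * (fps_lin (mvar (X (Suc N))) * fps_geom (mvar (X (Suc N))))"
  by (simp add: Qprod_def)

lemma Qfin_Suc_coeff:
  assumes "Poly_Mapping.lookup m (X (Suc N)) = 0"
  shows "mcoeff (Qfin (Suc N) r) m = mcoeff (Qfin N r) m"
proof -
  let ?x = "mvar (X (Suc N)) :: (var, int) mfps"
  have "Qprod (Suc N) = Qprod N + fps_const ?x * (2 * (Qprod N * (fps_X * fps_geom ?x)))"
    by (simp only: Qprod_Suc fps_lin_geom_eq) (simp add: algebra_simps)
  then have "Qfin (Suc N) r = Qfin N r + ?x * fps_nth (2 * (Qprod N * (fps_X * fps_geom ?x))) r"
    unfolding Qfin_eq by (simp only: fps_add_nth fps_mult_left_const_nth)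
  then show ?thesis
    using assms by (simp add: plus_mfps.rep_eq mcoeff_mult_mvar mult.commute[of ?x])
qed

text \<open>The factor for x_(N+1) affects only coefficients of monomials containing x_(N+1). A
  monomial contains finitely many variables, so beyond the largest index nothing changes; the
  eventual value is the one that \<open>Qser\<close> picks.\<close>

lemma mlim_Qfin: "mlim (\<lambda>N. Qfin N r) (Qser r)"
  unfolding mlim_def
proof
  fix m :: "var \<Rightarrow>\<^sub>0 nat"
  have "finite (X -` Poly_Mapping.keys m)"
    by (intro finite_vimageI) (auto simp: inj_def)
  then obtain N0 where N0: "\<And>i. X i \<in> Poly_Mapping.keys m \<Longrightarrow> i \<le> N0"
    by (metis finite_nat_set_iff_bounded_le vimageI)
  have stable: "mcoeff (Qfin (N0 + d) r) m = mcoeff (Qfin N0 r) m" for d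
  proof (induction d)
    case (Suc d)
    have "X (Suc (N0 + d)) \<notin> Poly_Mapping.keys m"
      using N0[of "Suc (N0 + d)"] by auto
    then show ?case using Suc Qfin_Suc_coeff[of m "N0 + d" r] by (simp add: in_keys_iff)
  qed simp
  have ev: "eventually (\<lambda>N. mcoeff (Qfin N r) m = mcoeff (Qfin N0 r) m) sequentially"
    unfolding eventually_sequentially by (metis stable le_Suc_ex)
  moreover have "mcoeff (Qser r) m = mcoeff (Qfin N0 r) m"
    unfolding Qser_def Abs_mfps_inverse[OF UNIV_I]
  proof (rule the_equality, rule ev)
    fix c assume "eventually (\<lambda>N. mcoeff (Qfin N r) m = c) sequentially"
    with ev have "eventually (\<lambda>N. c = mcoeff (Qfin N0 r) m) sequentially"
      by eventually_elim simp
    then show "c = mcoeff (Qfin N0 r) m" by simp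
  qed
  ultimately show "eventually (\<lambda>N. mcoeff (Qfin N r) m = mcoeff (Qser r) m) sequentially"
    by simp
qed

definition flim :: "(nat \<Rightarrow> ('v, int) mfps fps) \<Rightarrow> ('v, int) mfps fps \<Rightarrow> bool" where
  "flim F f \<longleftrightarrow> (\<forall>r. mlim (\<lambda>N. fps_nth (F N) r) (fps_nth f r))"

lemma flim_unique: "flim F f \<Longrightarrow> flim F g \<Longrightarrow> f = g"
  by (auto simp: flim_def fps_eq_iff intro: mlim_unique)

lemma flim_const: "flim (\<lambda>_. f) f"
  by (simp add: flim_def mlim_const)

lemma flim_mult: "flim F f \<Longrightarrow> flim G g \<Longrightarrow> flim (\<lambda>N. F N * G N) (f * g)"
  by (auto simp: flim_def fps_mult_nth intro!: mlim_sum mlim_mult)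

lemma flim_Qprod: "flim Qprod (Abs_fps Qser)"
  using mlim_Qfin by (simp add: flim_def Qfin_eq)

lemma flim_msub: "subst_ok c \<tau> \<Longrightarrow> flim F f \<Longrightarrow> flim (\<lambda>N. fps_map (msub c \<tau>) (F N)) (fps_map (msub c \<tau>) f)"
  by (auto simp: flim_def intro: mlim_msub)

lemma flim_Suc: "flim F f \<Longrightarrow> flim (\<lambda>N. F (Suc N)) f"
  unfolding flim_def using mlim_Suc[of "\<lambda>N. fps_nth (F N) r" for r] by blast

lemma rhom_msub: "subst_ok c \<tau> \<Longrightarrow> rhom (msub c \<tau>)"
  by (simp add: rhom_def msub_add msub_mult)

lemma fps_map_msub_Qprod:
  assumes ok: "subst_ok c \<tau>"
  shows "fps_map (msub c \<tau>) (Qprod N) =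
    (\<Prod>i=1..N. fps_lin (of_int (c (X i)) * mvar (\<tau> (X i))) * fps_geom (of_int (c (X i)) * mvar (\<tau> (X i))))"
  unfolding Qprod_def
  by (simp add: rhom_simps[OF rhom_fps_map[OF rhom_msub[OF ok]]] fps_map_lin fps_map_geom rhom_msub[OF ok] msub_mvar[OF ok])

lemma msub_Q_fixed:
  assumes ok: "subst_ok c \<tau>" and "\<And>i. c (X i) = 1" "\<And>i. \<tau> (X i) = X i"
  shows "msub c \<tau> (Qser r) = Qser r"
proof -
  have "fps_map (msub c \<tau>) (Qprod N) = Qprod N" for N
    unfolding fps_map_msub_Qprod[OF ok] by (simp add: assms(2,3) Qprod_def)
  then have "flim Qprod (fps_map (msub c \<tau>) (Abs_fps Qser))"
    using flim_msub[OF ok flim_Qprod] by simp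
  then have "fps_map (msub c \<tau>) (Abs_fps Qser) = Abs_fps Qser"
    using flim_unique flim_Qprod by blast
  then show ?thesis by (simp add: fps_eq_iff)
qed

text \<open>Relabelling x_2, x_3, ... as x_1, x_2, ... reproduces the infinite product and frees its
  first factor for the image of x_1. At a finite stage, N + 1 factors become the new factor times N
  factors, whence the passage to the limit.\<close>

lemma msub_Q_shift:
  assumes ok: "subst_ok c \<tau>" and "\<And>i. c (X i) = 1" "\<And>i. i \<ge> 1 \<Longrightarrow> \<tau> (X (Suc i)) = X i"
  shows "fps_map (msub c \<tau>) (Abs_fps Qser) =
    fps_lin (mvar (\<tau> (X 1))) * fps_geom (mvar (\<tau> (X 1))) * Abs_fps Qser"
proof -
  let ?L = "fps_lin (mvar (\<tau> (X 1))) * fps_geom (mvar (\<tau> (X 1))) :: (_, int) mfps fps"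
  have eq: "fps_map (msub c \<tau>) (Qprod (Suc N)) = ?L * Qprod N" for N
  proof -
    have "fps_map (msub c \<tau>) (Qprod (Suc N)) =
      ?L * (\<Prod>i=Suc 1..Suc N. fps_lin (mvar (\<tau> (X i))) * fps_geom (mvar (\<tau> (X i))))"
      unfolding fps_map_msub_Qprod[OF ok] by (subst prod.atLeast_Suc_atMost) (simp_all add: assms(2))
    also have "(\<Prod>i=Suc 1..Suc N. fps_lin (mvar (\<tau> (X i))) * fps_geom (mvar (\<tau> (X i)))) = (Qprod N :: _ fps)"
      unfolding prod.shift_bounds_cl_Suc_ivl Qprod_def by (intro prod.cong) (auto simp: assms(3))
    finally show ?thesis .
  qed
  have "flim (\<lambda>N. ?L * Qprod N) (fps_map (msub c \<tau>) (Abs_fps Qser))"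
    using flim_Suc[OF flim_msub[OF ok flim_Qprod]] unfolding eq .
  then show ?thesis
    using flim_unique flim_mult[OF flim_const flim_Qprod] by blast
qed

lemma msub_Q_zero:
  assumes ok: "subst_ok c \<tau>" and "\<And>i. c (X i) = 0"
  shows "fps_map (msub c \<tau>) (Abs_fps Qser) = 1"
proof -
  have "flim (\<lambda>N. 1) (fps_map (msub c \<tau>) (Abs_fps Qser))"
    using flim_msub[OF ok flim_Qprod] assms(2)
    by (simp add: fps_map_msub_Qprod[OF ok])
  then show ?thesis using flim_unique flim_const by blast
qed

text \<open>The substitution of -u for u, needed for products f(u) f(-u).\<close>

definition fps_alt :: "'a::comm_ring_1 fps \<Rightarrow> 'a fps" where
  "fps_alt f = Abs_fps (\<lambda>n. (-1) ^ n * fps_nth f n)"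

lemma fps_nth_alt [simp]: "fps_nth (fps_alt f) n = (-1) ^ n * fps_nth f n"
  by (simp add: fps_alt_def)

lemma rhom_fps_alt: "rhom fps_alt"
proof -
  have "fps_alt (a * b) = fps_alt a * fps_alt b" for a b :: "'a fps"
  proof (rule fps_ext)
    fix n
    have "(-1) ^ n * (fps_nth a i * fps_nth b (n - i)) = (-1) ^ i * fps_nth a i * ((-1) ^ (n - i) * fps_nth b (n - i))"
      if "i \<le> n" for i
    proof -
      have "(-1) ^ n = (-1) ^ i * (-1 :: 'a) ^ (n - i)"
        using that by (simp flip: power_add)
      then show ?thesis by (simp add: mult_ac)
    qed
    then show "fps_nth (fps_alt (a * b)) n = fps_nth (fps_alt a * fps_alt b) n"
      by (simp add: fps_mult_nth sum_distrib_left)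
  qed
  then show ?thesis
    by (auto simp: rhom_def fps_eq_iff distrib_left)
qed

lemma fps_alt_lin: "fps_alt (fps_lin a) = fps_lin (- a)"
  by (auto simp: fps_eq_iff fps_lin_def fps_X_def)

lemma fps_alt_geom: "fps_alt (fps_geom a) = fps_geom (- a)"
  by (auto simp: fps_eq_iff fps_geom_def power_minus[of a])

text \<open>Each factor (1 + xu)/(1 - xu) is inverted by u -> -u. This relation among the Q_r is
  what later makes theta(u) theta(-u) a polynomial.\<close>

lemma Qser_alt: "Abs_fps Qser * fps_alt (Abs_fps Qser) = 1"
proof -
  have factor: "fps_lin a * fps_geom a * fps_alt (fps_lin a * fps_geom a) = 1" for a :: "(var, int) mfps"
  proof -
    have "fps_lin a * fps_geom a * fps_alt (fps_lin a * fps_geom a) =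
        (fps_lin a * fps_geom (- a)) * (fps_lin (- a) * fps_geom a)"
      unfolding rhom_mult[OF rhom_fps_alt] fps_alt_lin fps_alt_geom by (simp only: mult_ac)
    then show ?thesis by (simp add: fps_geom_inverse fps_lin_mult_geom)
  qed
  have "Qprod N * fps_alt (Qprod N) = 1" for N
    unfolding Qprod_def rhom_prod[OF rhom_fps_alt] by (simp only: factor prod.distrib[symmetric] prod.neutral_const)
  moreover have "flim (\<lambda>N. fps_alt (Qprod N)) (fps_alt (Abs_fps Qser))"
    using flim_Qprod by (auto simp: flim_def intro!: mlim_mult mlim_const)
  ultimately have "flim (\<lambda>N. 1) (Abs_fps Qser * fps_alt (Abs_fps Qser))"
    using flim_mult[OF flim_Qprod] by (metis (no_types, lifting) ext)
  then show ?thesis using flim_unique flim_const by blast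
qed

lemma Qser_0: "Qser 0 = 1"
proof -
  have "Qfin N 0 = 1" for N
    unfolding Qfin_eq Qprod_def
    by (induction N) (simp_all add: fps_lin_def fps_geom_def)
  then have "mlim (\<lambda>N. 1) (Qser 0)" using mlim_Qfin[of 0] by simp
  then show ?thesis using mlim_unique mlim_const by blast
qed

section \<open>Automorphisms of \<open>R\<^sub>\<infinity>\<close>\<close>

definition rgens :: "(var, int) mfps set" where
  "rgens = range Qser \<union> {mvar (Z i) | i. i \<ge> 1} \<union> {mvar (T i) | i. i \<ge> 1}"

lemma series_of_in: "series_of f \<in> subring_gen rgens"
  using series_of[of f] by (simp add: rgens_def)

lemma series_of_Abs: "x \<in> subring_gen rgens \<Longrightarrow> series_of (Abs_rinf x) = x"
  by (simp add: Abs_rinf_inverse rgens_def)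

lemmas series_of_simps = zero_rinf.rep_eq one_rinf.rep_eq plus_rinf.rep_eq uminus_rinf.rep_eq
  minus_rinf.rep_eq times_rinf.rep_eq

lemma rhom_series_of: "rhom series_of"
  by (simp add: rhom_def series_of_simps)

lemma zvar_0 [simp]: "zvar 0 = 0" and tvar_0 [simp]: "tvar 0 = 0"
  by (transfer; simp)+

lemma series_of_zvar: "i \<ge> 1 \<Longrightarrow> series_of (zvar i) = mvar (Z i)"
  and series_of_tvar: "i \<ge> 1 \<Longrightarrow> series_of (tvar i) = mvar (T i)"
  by (simp_all add: zvar.rep_eq tvar.rep_eq)

lemma rinf_induct [case_names one Q z t diff mult]:
  assumes "P 1" "\<And>r. P (Qpol r)" "\<And>i. i \<ge> 1 \<Longrightarrow> P (zvar i)" "\<And>i. i \<ge> 1 \<Longrightarrow> P (tvar i)"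
    "\<And>a b. P a \<Longrightarrow> P b \<Longrightarrow> P (a - b)" "\<And>a b. P a \<Longrightarrow> P b \<Longrightarrow> P (a * b)"
  shows "P f"
proof -
  have "P (Abs_rinf x)" if "x \<in> subring_gen rgens" for x
    using that
  proof induction
    case one
    have "Abs_rinf 1 = 1" by (simp add: series_of_inject[symmetric] series_of_Abs subring_gen.one series_of_simps)
    then show ?case using assms(1) by simp
  next
    case (gen g)
    then consider r where "g = Qser r" | i where "i \<ge> 1" "g = mvar (Z i)" | i where "i \<ge> 1" "g = mvar (T i)"
      by (auto simp: rgens_def)
    then show ?case
    proof cases
      case 1
      then have "Abs_rinf g = Qpol r"
        using gen by (simp add: series_of_inject[symmetric] series_of_Abs subring_gen.gen Qpol.rep_eq)
      then show ?thesis using assms by simp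
    next
      case 2
      then have "Abs_rinf g = zvar i"
        using gen by (simp add: series_of_inject[symmetric] series_of_Abs subring_gen.gen zvar.rep_eq)
      then show ?thesis using assms 2 by simp
    next
      case 3
      then have "Abs_rinf g = tvar i"
        using gen by (simp add: series_of_inject[symmetric] series_of_Abs subring_gen.gen tvar.rep_eq)
      then show ?thesis using assms 3 by simp
    qed
  next
    case (diff a b)
    then have "Abs_rinf (a - b) = Abs_rinf a - Abs_rinf b"
      by (simp add: series_of_inject[symmetric] series_of_Abs subring_gen.diff series_of_simps)
    then show ?case using assms diff by simp
  next
    case (mult a b)
    then have "Abs_rinf (a * b) = Abs_rinf a * Abs_rinf b"
      by (simp add: series_of_inject[symmetric] series_of_Abs subring_gen.mult series_of_simps)
    then show ?case using assms mult by simp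
  qed
  from this[OF series_of_in[of f]] show ?thesis by (simp add: series_of_inverse)
qed

lemma rhom_rinf_eqI:
  assumes "rhom f" "rhom g" "\<And>r. f (Qpol r) = g (Qpol r)"
    "\<And>i. i \<ge> 1 \<Longrightarrow> f (zvar i) = g (zvar i)" "\<And>i. i \<ge> 1 \<Longrightarrow> f (tvar i) = g (tvar i)"
  shows "f = g"
proof
  fix x show "f x = g x"
    by (induction x rule: rinf_induct) (simp_all add: assms rhom_simps[OF assms(1)] rhom_simps[OF assms(2)])
qed

text \<open>If a substitution sends the generators into the ring, it does so with every element and
  descends to \<open>rinf\<close>. Existence of the maps described by \<open>omega\<close> and
  \<open>s_z\<close> is obtained in this way, uniqueness from \<open>rhom_rinf_eqI\<close>.\<close>

definition rlift :: "(var \<Rightarrow> int) \<Rightarrow> (var \<Rightarrow> var) \<Rightarrow> rinf \<Rightarrow> rinf" where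
  "rlift c \<tau> f = Abs_rinf (msub c \<tau> (series_of f))"

locale rsubst =
  fixes c :: "var \<Rightarrow> int" and \<tau> :: "var \<Rightarrow> var"
  assumes ok: "subst_ok c \<tau>"
    and closed: "\<And>g. g \<in> rgens \<Longrightarrow> msub c \<tau> g \<in> subring_gen rgens"
begin

lemma series_of_rlift: "series_of (rlift c \<tau> f) = msub c \<tau> (series_of f)"
  unfolding rlift_def
  by (rule series_of_Abs, rule subring_gen_hom[OF rhom_msub[OF ok] closed series_of_in])

lemma rhom_rlift: "rhom (rlift c \<tau>)"
  unfolding rhom_def
  by (simp add: series_of_inject[symmetric] series_of_rlift series_of_simps rhom_simps[OF rhom_msub[OF ok]])

end

lemma rhom_invol_aut:
  assumes "rhom f" "\<And>x. f (f x) = x"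
  shows "ring_aut f"
proof -
  have "bij f" using assms(2) by (rule involuntory_imp_bij)
  then show ?thesis using assms(1) by (simp add: ring_aut_def rhom_def)
qed

lemma ring_aut_rhom: "ring_aut f \<Longrightarrow> rhom f"
  by (simp add: ring_aut_def rhom_def)

fun om_c :: "var \<Rightarrow> int" where "om_c (X i) = 1" | "om_c (Z i) = -1" | "om_c (T i) = -1"
fun om_t :: "var \<Rightarrow> var" where "om_t (X i) = X i" | "om_t (Z i) = T i" | "om_t (T i) = Z i"

fun sw_t :: "nat \<Rightarrow> var \<Rightarrow> var" where
  "sw_t i (X j) = X j" | "sw_t i (Z j) = Z (transpose i (i + 1) j)" | "sw_t i (T j) = T j"

text \<open>s_0 as a substitution: z_1 becomes -z_1, while x_1 becomes z_1 and each later x_i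
  becomes x_(i-1), so that Q acquires exactly the factor (1 + z_1 u)/(1 - z_1 u). On power series
  this map is no involution; it is one on the subring \<open>rinf\<close>.\<close>

definition s0_c :: "var \<Rightarrow> int" where "s0_c v = (if v = Z 1 then -1 else 1)"
fun s0_t :: "var \<Rightarrow> var" where
  "s0_t (X i) = (if i = 0 then X 0 else if i = 1 then Z 1 else X (i - 1))"
| "s0_t (Z i) = Z i" | "s0_t (T i) = T i"

lemma subst_okI: "(\<And>w. finite {v. \<tau> v = w}) \<Longrightarrow> subst_ok c \<tau>"
  unfolding subst_ok_def by (metis (mono_tags, lifting) Collect_mono_iff finite_subset)

lemma om_t_invol: "om_t (om_t v) = v"
  by (cases v) auto

lemma sw_t_invol: "sw_t i (sw_t i v) = v"
  by (cases v) auto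

lemma ok_om: "subst_ok c om_t"
proof (rule subst_okI)
  fix w have "{v. om_t v = w} \<subseteq> {om_t w}" by (auto simp: om_t_invol)
  then show "finite {v. om_t v = w}" by (rule finite_subset) simp
qed

lemma ok_sw: "subst_ok c (sw_t i)"
proof (rule subst_okI)
  fix w have "{v. sw_t i v = w} \<subseteq> {sw_t i w}" by (auto simp: sw_t_invol)
  then show "finite {v. sw_t i v = w}" by (rule finite_subset) simp
qed

lemma ok_s0: "subst_ok c s0_t"
proof (rule subst_okI)
  fix w
  have "{v. s0_t v = w} \<subseteq> {w, X 1} \<union> {X (Suc i) | i. w = X i}"
  proof
    fix v assume "v \<in> {v. s0_t v = w}"
    then show "v \<in> {w, X 1} \<union> {X (Suc i) | i. w = X i}"
      by (cases v) (auto split: if_splits)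
  qed
  moreover have "finite {X (Suc i) | i. w = X i}"
    by (cases w) auto
  ultimately show "finite {v. s0_t v = w}" by (auto intro: finite_subset)
qed

lemma rgens_cases:
  assumes "g \<in> rgens"
  obtains r where "g = Qser r" | i where "i \<ge> 1" "g = mvar (Z i)" | i where "i \<ge> 1" "g = mvar (T i)"
  using assms by (auto simp: rgens_def)

lemma in_rgens: "Qser r \<in> subring_gen rgens" "i \<ge> Suc 0 \<Longrightarrow> mvar (Z i) \<in> subring_gen rgens"
   "i \<ge> Suc 0 \<Longrightarrow> mvar (T i) \<in> subring_gen rgens"
  by (auto simp: rgens_def intro!: subring_gen.gen)

lemma rsubst_om: "rsubst om_c om_t"
proof
  show "subst_ok om_c om_t" by (rule ok_om)
  fix g assume "g \<in> rgens"
  then show "msub om_c om_t g \<in> subring_gen rgens"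
    by (cases rule: rgens_cases)
      (auto simp: msub_mvar[OF ok_om] msub_Q_fixed[OF ok_om] in_rgens intro!: subring_gen_uminus)
qed

lemma transpose_ge_1: "i \<ge> 1 \<Longrightarrow> j \<ge> 1 \<Longrightarrow> transpose i (Suc i) j \<ge> (1::nat)"
  by (auto simp: transpose_def)

lemma rsubst_sw:
  assumes "i \<ge> 1"
  shows "rsubst (\<lambda>_. 1) (sw_t i)"
proof
  show "subst_ok (\<lambda>_. 1) (sw_t i)" by (rule ok_sw)
  fix g assume "g \<in> rgens"
  then show "msub (\<lambda>_. 1) (sw_t i) g \<in> subring_gen rgens"
    using transpose_ge_1[OF assms]
    by (cases rule: rgens_cases)
      (auto simp: msub_mvar[OF ok_sw] msub_Q_fixed[OF ok_sw] intro!: in_rgens)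
qed

lemma msub_s0_Q: "fps_map (msub s0_c s0_t) (Abs_fps Qser) = fps_lin (mvar (Z 1)) * fps_geom (mvar (Z 1)) * Abs_fps Qser"
  by (subst msub_Q_shift[OF ok_s0]) (auto simp: s0_c_def)

lemma subring_gen_sum: "(\<And>i. i \<in> A \<Longrightarrow> f i \<in> subring_gen G) \<Longrightarrow> sum f A \<in> subring_gen G"
  by (induction A rule: infinite_finite_induct) (auto intro: subring_gen_zero subring_gen_add)

lemma subring_gen_power: "a \<in> subring_gen G \<Longrightarrow> a ^ n \<in> subring_gen G"
  by (induction n) (auto intro: subring_gen.intros)

lemma rsubst_s0: "rsubst s0_c s0_t"
proof
  show "subst_ok s0_c s0_t" by (rule ok_s0)
  fix g assume "g \<in> rgens"
  then show "msub s0_c s0_t g \<in> subring_gen rgens"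
  proof (cases rule: rgens_cases)
    case (1 r)
    have z: "mvar (Z 1) \<in> subring_gen rgens" by (rule in_rgens) simp
    have L: "fps_nth (fps_lin (mvar (Z 1)) * fps_geom (mvar (Z 1))) n \<in> subring_gen rgens" for n
      using z by (auto simp: fps_mult_nth fps_lin_def fps_geom_def fps_X_def
        intro!: subring_gen_sum subring_gen.mult subring_gen_add subring_gen_power subring_gen_zero subring_gen.one simp del: One_nat_def)
    have "msub s0_c s0_t g = fps_nth (fps_map (msub s0_c s0_t) (Abs_fps Qser)) r"
      by (simp add: 1)
    also have "\<dots> \<in> subring_gen rgens"
      unfolding msub_s0_Q fps_mult_nth[of "_ * _"]
      by (intro subring_gen_sum subring_gen.mult L) (simp add: in_rgens)
    finally show ?thesis .
  qed (auto simp: msub_mvar[OF ok_s0] in_rgens s0_c_def intro!: subring_gen_uminus)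
qed

definition om_fun :: "rinf \<Rightarrow> rinf" where "om_fun = rlift om_c om_t"
definition sz_fun :: "nat \<Rightarrow> rinf \<Rightarrow> rinf" where
  "sz_fun i = (if i = 0 then rlift s0_c s0_t else rlift (\<lambda>_. 1) (sw_t i))"

lemma rhom_om_fun: "rhom om_fun"
  unfolding om_fun_def by (rule rsubst.rhom_rlift[OF rsubst_om])

lemma rhom_sz_fun: "rhom (sz_fun i)"
  unfolding sz_fun_def using rsubst.rhom_rlift[OF rsubst_sw, of i] rsubst.rhom_rlift[OF rsubst_s0] by auto

lemma om_fun_gens: "om_fun (Qpol r) = Qpol r" "om_fun (zvar i) = - tvar i" "om_fun (tvar i) = - zvar i"
  by (simp_all add: om_fun_def series_of_inject[symmetric] rsubst.series_of_rlift[OF rsubst_om]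
     Qpol.rep_eq zvar.rep_eq tvar.rep_eq series_of_simps msub_Q_fixed[OF ok_om] msub_mvar[OF ok_om])

lemma sz_fun_gens:
  assumes "i \<ge> 1"
  shows "sz_fun i (Qpol r) = Qpol r" "j \<ge> 1 \<Longrightarrow> sz_fun i (zvar j) = zvar (transpose i (i + 1) j)" "sz_fun i (tvar j) = tvar j"
  using assms transpose_ge_1[OF assms, of j]
  by (auto simp add: sz_fun_def series_of_inject[symmetric] rsubst.series_of_rlift[OF rsubst_sw]
     Qpol.rep_eq zvar.rep_eq tvar.rep_eq series_of_simps msub_Q_fixed[OF ok_sw] msub_mvar[OF ok_sw])

lemma sz0_fun_gens:
  "j \<ge> 1 \<Longrightarrow> sz_fun 0 (zvar j) = (if j = 1 then - zvar j else zvar j)" "sz_fun 0 (tvar j) = tvar j"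
  by (auto simp add: sz_fun_def series_of_inject[symmetric] rsubst.series_of_rlift[OF rsubst_s0]
     zvar.rep_eq tvar.rep_eq series_of_simps msub_mvar[OF ok_s0] s0_c_def)

lemma fps_map_series_inj: "fps_map series_of f = fps_map series_of g \<Longrightarrow> f = g"
  by (simp add: fps_eq_iff series_of_inject)

lemma sz0_fun_Q: "fps_map (sz_fun 0) (Abs_fps Qpol) = fps_lin (zvar 1) * fps_geom (zvar 1) * Abs_fps Qpol"
proof (rule fps_map_series_inj)
  have Q: "fps_map series_of (Abs_fps Qpol) = Abs_fps Qser"
    by (simp add: fps_eq_iff Qpol.rep_eq)
  have "fps_map series_of (fps_map (sz_fun 0) (Abs_fps Qpol)) = fps_map (msub s0_c s0_t) (Abs_fps Qser)"
    by (simp add: fps_eq_iff sz_fun_def rsubst.series_of_rlift[OF rsubst_s0] Qpol.rep_eq)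
  also have "\<dots> = fps_map series_of (fps_lin (zvar 1) * fps_geom (zvar 1) * Abs_fps Qpol)"
    by (simp add: msub_s0_Q rhom_simps[OF rhom_fps_map[OF rhom_series_of]] fps_map_lin fps_map_geom
      rhom_series_of Q series_of_zvar)
  finally show "fps_map series_of (fps_map (sz_fun 0) (Abs_fps Qpol)) =
    fps_map series_of (fps_lin (zvar 1) * fps_geom (zvar 1) * Abs_fps Qpol)" .
qed

lemma om_fun_invol: "om_fun (om_fun x) = x"
proof -
  have "om_fun \<circ> om_fun = (\<lambda>x. x)"
    by (rule rhom_rinf_eqI) (auto simp: rhom_comp rhom_om_fun rhom_id om_fun_gens rhom_uminus)
  then show ?thesis by (metis comp_apply)
qed

text \<open>It suffices to check generators. For i = 0 the second application turns z_1 into -z_1,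
  so Q is multiplied by (1 + z_1 u)/(1 - z_1 u) and by its inverse.\<close>

lemma sz_fun_invol: "sz_fun i (sz_fun i x) = x"
proof -
  have "sz_fun i \<circ> sz_fun i = (\<lambda>x. x)"
  proof (cases "i = 0")
    case True
    have h: "rhom (sz_fun 0)" by (rule rhom_sz_fun)
    have z: "sz_fun 0 (zvar 1) = - zvar 1" by (simp add: sz0_fun_gens)
    have "fps_map (sz_fun 0) (fps_map (sz_fun 0) (Abs_fps Qpol)) =
       (fps_lin (- zvar 1) * fps_geom (zvar 1)) * (fps_lin (zvar 1) * fps_geom (- zvar 1)) * Abs_fps Qpol"
      by (simp only: sz0_fun_Q rhom_mult[OF rhom_fps_map[OF h]] fps_map_lin[OF h] fps_map_geom[OF h] z mult_ac)
    then have "fps_map (sz_fun 0) (fps_map (sz_fun 0) (Abs_fps Qpol)) = Abs_fps Qpol"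
      by (simp only: fps_geom_inverse fps_lin_mult_geom mult_1_left)
    then have "sz_fun 0 (sz_fun 0 (Qpol r)) = Qpol r" for r
      by (simp add: fps_eq_iff)
    then show ?thesis unfolding True
      by (intro rhom_rinf_eqI) (auto simp: rhom_comp h rhom_id sz0_fun_gens rhom_uminus[OF h])
  next
    case False
    then have i: "i \<ge> 1" by simp
    show ?thesis
      by (rule rhom_rinf_eqI)
       (use transpose_ge_1[OF i] in \<open>auto simp: rhom_comp rhom_sz_fun rhom_id sz_fun_gens[OF i]\<close>)
  qed
  then show ?thesis by (metis comp_apply)
qed

lemma omega_eq: "omega = om_fun"
  unfolding omega_def
proof (rule the_equality)
  show "ring_aut om_fun \<and> (\<forall>j\<ge>1. om_fun (tvar j) = - zvar j) \<and> (\<forall>j\<ge>1. om_fun (zvar j) = - tvar j) \<and>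
    (\<forall>r. om_fun (Qpol r) = Qpol r)"
    by (auto simp: om_fun_gens intro!: rhom_invol_aut rhom_om_fun om_fun_invol)
  fix f :: "rinf \<Rightarrow> rinf" assume f: "ring_aut f \<and> (\<forall>j\<ge>1. f (tvar j) = - zvar j) \<and> (\<forall>j\<ge>1. f (zvar j) = - tvar j) \<and>
    (\<forall>r. f (Qpol r) = Qpol r)"
  show "f = om_fun"
    by (rule rhom_rinf_eqI) (use f in \<open>auto simp: om_fun_gens rhom_om_fun ring_aut_rhom\<close>)
qed

lemma s_z_eq: "s_z i = sz_fun i"
  unfolding s_z_def
proof (rule the_equality)
  have aut: "ring_aut (sz_fun i)"
    by (auto intro!: rhom_invol_aut rhom_sz_fun sz_fun_invol)
  have Q: "Abs_fps (\<lambda>r. f (Qpol r)) = fps_map f (Abs_fps Qpol)" for f :: "rinf \<Rightarrow> rinf"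
    by (simp add: fps_eq_iff)
  let ?P = "\<lambda>f. ring_aut f \<and> (\<forall>j\<ge>1. f (tvar j) = tvar j) \<and>
     (if i = 0 then
        f (zvar 1) = - zvar 1 \<and> (\<forall>j\<ge>2. f (zvar j) = zvar j) \<and>
        Abs_fps (\<lambda>r. f (Qpol r)) = fps_lin (zvar 1) * fps_geom (zvar 1) * Abs_fps Qpol
      else
        f (zvar i) = zvar (i + 1) \<and> f (zvar (i + 1)) = zvar i \<and>
        (\<forall>j\<ge>1. j \<noteq> i \<and> j \<noteq> i + 1 \<longrightarrow> f (zvar j) = zvar j) \<and> (\<forall>r. f (Qpol r) = Qpol r))"
  show "?P (sz_fun i)"
  proof (cases "i = 0")
    case True
    then show ?thesis using aut unfolding Q by (auto simp: sz0_fun_gens sz0_fun_Q)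
  next
    case False
    then have i: "i \<ge> 1" by simp
    then show ?thesis using aut by (auto simp: sz_fun_gens transpose_def)
  qed
  fix f :: "rinf \<Rightarrow> rinf" assume f: "?P f"
  then have h: "rhom f" by (simp add: ring_aut_rhom)
  show "f = sz_fun i"
  proof (cases "i = 0")
    case True
    show ?thesis
    proof (rule rhom_rinf_eqI[OF h rhom_sz_fun])
      have "fps_map f (Abs_fps Qpol) = fps_map (sz_fun i) (Abs_fps Qpol)"
        using f True unfolding Q by (simp add: sz0_fun_Q)
      then show "f (Qpol r) = sz_fun i (Qpol r)" for r
        by (simp add: fps_eq_iff)
      show "f (zvar j) = sz_fun i (zvar j)" if "j \<ge> 1" for j
        using that f True by (cases "j = 1") (auto simp: sz0_fun_gens)
      show "f (tvar j) = sz_fun i (tvar j)" if "j \<ge> 1" for j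
        using that f True by (auto simp: sz0_fun_gens)
    qed
  next
    case False
    then have i: "i \<ge> 1" by simp
    show ?thesis
    proof (rule rhom_rinf_eqI[OF h rhom_sz_fun])
      show "f (Qpol r) = sz_fun i (Qpol r)" for r
        using f False by (simp add: sz_fun_gens[OF i])
      show "f (zvar j) = sz_fun i (zvar j)" if "j \<ge> 1" for j
        using that f False by (auto simp: sz_fun_gens(2)[OF i that] transpose_def)
      show "f (tvar j) = sz_fun i (tvar j)" if "j \<ge> 1" for j
        using that f False by (simp add: sz_fun_gens[OF i])
    qed
  qed
qed

lemma rhom_omega: "rhom omega" and omega_invol [simp]: "omega (omega x) = x"
  and rhom_s_z: "rhom (s_z i)" and s_z_invol [simp]: "s_z i (s_z i x) = x"
  by (simp_all add: omega_eq rhom_om_fun om_fun_invol s_z_eq rhom_sz_fun sz_fun_invol)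

lemma omega_gens [simp]: "omega (Qpol r) = Qpol r" "omega (zvar i) = - tvar i" "omega (tvar i) = - zvar i"
  by (simp_all add: omega_eq om_fun_gens)

lemma s_z_gens:
  assumes "i \<ge> 1"
  shows "s_z i (Qpol r) = Qpol r" "s_z i (zvar j) = zvar (transpose i (i + 1) j)" "s_z i (tvar j) = tvar j"
  using assms sz_fun_gens[of i] rhom_zero[OF rhom_sz_fun]
  by (cases "j = 0"; simp add: s_z_eq)+

lemma s_z_0_gens:
  "s_z 0 (zvar j) = (if j = 1 then - zvar j else zvar j)" "s_z 0 (tvar j) = tvar j"
  "fps_map (s_z 0) (Abs_fps Qpol) = fps_lin (zvar 1) * fps_geom (zvar 1) * Abs_fps Qpol"
  using rhom_zero[OF rhom_sz_fun]
  by (cases "j = 0"; simp add: s_z_eq sz0_fun_gens sz0_fun_Q)+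

lemma s_t_apply: "s_t i f = omega (s_z i (omega f))"
  by (simp add: s_t_def)

lemma rhom_s_t: "rhom (s_t i)"
  unfolding s_t_def by (intro rhom_comp rhom_omega rhom_s_z)

lemma s_t_gens:
  assumes "i \<ge> 1"
  shows "s_t i (Qpol r) = Qpol r" "s_t i (tvar j) = tvar (transpose i (i + 1) j)" "s_t i (zvar j) = zvar j"
  by (simp_all add: s_t_apply s_z_gens[OF assms] rhom_simps[OF rhom_s_z] rhom_simps[OF rhom_omega])

lemma s_t_0_gens:
  "s_t 0 (tvar j) = (if j = 1 then - tvar j else tvar j)" "s_t 0 (zvar j) = zvar j"
  by (simp_all add: s_t_apply s_z_0_gens rhom_simps[OF rhom_s_z] rhom_simps[OF rhom_omega])

lemma s_t_0_Q: "fps_map (s_t 0) (Abs_fps Qpol) = fps_lin (- tvar 1) * fps_geom (- tvar 1) * Abs_fps Qpol"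
proof -
  have Q: "fps_map omega (Abs_fps Qpol) = Abs_fps Qpol" by (simp add: fps_eq_iff)
  have "fps_map (s_t 0) (Abs_fps Qpol) = fps_map omega (fps_map (s_z 0) (fps_map omega (Abs_fps Qpol)))"
    by (simp add: fps_eq_iff s_t_apply)
  then show ?thesis
    by (simp add: Q s_z_0_gens rhom_simps[OF rhom_fps_map[OF rhom_omega]] fps_map_lin fps_map_geom rhom_omega)
qed

lemma omega_alpha: "omega (alpha i) = (if i = 0 then - (2 * zvar 1) else zvar i - zvar (i + 1))"
  by (auto simp: alpha_def rhom_simps[OF rhom_omega])

lemma s_z_alpha [simp]: "s_z i (alpha j) = alpha j"
  by (cases "i = 0") (auto simp: alpha_def rhom_simps[OF rhom_s_z] s_z_gens s_z_0_gens)

section \<open>Divided differences are defined\<close>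

text \<open>Divisibility is verified on generators and spreads to products by the twisted Leibniz
  rule ab - s(ab) = (a - s a) b + s a (b - s b). For Q_r and i = 0 it comes from the factor 2 z_1 in
  \<open>fps_lin_geom_eq\<close>.\<close>

lemma s_z_divisible: "\<exists>g. f - s_z i f = omega (alpha i) * g"
proof (induction f rule: rinf_induct)
  case one
  show ?case by (intro exI[of _ 0]) (simp add: rhom_simps[OF rhom_s_z])
next
  case (Q r)
  show ?case
  proof (cases "i = 0")
    case True
    define G where "G = fps_X * fps_geom (zvar 1) * Abs_fps Qpol"
    have "s_z 0 (Qpol r) = fps_nth (fps_map (s_z 0) (Abs_fps Qpol)) r" by simp
    also have "fps_map (s_z 0) (Abs_fps Qpol) = Abs_fps Qpol + fps_const (zvar 1) * (G + G)"
      unfolding s_z_0_gens fps_lin_geom_eq G_def by (simp add: algebra_simps)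
    also have "fps_nth \<dots> r = Qpol r + zvar 1 * (fps_nth G r + fps_nth G r)"
      by (simp only: fps_add_nth fps_mult_left_const_nth fps_nth_Abs_fps)
    finally show ?thesis
      unfolding True omega_alpha by (intro exI[of _ "fps_nth G r"]) (simp add: algebra_simps)
  next
    case False
    then show ?thesis by (intro exI[of _ 0]) (simp add: s_z_gens)
  qed
next
  case (z j)
  consider "i = 0" "j = 1" | "i = 0" "j \<noteq> 1" | "i \<ge> 1" "j = i" | "i \<ge> 1" "j = i + 1" | "i \<ge> 1" "j \<noteq> i" "j \<noteq> i + 1"
    by linarith
  then show ?case
  proof cases
    case 1
    then show ?thesis by (intro exI[of _ "- 1"]) (simp add: s_z_0_gens omega_alpha)
  next
    case 2
    then show ?thesis by (intro exI[of _ 0]) (simp add: s_z_0_gens)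
  next
    case 3
    then show ?thesis by (intro exI[of _ 1]) (simp add: s_z_gens omega_alpha)
  next
    case 4
    then show ?thesis by (intro exI[of _ "- 1"]) (simp add: s_z_gens omega_alpha)
  next
    case 5
    then show ?thesis by (intro exI[of _ 0]) (simp add: s_z_gens transpose_def)
  qed
next
  case (t j)
  show ?case by (intro exI[of _ 0]) (cases "i = 0"; simp add: s_z_gens s_z_0_gens)
next
  case (diff a b)
  then obtain g h where "a - s_z i a = omega (alpha i) * g" "b - s_z i b = omega (alpha i) * h" by blast
  then show ?case
    by (intro exI[of _ "g - h"]) (simp add: rhom_simps[OF rhom_s_z] algebra_simps)
next
  case (mult a b)
  then obtain g h where gh: "a - s_z i a = omega (alpha i) * g" "b - s_z i b = omega (alpha i) * h" by blast
  have "a * b - s_z i (a * b) = (a - s_z i a) * b + s_z i a * (b - s_z i b)"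
    by (simp add: rhom_simps[OF rhom_s_z] algebra_simps)
  then show ?case unfolding gh
    by (intro exI[of _ "g * b + s_z i a * h"]) (simp add: algebra_simps)
qed

text \<open>If f u = f v, the coefficient of f at m is 0 when v does not divide m, and otherwise
  equals the one at m u/v. Moving exponents from v to u ends after finitely many steps at a monomial
  free of v.\<close>

lemma mult_var_diff_cancel:
  fixes f :: "(var, int) mfps"
  assumes "u \<noteq> v" "f * (mvar u - mvar v) = 0"
  shows "f = 0"
proof (rule mfps_eqI)
  have step: "mcoeff f m = (if Poly_Mapping.lookup m v = 0 then 0 else
      mcoeff f (m + Poly_Mapping.single u 1 - Poly_Mapping.single v 1))" for m
  proof -
    let ?m = "m + Poly_Mapping.single u 1"
    have "mcoeff (f * mvar u) ?m = mcoeff (f * mvar v) ?m"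
      using assms(2) by (simp add: right_diff_distrib)
    then show ?thesis using assms(1)
      by (simp add: mcoeff_mult_mvar lookup_add lookup_single when_def)
  qed
  show "mcoeff f m = mcoeff 0 m" for m
  proof (induction "Poly_Mapping.lookup m v" arbitrary: m)
    case 0
    then show ?case using step[of m] by (simp add: zero_mfps.rep_eq)
  next
    case (Suc n)
    have "n = Poly_Mapping.lookup (m + Poly_Mapping.single u 1 - Poly_Mapping.single v 1) v"
      using Suc(2) assms(1) by (simp add: lookup_add lookup_minus lookup_single when_def)
    from Suc(1)[OF this] show ?case using step[of m] Suc(2) by (simp add: zero_mfps.rep_eq)
  qed
qed

lemma two_cancel: "(2::rinf) * g = 0 \<Longrightarrow> g = 0"
proof -
  assume "(2::rinf) * g = 0"
  then have "series_of (g + g) = 0"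
    by (simp only: mult_2 zero_rinf.rep_eq)
  then have "mcoeff (series_of g + series_of g) m = 0" for m
    by (simp only: plus_rinf.rep_eq zero_mfps.rep_eq)
  then have "mcoeff (series_of g) m + mcoeff (series_of g) m = 0" for m
    by (simp only: plus_mfps.rep_eq)
  then have "series_of g = 0" by (intro mfps_eqI) (simp add: zero_mfps.rep_eq)
  then show "g = 0" by (simp add: series_of_inject[symmetric] zero_rinf.rep_eq)
qed

lemma alpha_cancel:
  assumes "alpha i * g = 0"
  shows "g = 0"
proof (cases "i = 0")
  case True
  then have "2 * (tvar 1 * g) = 0" using assms by (simp add: alpha_def mult.assoc)
  then have "g * tvar 1 = 0" by (simp only: two_cancel mult.commute[of g])
  then have "series_of (g * tvar 1) = 0" by (simp only: zero_rinf.rep_eq)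
  then have s: "series_of g * mvar (T 1) = 0"
    by (simp only: times_rinf.rep_eq series_of_tvar[OF order_refl])
  have "mcoeff (series_of g) m = 0" for m
  proof -
    have "mcoeff (series_of g * mvar (T 1)) (m + Poly_Mapping.single (T 1) 1) = 0" by (simp only: s zero_mfps.rep_eq)
    then show ?thesis by (simp add: mcoeff_mult_mvar lookup_add)
  qed
  then have "series_of g = 0" by (intro mfps_eqI) (simp add: zero_mfps.rep_eq)
  then show "g = 0" by (simp add: series_of_inject[symmetric] zero_rinf.rep_eq)
next
  case False
  then have "g * (tvar (i + 1) - tvar i) = 0" using assms by (simp add: alpha_def mult.commute)
  then have "series_of (g * (tvar (i + 1) - tvar i)) = 0" by (simp only: zero_rinf.rep_eq)
  then have "series_of g * (mvar (T (i + 1)) - mvar (T i)) = 0"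
    using False by (simp add: times_rinf.rep_eq minus_rinf.rep_eq series_of_tvar)
  then have "series_of g = 0" by (rule mult_var_diff_cancel[rotated]) simp
  then show "g = 0" by (simp add: series_of_inject[symmetric] zero_rinf.rep_eq)
qed

lemma exact_quot_eqI:
  assumes "f = a * g" "\<And>h. a * h = 0 \<Longrightarrow> h = 0"
  shows "exact_quot f a = g"
  unfolding exact_quot_def
proof (rule the_equality)
  show "g * a = f" using assms(1) by (simp add: mult.commute)
  fix h assume "h * a = f"
  then have "a * (h - g) = 0" using assms(1) by (simp add: algebra_simps)
  from assms(2)[OF this] show "h = g" by simp
qed

lemma omega_alpha_cancel: "omega (alpha i) * g = 0 \<Longrightarrow> g = 0"
proof -
  assume "omega (alpha i) * g = 0"
  then have "omega (omega (alpha i) * g) = 0" by (simp add: rhom_zero[OF rhom_omega])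
  then have "omega g = 0" using alpha_cancel by (simp add: rhom_mult[OF rhom_omega])
  then have "omega (omega g) = 0" by (simp add: rhom_zero[OF rhom_omega])
  then show ?thesis by simp
qed

lemma ddiff_zI: "f - s_z i f = omega (alpha i) * g \<Longrightarrow> ddiff_z i f = g"
  unfolding ddiff_z_def by (rule exact_quot_eqI, assumption, rule omega_alpha_cancel)

lemma ddiff_tI: "f - s_t i f = alpha i * g \<Longrightarrow> ddiff_t i f = g"
  unfolding ddiff_t_def by (rule exact_quot_eqI, assumption, rule alpha_cancel)

lemma ddiff_z_eq: "f - s_z i f = omega (alpha i) * ddiff_z i f"
  using s_z_divisible[of f i] ddiff_zI by blast

lemma s_t_divisible: "\<exists>g. f - s_t i f = alpha i * g"
proof -
  obtain g where "omega f - s_z i (omega f) = omega (alpha i) * g"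
    using s_z_divisible by blast
  then have "omega (omega f - s_z i (omega f)) = omega (omega (alpha i) * g)" by simp
  then show ?thesis by (auto simp: s_t_apply rhom_simps[OF rhom_omega])
qed

lemma ddiff_t_eq: "f - s_t i f = alpha i * ddiff_t i f"
  using s_t_divisible[of f i] ddiff_tI by blast

section \<open>Length in the hyperoctahedral group\<close>

lemma W_infD:
  assumes "w \<in> W_inf"
  shows "bij w" "inj w" "w 0 = 0" "w (- a) = - w a" "w a = 0 \<longleftrightarrow> a = 0" "finite {i. w i \<noteq> i}"
proof -
  have p: "w permutes (- {0})" using assms by (simp add: W_inf_def)
  show "bij w" using p by (rule permutes_bij)
  show inj: "inj w" using p by (rule permutes_inj)
  show z: "w 0 = 0" using permutes_not_in[OF p, of 0] by simp
  show "w (- a) = - w a" "finite {i. w i \<noteq> i}" using assms by (simp_all add: W_inf_def)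
  show "w a = 0 \<longleftrightarrow> a = 0" using inj z by (metis injD)
qed

lemma W_infI:
  assumes "bij w" "\<And>a. w (- a) = - w a" "finite {i. w i \<noteq> i}"
  shows "w \<in> W_inf"
proof -
  have "w 0 = 0" using assms(2)[of 0] by simp
  then have "w permutes (- {0})"
    using assms(1) by (auto simp: permutes_def bij_iff)
  then show ?thesis using assms by (simp add: W_inf_def)
qed

lemma id_W_inf: "id \<in> W_inf"
  by (rule W_infI) auto

lemma comp_W_inf:
  assumes "v \<in> W_inf" "w \<in> W_inf"
  shows "v \<circ> w \<in> W_inf"
proof (rule W_infI)
  show "bij (v \<circ> w)" using assms by (intro bij_comp W_infD)
  show "(v \<circ> w) (- a) = - (v \<circ> w) a" for a using assms by (simp add: W_infD)
  have "{i. (v \<circ> w) i \<noteq> i} \<subseteq> {i. w i \<noteq> i} \<union> {i. v i \<noteq> i}" by auto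
  then show "finite {i. (v \<circ> w) i \<noteq> i}"
    using W_infD(6)[OF assms(1)] W_infD(6)[OF assms(2)] finite_subset by blast
qed

abbreviation winv :: "('a \<Rightarrow> 'b) \<Rightarrow> 'b \<Rightarrow> 'a" where "winv \<equiv> inv_into UNIV"

lemma inv_W_inf:
  assumes "w \<in> W_inf"
  shows "winv w \<in> W_inf"
proof (rule W_infI)
  have b: "bij w" using assms by (rule W_infD)
  show "bij (winv w)" using b by (rule bij_imp_bij_inv)
  show "winv w (- a) = - winv w a" for a
    using b W_infD(4)[OF assms] by (metis bij_inv_eq_iff)
  have "{i. winv w i \<noteq> i} = {i. w i \<noteq> i}"
    using b by (metis bij_inv_eq_iff)
  then show "finite {i. winv w i \<noteq> i}" using W_infD(6)[OF assms] by simp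
qed

lemma gen_s_apply:
  "gen_s i x = (if i = 0 then (if x = 1 then - 1 else if x = - 1 then 1 else x)
    else if x = int i then int i + 1 else if x = int i + 1 then int i
    else if x = - int i then - int i - 1 else if x = - int i - 1 then - int i else x)"
  by (auto simp: gen_s_def transpose_def)

lemma gen_s_invol [simp]: "gen_s i (gen_s i x) = x"
  by (auto simp: gen_s_apply)

lemma gen_s_comp [simp]: "gen_s i \<circ> gen_s i = id"
  by auto

lemma gen_s_W_inf: "gen_s i \<in> W_inf"
proof (rule W_infI)
  show "bij (gen_s i)" by (rule involuntory_imp_bij) simp
  show "gen_s i (- a) = - gen_s i a" for a by (auto simp: gen_s_apply)
  have "{x. gen_s i x \<noteq> x} \<subseteq> {1, -1, int i, int i + 1, - int i, - int i - 1}"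
    by (auto simp: gen_s_apply split: if_splits)
  then show "finite {x. gen_s i x \<noteq> x}" by (rule finite_subset) simp
qed

lemma inv_gen_s [simp]: "winv (gen_s i) = gen_s i"
  by (rule inv_unique_comp) simp_all

definition inversions :: "(int \<Rightarrow> int) \<Rightarrow> (int \<times> int) set" where
  "inversions w = {(a, b). a \<noteq> 0 \<and> b \<noteq> 0 \<and> a < b \<and> w a > w b}"

definition negatives :: "(int \<Rightarrow> int) \<Rightarrow> int set" where
  "negatives w = {b. b > 0 \<and> w b < 0}"

text \<open>Every inversion of \<open>w\<close> as a signed permutation is counted twice, in \<open>inversions\<close> as
  \<open>(a, b)\<close> and \<open>(-b, -a)\<close>, or, if \<open>a = -b\<close>, once in \<open>inversions\<close> and once in \<open>negatives\<close>.\<close>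

definition inv_count :: "(int \<Rightarrow> int) \<Rightarrow> nat" where
  "inv_count w = card (inversions w) + card (negatives w)"

definition ascent :: "(int \<Rightarrow> int) \<Rightarrow> nat \<Rightarrow> bool" where
  "ascent w i \<longleftrightarrow> (if i = 0 then w 1 > 0 else w (int i) < w (int i + 1))"

lemma W_inf_bound:
  assumes "w \<in> W_inf"
  obtains M where "M \<ge> 0" "\<And>x. \<bar>x\<bar> > M \<Longrightarrow> w x = x" "\<And>x. \<bar>x\<bar> \<le> M \<Longrightarrow> \<bar>w x\<bar> \<le> M"
proof -
  have "finite (abs ` {i. w i \<noteq> i})" using W_infD(6)[OF assms] by simp
  then obtain M0 where M0: "\<And>i. w i \<noteq> i \<Longrightarrow> \<bar>i\<bar> \<le> M0"
    by (metis (mono_tags, lifting) bdd_above.E bdd_above_finite imageI mem_Collect_eq)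
  let ?M = "max M0 0"
  have 1: "w x = x" if "\<bar>x\<bar> > ?M" for x
    using M0[of x] that by force
  moreover have "\<bar>w x\<bar> \<le> ?M" if "\<bar>x\<bar> \<le> ?M" for x
  proof (rule ccontr)
    assume neg: "\<not> \<bar>w x\<bar> \<le> ?M"
    then have "\<bar>w x\<bar> > ?M" by linarith
    then have "w (w x) = w x" by (rule 1)
    then have "w x = x" using W_infD(2)[OF assms] by (simp add: inj_eq)
    then show False using that neg by simp
  qed
  ultimately show ?thesis using that[of ?M] by auto
qed

lemma finite_inversions:
  assumes "w \<in> W_inf"
  shows "finite (inversions w)" "finite (negatives w)"
proof -
  obtain M where M: "M \<ge> 0" "\<And>x. \<bar>x\<bar> > M \<Longrightarrow> w x = x" "\<And>x. \<bar>x\<bar> \<le> M \<Longrightarrow> \<bar>w x\<bar> \<le> M"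
    using W_inf_bound[OF assms] by blast
  have "a \<in> {-M..M} \<and> b \<in> {-M..M}" if "a < b" "w a > w b" for a b
  proof (cases "\<bar>a\<bar> \<le> M"; cases "\<bar>b\<bar> \<le> M")
    assume "\<bar>a\<bar> \<le> M" "\<not> \<bar>b\<bar> \<le> M"
    then show ?thesis using that M(2)[of b] M(3)[of a] by auto
  next
    assume "\<not> \<bar>a\<bar> \<le> M" "\<bar>b\<bar> \<le> M"
    then show ?thesis using that M(2)[of a] M(3)[of b] by auto
  next
    assume "\<not> \<bar>a\<bar> \<le> M" "\<not> \<bar>b\<bar> \<le> M"
    then show ?thesis using that M(2)[of a] M(2)[of b] by auto
  qed auto
  then have "inversions w \<subseteq> {-M..M} \<times> {-M..M}"
    by (auto simp: inversions_def)
  then show "finite (inversions w)" by (rule finite_subset) simp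
  have "negatives w \<subseteq> {-M..M}"
  proof
    fix b assume b: "b \<in> negatives w"
    then have "\<bar>b\<bar> \<le> M" using M(2)[of b] by (force simp: negatives_def)
    then show "b \<in> {-M..M}" by auto
  qed
  then show "finite (negatives w)" by (rule finite_subset) simp
qed

text \<open>\<open>gen_s i\<close> exchanges neighbours in the ordered set of nonzero integers, so
  it reverses no pair except those it exchanges.\<close>

lemma gen_s_mono:
  assumes "a < b" "a \<noteq> 0" "b \<noteq> 0"
    "(a, b) \<notin> (if i = 0 then {(- 1, 1)} else {(int i, int i + 1), (- int i - 1, - int i)})"
  shows "gen_s i a < gen_s i b"
  using assms by (auto simp: gen_s_apply split: if_splits)

lemma inversions_comp_gen_s:
  fixes i :: nat
  defines "E \<equiv> (if i = 0 then {(- 1, 1)} else {(int i, int i + 1), (- int i - 1, - int i)})"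
  shows "card (inversions (w \<circ> gen_s i) - E) = card (inversions w - E)"
proof (rule bij_betw_same_card[of "\<lambda>(a, b). (gen_s i a, gen_s i b)"],
    rule bij_betw_byWitness[of _ "\<lambda>(a, b). (gen_s i a, gen_s i b)"])
  have nz: "gen_s i a = 0 \<longleftrightarrow> a = 0" for a by (auto simp: gen_s_apply)
  have E: "(gen_s i a, gen_s i b) \<notin> E" if "(a, b) \<notin> E" "a < b" "a \<noteq> 0" "b \<noteq> 0" for a b
  proof
    assume "(gen_s i a, gen_s i b) \<in> E"
    then have "b < a" unfolding E_def by (auto simp: gen_s_apply split: if_splits)
    then show False using that by simp
  qed
  have mono: "gen_s i a < gen_s i b" if "(a, b) \<notin> E" "a < b" "a \<noteq> 0" "b \<noteq> 0" for a b
    using that gen_s_mono unfolding E_def by blast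
  show "(\<lambda>(a, b). (gen_s i a, gen_s i b)) ` (inversions (w \<circ> gen_s i) - E) \<subseteq> inversions w - E"
    using E mono by (auto simp: inversions_def nz)
  show "(\<lambda>(a, b). (gen_s i a, gen_s i b)) ` (inversions w - E) \<subseteq> inversions (w \<circ> gen_s i) - E"
    using E mono by (auto simp: inversions_def nz)
qed auto

text \<open>Away from the exchanged pairs, applying \<open>gen_s i\<close> to both entries matches
  the inversions of w with those of the product. For i \<ge> 1 the two mirror pairs are gained; for
  i = 0 one pair and one negative value, which makes the increment 2 in both cases.\<close>

lemma inv_count_ascent:
  assumes w: "w \<in> W_inf" and asc: "ascent w i"
  shows "inv_count (w \<circ> gen_s i) = inv_count w + 2"
proof -
  have ws: "w \<circ> gen_s i \<in> W_inf" by (intro comp_W_inf w gen_s_W_inf)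
  define E where "E = (if i = 0 then {(- 1, 1)} else {(int i, int i + 1), (- int i - 1, - int i)})"
  have "inversions w \<inter> E = {}"
    using asc W_infD(4)[OF w, of "int i"] W_infD(4)[OF w, of "int i + 1"] W_infD(4)[OF w, of 1]
    by (auto simp: E_def inversions_def ascent_def)
  then have e1: "inversions w - E = inversions w" by blast
  have m: "w (- int i - 1) = - w (int i + 1)"
    using W_infD(4)[OF w, of "int i + 1"] by simp
  have sub: "E \<subseteq> inversions (w \<circ> gen_s i)"
    using asc W_infD(4)[OF w, of "int i"] W_infD(4)[OF w, of 1] m
    by (auto simp: E_def inversions_def ascent_def gen_s_apply)
  have "finite E" by (simp add: E_def)
  then have "card (inversions (w \<circ> gen_s i)) = card (inversions (w \<circ> gen_s i) - E) + card E"
    using card_Diff_subset[OF _ sub] card_mono[OF finite_inversions(1)[OF ws] sub] by simp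
  then have "card (inversions (w \<circ> gen_s i)) = card (inversions w) + card E"
    using inversions_comp_gen_s[of w i] e1 by (simp add: E_def)
  moreover have "card E + card (negatives (w \<circ> gen_s i)) = card (negatives w) + 2"
  proof (cases "i = 0")
    case True
    have eq: "negatives (w \<circ> gen_s i) = insert 1 (negatives w)"
      using True asc W_infD(4)[OF w, of 1] by (auto simp: negatives_def gen_s_apply ascent_def)
    have "1 \<notin> negatives w" using True asc by (auto simp: negatives_def ascent_def)
    then show ?thesis unfolding eq using True finite_inversions(2)[OF w] by (simp add: E_def)
  next
    case False
    have "bij_betw (gen_s i) (negatives (w \<circ> gen_s i)) (negatives w)"
      by (rule bij_betw_byWitness[of _ "gen_s i"]) (use False in \<open>auto simp: negatives_def gen_s_apply\<close>)
    then have "card (negatives (w \<circ> gen_s i)) = card (negatives w)" by (rule bij_betw_same_card)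
    then show ?thesis using False by (simp add: E_def)
  qed
  ultimately show ?thesis by (simp add: inv_count_def)
qed

lemma inv_count_id: "inv_count id = 0"
proof -
  have "inversions id = {}" "negatives id = {}" by (auto simp: inversions_def negatives_def)
  then show ?thesis by (simp only: inv_count_def card.empty)
qed

lemma ascent_comp:
  assumes w: "w \<in> W_inf"
  shows "ascent (w \<circ> gen_s i) i \<longleftrightarrow> \<not> ascent w i"
proof (cases "i = 0")
  case True
  then show ?thesis using W_infD(4)[OF w, of 1] W_infD(5)[OF w, of 1] by (auto simp: ascent_def gen_s_apply)
next
  case False
  have "w (int i) \<noteq> w (int i + 1)" using W_infD(2)[OF w] by (auto simp: inj_eq)
  then show ?thesis using False by (auto simp: ascent_def gen_s_apply)
qed

lemma comp_gen_s_gen_s [simp]: "w \<circ> gen_s i \<circ> gen_s i = w"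
  by (simp add: comp_assoc)

lemma inv_count_descent:
  assumes w: "w \<in> W_inf" and "\<not> ascent w i"
  shows "inv_count w = inv_count (w \<circ> gen_s i) + 2"
proof -
  have "ascent (w \<circ> gen_s i) i" using assms ascent_comp by blast
  from inv_count_ascent[OF comp_W_inf[OF w gen_s_W_inf] this] show ?thesis
    by (simp only: comp_gen_s_gen_s)
qed

text \<open>Strict increase makes w(a) - a weakly increasing on positive a; it starts at a value
  \<ge> 0 and is 0 beyond the support, hence it vanishes throughout.\<close>

lemma all_ascents_id:
  assumes w: "w \<in> W_inf" and asc: "\<And>i. ascent w i"
  shows "w = id"
proof -
  obtain M where M: "M \<ge> 0" "\<And>x. \<bar>x\<bar> > M \<Longrightarrow> w x = x" "\<And>x. \<bar>x\<bar> \<le> M \<Longrightarrow> \<bar>w x\<bar> \<le> M"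
    using W_inf_bound[OF w] by blast
  have mono: "w (int a) - int a \<le> w (int (a + d)) - int (a + d)" if "a \<ge> 1" for a d
  proof (induction d)
    case (Suc d)
    have "w (int (a + d)) < w (int (a + d) + 1)" using asc[of "a + d"] that by (auto simp: ascent_def)
    then show ?case using Suc by (simp add: algebra_simps)
  qed simp
  have "w (int a) = int a" if a: "a \<ge> 1" for a
  proof -
    have "1 \<le> w (int 1)" using asc[of 0] by (auto simp: ascent_def)
    then have "0 \<le> w (int a) - int a" using mono[of 1 "a - 1"] a by simp
    moreover have "w (int (a + nat M)) = int (a + nat M)" using a M by (intro M) simp
    then have "w (int a) - int a \<le> 0" using mono[OF a, of "nat M"] by simp
    ultimately show ?thesis by simp
  qed
  note pos = this
  show ?thesis
  proof
    fix x :: int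
    show "w x = id x"
      using pos[of "nat x"] pos[of "nat (- x)"] W_infD(3)[OF w] W_infD(4)[OF w, of x]
      by (cases "x > 0"; cases "x = 0") auto
  qed
qed

section \<open>Words in the generators and the length function\<close>

definition word :: "nat list \<Rightarrow> int \<Rightarrow> int" where
  "word is = foldr (\<circ>) (map gen_s is) id"

lemma word_simps [simp]: "word [] = id" "word (i # is) = gen_s i \<circ> word is"
  by (simp_all add: word_def)

lemma word_append: "word (is @ js) = word is \<circ> word js"
  by (induction "is") (auto simp: fun_eq_iff)

lemma word_W_inf: "word is \<in> W_inf"
proof (induction "is")
  case (Cons i "is")
  show ?case using comp_W_inf[OF gen_s_W_inf Cons] by (simp only: word_simps)
qed (simp only: word_simps id_W_inf)

lemma inv_word: "winv (word is) = word (rev is)"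
proof (induction "is")
  case (Cons i "is")
  have "winv (gen_s i \<circ> word is) = winv (word is) \<circ> winv (gen_s i)"
    by (rule o_inv_distrib) (auto intro: W_infD word_W_inf gen_s_W_inf)
  then show ?case by (simp only: word_simps rev.simps word_append Cons inv_gen_s comp_id)
qed (simp add: inv_id)

lemma inv_count_word: "inv_count (word is) \<le> 2 * length is"
proof (induction "is" rule: rev_induct)
  case Nil
  show ?case by (simp only: word_simps inv_count_id)
next
  case (snoc i "is")
  have "inv_count (word (is @ [i])) = inv_count (word is \<circ> gen_s i)"
    by (simp only: word_append word_simps comp_id)
  also have "\<dots> \<le> inv_count (word is) + 2"
    using inv_count_ascent[OF word_W_inf, of "is" i] inv_count_descent[OF word_W_inf, of "is" i] by linarith
  also have "\<dots> \<le> 2 * length is + 2" using snoc by simp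
  finally show ?case by simp
qed

lemma ex_word:
  assumes "w \<in> W_inf"
  shows "\<exists>is. 2 * length is = inv_count w \<and> w = word is"
  using assms
proof (induction "inv_count w" arbitrary: w rule: less_induct)
  case less
  show ?case
  proof (cases "\<forall>i. ascent w i")
    case True
    then have "w = id" using all_ascents_id less by blast
    then show ?thesis by (intro exI[of _ "[]"]) (simp only: inv_count_id word_simps list.size mult_0_right)
  next
    case False
    then obtain i where i: "\<not> ascent w i" by blast
    have eq: "inv_count w = inv_count (w \<circ> gen_s i) + 2"
      using inv_count_descent[OF less(2) i] .
    then obtain "is" where "2 * length is = inv_count (w \<circ> gen_s i)" "w \<circ> gen_s i = word is"
      using less(1)[of "w \<circ> gen_s i"] comp_W_inf[OF less(2) gen_s_W_inf] by auto
    moreover from this have "w = word (is @ [i])"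
      by (metis comp_gen_s_gen_s word_append word_simps comp_id)
    ultimately show ?thesis using eq by (intro exI[of _ "is @ [i]"]) simp
  qed
qed

text \<open>Every letter changes the count by exactly 2, which bounds the length of any word from
  below, and walking down descents produces a word attaining the bound.\<close>

lemma inv_count_len:
  assumes w: "w \<in> W_inf"
  shows "inv_count w = 2 * len w"
proof -
  obtain "is" where ws: "2 * length is = inv_count w" "w = word is" using ex_word[OF w] by blast
  have "len w = length is"
    unfolding len_def word_def[symmetric]
  proof (rule Least_equality)
    show "\<exists>js. length js = length is \<and> w = word js" using ws by blast
    fix m assume "\<exists>js. length js = m \<and> w = word js"
    then obtain js where "length js = m" "w = word js" by blast
    then show "length is \<le> m" using inv_count_word[of js] ws(1) by simp
  qed
  then show ?thesis using ws by simp
qed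

lemma len_comp_gen_s:
  assumes w: "w \<in> W_inf"
  shows "ascent w i \<Longrightarrow> len (w \<circ> gen_s i) = Suc (len w)"
    and "\<not> ascent w i \<Longrightarrow> len w = Suc (len (w \<circ> gen_s i))"
proof -
  note count = inv_count_len[OF w] inv_count_len[OF comp_W_inf[OF w gen_s_W_inf, of i]]
  show "len (w \<circ> gen_s i) = Suc (len w)" if "ascent w i"
    using inv_count_ascent[OF w that] count by linarith
  show "len w = Suc (len (w \<circ> gen_s i))" if "\<not> ascent w i"
    using inv_count_descent[OF w that] count by linarith
qed

lemma len_less_comp_gen_s:
  assumes "w \<in> W_inf"
  shows "len w < len (w \<circ> gen_s i) \<longleftrightarrow> ascent w i" "len (w \<circ> gen_s i) < len w \<longleftrightarrow> \<not> ascent w i"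
proof -
  have "if ascent w i then len (w \<circ> gen_s i) = Suc (len w) else len w = Suc (len (w \<circ> gen_s i))"
    using len_comp_gen_s[OF assms, of i] by argo
  then show "len w < len (w \<circ> gen_s i) \<longleftrightarrow> ascent w i" "len (w \<circ> gen_s i) < len w \<longleftrightarrow> \<not> ascent w i"
    by (simp_all split: if_splits)
qed

lemma len_inv:
  assumes w: "w \<in> W_inf"
  shows "len (winv w) = len w"
proof -
  have le: "len (winv v) \<le> len v" if v: "v \<in> W_inf" for v
  proof -
    obtain "is" where ws: "2 * length is = inv_count v" "v = word is" using ex_word[OF v] by blast
    have "len (winv v) \<le> length (rev is)"
      unfolding len_def word_def[symmetric] ws(2) inv_word by (rule Least_le) blast
    then show ?thesis using ws inv_count_len[OF v] by simp
  qed
  have "winv (winv w) = w" using W_infD(1)[OF w] by (rule inv_inv_eq)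
  then show ?thesis using le[OF w] le[OF inv_W_inf[OF w]] by simp
qed

text \<open>Inversion turns left multiplication into right multiplication and keeps the length, so
  left descents are read off from the positions of the values i and i + 1 (of the value 1, if i =
  0).\<close>

lemma len_gen_s_comp:
  assumes w: "w \<in> W_inf"
  shows "len (gen_s i \<circ> w) < len w \<longleftrightarrow> \<not> ascent (winv w) i"
    and "\<not> ascent (winv w) i \<Longrightarrow> len w = Suc (len (gen_s i \<circ> w))"
proof -
  have "winv (gen_s i \<circ> w) = winv w \<circ> winv (gen_s i)"
    by (rule o_inv_distrib) (auto intro: W_infD w gen_s_W_inf)
  then have eq: "len (gen_s i \<circ> w) = len (winv w \<circ> gen_s i)"
    using len_inv[OF comp_W_inf[OF gen_s_W_inf w, of i]] by simp
  show "len (gen_s i \<circ> w) < len w \<longleftrightarrow> \<not> ascent (winv w) i"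
    unfolding eq using len_less_comp_gen_s(2)[OF inv_W_inf[OF w], of i] len_inv[OF w] by simp
  show "len w = Suc (len (gen_s i \<circ> w))" if "\<not> ascent (winv w) i"
    unfolding eq using len_comp_gen_s(2)[OF inv_W_inf[OF w] that] len_inv[OF w] by simp
qed

lemma len_id [simp]: "len id = 0"
  unfolding len_def by (rule Least_eq_0) (auto intro: exI[of _ "[]"])

lemma len_gen_s: "len (gen_s i) = 1"
  using len_comp_gen_s(1)[OF id_W_inf, of i] by (simp add: ascent_def)

lemma ex_right_descent:
  assumes "w \<in> W_inf" "w \<noteq> id"
  obtains i where "len (w \<circ> gen_s i) < len w"
  using all_ascents_id[OF assms(1)] assms(2) len_less_comp_gen_s(2)[OF assms(1)] by blast

section \<open>Uniqueness of double Schubert polynomials\<close>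

lemma lookup_mon_map:
  "Poly_Mapping.lookup (mon_map \<tau> m) w = (\<Sum>v\<in>Poly_Mapping.keys m. Poly_Mapping.lookup m v when \<tau> v = w)"
  by (simp add: mon_map_def lookup_sum lookup_single)

lemma mon_map_ident: "mon_map (\<lambda>v. v) m = m"
proof (rule poly_mapping_eqI)
  fix w
  have "(\<Sum>v\<in>Poly_Mapping.keys m. Poly_Mapping.lookup m v when v = w) = Poly_Mapping.lookup m w"
    by (simp add: when_def sum.delta' in_keys_iff)
  then show "Poly_Mapping.lookup (mon_map (\<lambda>v. v) m) w = Poly_Mapping.lookup m w"
    by (simp add: lookup_mon_map)
qed

lemma mon_map_mon_map:
  fixes m :: "'u \<Rightarrow>\<^sub>0 nat" and \<tau> :: "'v \<Rightarrow> 'w"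
  shows "mon_map \<tau> (mon_map \<sigma> m) = mon_map (\<lambda>v. \<tau> (\<sigma> v)) m"
proof -
  have "mon_map \<tau> (\<Sum>v\<in>A. f v) = (\<Sum>v\<in>A. mon_map \<tau> (f v))" if "finite A" for A :: "'u set" and f
    using that by induction (auto simp: mon_map_add)
  then show ?thesis by (simp add: mon_map_def[of \<sigma>] mon_map_def[of "\<lambda>v. \<tau> (\<sigma> v)"])
qed

lemma mcoeff_msub_involution:
  assumes "\<And>v. \<tau> (\<tau> v) = v"
  shows "mcoeff (msub (\<lambda>_. 1) \<tau> f) m = mcoeff f (mon_map \<tau> m)"
proof -
  have "mon_map \<tau> (mon_map \<tau> m) = m" for m
    by (simp add: mon_map_mon_map assms mon_map_ident)
  then have "fib (\<lambda>_. 1) \<tau> m = {mon_map \<tau> m}"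
    by (auto simp: fib_def mon_wt_nonzero)
  then show ?thesis by (simp add: mcoeff_msub mon_wt_def)
qed

fun ev_c :: "var \<Rightarrow> int" where "ev_c (X i) = 0" | "ev_c (Z i) = 1" | "ev_c (T i) = 1"
fun ev_t :: "var \<Rightarrow> var" where "ev_t (X i) = X i" | "ev_t (Z i) = T i" | "ev_t (T i) = T i"

lemma ok_ev: "subst_ok c ev_t"
proof (rule subst_okI)
  fix w
  have "{v. ev_t v = w} \<subseteq> {w} \<union> {Z i | i. w = T i}"
  proof
    fix v assume "v \<in> {v. ev_t v = w}"
    then show "v \<in> {w} \<union> {Z i | i. w = T i}" by (cases v) auto
  qed
  moreover have "finite {Z i | i. w = T i}" by (cases w) auto
  ultimately show "finite {v. ev_t v = w}" by (auto intro: finite_subset)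
qed

text \<open>Localization at the identity: \<open>x = 0\<close> and \<open>z = t\<close>.\<close>

definition ev :: "rinf \<Rightarrow> (var, int) mfps" where
  "ev f = msub ev_c ev_t (series_of f)"

lemma rhom_ev: "rhom ev"
  unfolding rhom_def ev_def by (simp add: series_of_simps rhom_simps[OF rhom_msub[OF ok_ev]])

lemma ev_Q: "fps_map ev (Abs_fps Qpol) = 1"
proof -
  have "fps_map ev (Abs_fps Qpol) = fps_map (msub ev_c ev_t) (Abs_fps Qser)"
    by (simp add: fps_eq_iff ev_def Qpol.rep_eq)
  also have "\<dots> = 1" by (rule msub_Q_zero[OF ok_ev]) simp
  finally show ?thesis .
qed

lemma ev_Qpol: "ev (Qpol r) = (if r = 0 then 1 else 0)"
proof -
  have "fps_nth (fps_map ev (Abs_fps Qpol)) r = (if r = 0 then 1 else 0)"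
    by (simp add: ev_Q)
  then show ?thesis by simp
qed

lemma ev_z_t: "ev (zvar i) = ev (tvar i)" "i \<ge> 1 \<Longrightarrow> ev (tvar i) = mvar (T i)"
  by (simp_all add: ev_def zvar.rep_eq tvar.rep_eq msub_mvar[OF ok_ev])

lemma ev_constant_term: "mcoeff (ev f) 0 = constant_term f"
  by (simp add: ev_def constant_term_def)

lemma ev_polynomial: "ev f \<in> subring_gen {mvar (T i) | i. i \<ge> 1}"
proof (induction f rule: rinf_induct)
  case (Q r)
  then show ?case by (auto simp: ev_Qpol intro: subring_gen.one subring_gen_zero)
next
  case (z i)
  then show ?case by (auto simp: ev_z_t intro!: subring_gen.gen)
next
  case (t i)
  then show ?case by (auto simp: ev_z_t intro!: subring_gen.gen)
qed (auto simp: rhom_simps[OF rhom_ev] intro: subring_gen.intros)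

lemma polynomial_support:
  assumes "f \<in> subring_gen {mvar (T i) :: (var, int) mfps | i. i \<ge> 1}"
  shows "\<exists>N. \<forall>m. mcoeff f m \<noteq> 0 \<longrightarrow> Poly_Mapping.keys m \<subseteq> T ` {1..N}"
  using assms
proof induction
  case one
  show ?case by (auto simp: one_mfps.rep_eq)
next
  case (gen g)
  then obtain i where i: "g = mvar (T i)" "i \<ge> 1" by blast
  show ?case using i(2) by (intro exI[of _ i]) (auto simp: i(1) mvar.rep_eq split: if_splits)
next
  case (diff a b)
  then obtain M N where MN: "\<And>m. mcoeff a m \<noteq> 0 \<Longrightarrow> Poly_Mapping.keys m \<subseteq> T ` {1..M}"
    "\<And>m. mcoeff b m \<noteq> 0 \<Longrightarrow> Poly_Mapping.keys m \<subseteq> T ` {1..N}" by blast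
  have "Poly_Mapping.keys m \<subseteq> T ` {1..max M N}" if "mcoeff (a - b) m \<noteq> 0" for m
  proof -
    have "mcoeff a m \<noteq> 0 \<or> mcoeff b m \<noteq> 0" using that by (auto simp: minus_mfps.rep_eq)
    then have "Poly_Mapping.keys m \<subseteq> T ` {1..M} \<or> Poly_Mapping.keys m \<subseteq> T ` {1..N}" using MN by blast
    moreover have "T ` {1..M} \<subseteq> T ` {1..max M N}" "T ` {1..N} \<subseteq> T ` {1..max M N}" by (intro image_mono; simp)+
    ultimately show ?thesis by blast
  qed
  then show ?case by blast
next
  case (mult a b)
  then obtain M N where MN: "\<And>m. mcoeff a m \<noteq> 0 \<Longrightarrow> Poly_Mapping.keys m \<subseteq> T ` {1..M}"
    "\<And>m. mcoeff b m \<noteq> 0 \<Longrightarrow> Poly_Mapping.keys m \<subseteq> T ` {1..N}" by blast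
  have "Poly_Mapping.keys m \<subseteq> T ` {1..max M N}" if "mcoeff (a * b) m \<noteq> 0" for m
  proof -
    have "(\<Sum>(p, q)\<in>{(p, q). p + q = m}. mcoeff a p * mcoeff b q) \<noteq> 0"
      using that by (simp only: times_mfps.rep_eq not_False_eq_True)
    from sum.not_neutral_contains_not_neutral[OF this]
    obtain x where "x \<in> {(p, q). p + q = m}" "(case x of (p, q) \<Rightarrow> mcoeff a p * mcoeff b q) \<noteq> 0" .
    then obtain p q where pq: "p + q = m" "mcoeff a p \<noteq> 0" "mcoeff b q \<noteq> 0" by auto
    have "T ` {1..M} \<subseteq> T ` {1..max M N}" "T ` {1..N} \<subseteq> T ` {1..max M N}" by (intro image_mono; simp)+
    then have "Poly_Mapping.keys p \<union> Poly_Mapping.keys q \<subseteq> T ` {1..max M N}"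
      using MN(1)[OF pq(2)] MN(2)[OF pq(3)] by (intro Un_least) (rule order_trans, assumption, assumption)+
    then show ?thesis using order_trans[OF keys_add[of p q]] pq(1) by simp
  qed
  then show ?case by blast
qed

fun tsw :: "nat \<Rightarrow> var \<Rightarrow> var" where
  "tsw i (X j) = X j" | "tsw i (Z j) = Z j" | "tsw i (T j) = T (transpose i (i + 1) j)"

lemma tsw_invol: "tsw i (tsw i v) = v"
  by (cases v) auto

lemma ok_tsw: "subst_ok c (tsw i)"
proof (rule subst_okI)
  fix w have "{v. tsw i v = w} \<subseteq> {tsw i w}" by (auto simp: tsw_invol)
  then show "finite {v. tsw i v = w}" by (rule finite_subset) simp
qed

text \<open>Successive transpositions carry a variable t_i of m to t_(N+1) without changing the
  coefficient; but no monomial of f contains a variable of index above N.\<close>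

lemma symmetric_polynomial_constant:
  assumes "f \<in> subring_gen {mvar (T i) :: (var, int) mfps | i. i \<ge> 1}"
    and inv: "\<And>i. i \<ge> 1 \<Longrightarrow> msub (\<lambda>_. 1) (tsw i) f = f"
    and "m \<noteq> 0"
  shows "mcoeff f m = 0"
proof -
  obtain N where N: "\<And>m. mcoeff f m \<noteq> 0 \<Longrightarrow> Poly_Mapping.keys m \<subseteq> T ` {1..N}"
    using polynomial_support[OF assms(1)] by blast
  have vanish: "mcoeff f m = 0" if "T i \<in> Poly_Mapping.keys m" "i \<ge> 1" "i + d = Suc N" for i d m
    using that
  proof (induction d arbitrary: i m)
    case 0
    then show ?case using N[of m] by fastforce
  next
    case (Suc d)
    have "T (i + 1) \<in> Poly_Mapping.keys (mon_map (tsw i) m)"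
      using lookup_le_mon_map[of m "T i" "tsw i"] Suc.prems(1) by (auto simp: in_keys_iff)
    then have "mcoeff f (mon_map (tsw i) m) = 0"
      using Suc.prems by (intro Suc.IH[of "i + 1"]) auto
    then show ?case
      using mcoeff_msub_involution[of "tsw i" f m] inv[OF Suc.prems(2)] by (simp add: tsw_invol)
  qed
  show ?thesis
  proof (rule ccontr)
    assume nz: "mcoeff f m \<noteq> 0"
    obtain v where v: "v \<in> Poly_Mapping.keys m" using \<open>m \<noteq> 0\<close> by (metis keys_eq_empty ex_in_conv)
    then obtain i where "v = T i" "1 \<le> i" "i \<le> N" using N[OF nz] by auto
    then show False using vanish[of i m "Suc N - i"] v nz by simp
  qed
qed

text \<open>Exchanging z_i with z_(i+1) and t_i with t_(i+1) simultaneously is compatible with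
  setting z = t, and becomes the exchange of t_i and t_(i+1).\<close>

lemma ev_s_z_s_t:
  assumes "i \<ge> 1"
  shows "ev (s_z i (s_t i f)) = msub (\<lambda>_. 1) (tsw i) (ev f)"
proof -
  have h: "rhom (\<lambda>f. ev (s_z i (s_t i f)))" "rhom (\<lambda>f. msub (\<lambda>_. 1) (tsw i) (ev f))"
    using rhom_comp[OF rhom_ev rhom_comp[OF rhom_s_z rhom_s_t], of i i]
      rhom_comp[OF rhom_msub[OF ok_tsw] rhom_ev, of "\<lambda>_. 1" i] by (simp_all add: comp_def)
  have "(\<lambda>f. ev (s_z i (s_t i f))) = (\<lambda>f. msub (\<lambda>_. 1) (tsw i) (ev f))"
  proof (rule rhom_rinf_eqI[OF h])
    show "ev (s_z i (s_t i (Qpol r))) = msub (\<lambda>_. 1) (tsw i) (ev (Qpol r))" for r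
      by (simp add: s_t_gens[OF assms] s_z_gens[OF assms] ev_Qpol msub_one[OF ok_tsw])
    show "ev (s_z i (s_t i (zvar j))) = msub (\<lambda>_. 1) (tsw i) (ev (zvar j))" if "j \<ge> 1" for j
      using that transpose_ge_1[OF assms that]
      by (simp add: s_t_gens[OF assms] s_z_gens[OF assms] ev_z_t msub_mvar[OF ok_tsw])
    show "ev (s_z i (s_t i (tvar j))) = msub (\<lambda>_. 1) (tsw i) (ev (tvar j))" if "j \<ge> 1" for j
      using that transpose_ge_1[OF assms that]
      by (simp add: s_t_gens[OF assms] s_z_gens[OF assms] ev_z_t msub_mvar[OF ok_tsw])
  qed
  then show ?thesis by (rule fun_cong)
qed

lemma ddiff_zero [simp]: "ddiff_z i 0 = 0" "ddiff_t i 0 = 0"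
  by (rule ddiff_zI ddiff_tI, simp add: rhom_zero[OF rhom_s_z] rhom_zero[OF rhom_s_t])+

lemma ev_alpha: "ev (omega (alpha i)) = - ev (alpha i)"
  unfolding omega_alpha by (auto simp: alpha_def rhom_simps[OF rhom_ev] ev_z_t)

section \<open>Localization and uniqueness of double Schubert polynomials\<close>

locale schubert =
  fixes C :: "(int \<Rightarrow> int) \<Rightarrow> rinf"
  assumes double_schubert: "double_schubert C"
begin

lemma basis: "is_Zt_basis W_inf C"
  and C_id: "C id = 1"
  and ddiff_z_C: "w \<in> W_inf \<Longrightarrow> ddiff_z i (C w) = (if len (w \<circ> gen_s i) < len w then C (w \<circ> gen_s i) else 0)"
  and ddiff_t_C: "w \<in> W_inf \<Longrightarrow> ddiff_t i (C w) = (if len (gen_s i \<circ> w) < len w then C (gen_s i \<circ> w) else 0)"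
  and constant_term_C: "w \<in> W_inf \<Longrightarrow> w \<noteq> id \<Longrightarrow> constant_term (C w) = 0"
  using double_schubert unfolding double_schubert_def by blast+

text \<open>By induction on the length, for w other than the identity \<open>ev (C w)\<close> is
  invariant under exchanging t_i and t_(i+1) for all i \<ge> 1. Being a polynomial in finitely many
  t, it is constant, and its constant term is that of \<open>C w\<close>.\<close>

lemma ev_C:
  assumes "w \<in> W_inf"
  shows "ev (C w) = (if w = id then 1 else 0)"
  using assms
proof (induction "len w" arbitrary: w rule: less_induct)
  case less
  show ?case
  proof (cases "w = id")
    case True
    then show ?thesis by (simp only: C_id rhom_one[OF rhom_ev] if_True simp_thms)
  next
    case False
    have inv: "msub (\<lambda>_. 1) (tsw i) (ev (C w)) = ev (C w)" if i: "i \<ge> 1" for i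
    proof -
      let ?f = "C w" and ?s = "gen_s i"
      have sw: "?s \<circ> w \<in> W_inf" "w \<circ> ?s \<in> W_inf" using less.prems gen_s_W_inf comp_W_inf by blast+
      have right: "w \<circ> ?s = id \<longleftrightarrow> w = ?s"
      proof
        assume "w \<circ> ?s = id"
        then have "w \<circ> ?s \<circ> ?s = id \<circ> ?s" by (simp only:)
        then show "w = ?s" by (simp only: comp_gen_s_gen_s id_comp)
      qed (simp only: gen_s_comp)
      have left: "?s \<circ> w = id \<longleftrightarrow> w = ?s"
      proof
        assume "?s \<circ> w = id"
        then have "?s \<circ> (?s \<circ> w) = ?s \<circ> id" by (simp only:)
        then show "w = ?s" by (simp only: comp_assoc[symmetric] gen_s_comp id_comp comp_id)
      qed (simp only: gen_s_comp)
      have lens: "len (w \<circ> ?s) < len w" "len (?s \<circ> w) < len w" if "w = ?s"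
        by (simp_all only: that gen_s_comp len_id len_gen_s)
      have p: "ev (ddiff_z i ?f) = (if w = ?s then 1 else 0)"
        unfolding ddiff_z_C[OF less.prems]
        using less.hyps[OF _ sw(2)] right lens(1) by (auto simp: rhom_zero[OF rhom_ev] simp del: comp_apply)
      have q: "ev (ddiff_t i ?f) = (if w = ?s then 1 else 0)"
        unfolding ddiff_t_C[OF less.prems]
        using less.hyps[OF _ sw(1)] left lens(2) by (auto simp: rhom_zero[OF rhom_ev] simp del: comp_apply)
      \<comment> \<open>The mixed difference is 0 or belongs to the shorter element s_i w s_i, which
        is the identity only if w is.\<close>
      have r: "ev (ddiff_z i (ddiff_t i ?f)) = 0"
      proof (cases "len (?s \<circ> w) < len w \<and> len (?s \<circ> w \<circ> ?s) < len (?s \<circ> w)")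
        case True
        have "?s \<circ> w \<circ> ?s \<noteq> id"
        proof
          assume "?s \<circ> w \<circ> ?s = id"
          then have "?s \<circ> w \<circ> ?s \<circ> ?s = id \<circ> ?s" by (simp only:)
          then have "?s \<circ> w = ?s" by (simp only: comp_gen_s_gen_s id_comp)
          then have "?s \<circ> (?s \<circ> w) = ?s \<circ> ?s" by (simp only:)
          then show False using False by (simp only: comp_assoc[symmetric] gen_s_comp id_comp)
        qed
        moreover have "?s \<circ> w \<circ> ?s \<in> W_inf" using sw gen_s_W_inf comp_W_inf by blast
        ultimately have "ev (C (?s \<circ> w \<circ> ?s)) = 0" using less.hyps[of "?s \<circ> w \<circ> ?s"] True by auto
        then show ?thesis using True by (simp only: ddiff_t_C[OF less.prems] ddiff_z_C[OF sw(1)] if_True)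
      next
        case False
        then have "ddiff_z i (ddiff_t i ?f) = 0"
          unfolding ddiff_t_C[OF less.prems] using ddiff_z_C[OF sw(1), of i] by auto
        then show ?thesis by (simp add: rhom_zero[OF rhom_ev])
      qed
      \<comment> \<open>f - s_z s_t f splits as (f - s_z f) + s_z (f - s_t f). Since omega(alpha_i)
        localizes to minus alpha_i, the two contributions are -p and q times \<open>?a\<close>, with
        p = q by the induction hypothesis; fact \<open>r\<close> permits replacing s_z g by
        g.\<close>
      let ?g = "ddiff_t i ?f" and ?a = "ev (alpha i)"
      have 1: "ev ?f - ev (s_z i ?f) = - ?a * ev (ddiff_z i ?f)"
        using arg_cong[OF ddiff_z_eq[of ?f i], of ev] by (simp only: rhom_simps[OF rhom_ev] ev_alpha)
      have "s_z i ?f - s_z i (s_t i ?f) = alpha i * s_z i ?g"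
        using arg_cong[OF ddiff_t_eq[of ?f i], of "s_z i"] by (simp only: rhom_simps[OF rhom_s_z] s_z_alpha)
      then have 2: "ev (s_z i ?f) - ev (s_z i (s_t i ?f)) = ?a * ev (s_z i ?g)"
        using arg_cong[of _ _ ev] by (simp only: rhom_diff[OF rhom_ev, symmetric] rhom_mult[OF rhom_ev, symmetric])
      have 3: "ev ?g - ev (s_z i ?g) = - ?a * ev (ddiff_z i ?g)"
        using arg_cong[OF ddiff_z_eq[of ?g i], of ev] by (simp only: rhom_simps[OF rhom_ev] ev_alpha)
      then have "ev (s_z i ?g) = ev ?g" using r by simp
      then have "ev ?f = ev (s_z i (s_t i ?f))"
        using 1 2 p q by (simp add: algebra_simps split: if_splits)
      then show ?thesis using ev_s_z_s_t[OF i, of ?f] by simp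
    qed
    have "ev (C w) = 0"
    proof (rule mfps_eqI)
      fix m show "mcoeff (ev (C w)) m = mcoeff 0 m"
        using symmetric_polynomial_constant[OF ev_polynomial inv, of m] constant_term_C[OF less.prems False]
        by (cases "m = 0") (simp_all add: ev_constant_term zero_mfps.rep_eq)
    qed
    then show ?thesis using False by (simp only: if_False)
  qed
qed

lemma s_z_Zt: "f \<in> Zt \<Longrightarrow> s_z i f = f"
  unfolding Zt_def
proof (induction rule: subring_gen.induct)
  case (gen g)
  then obtain j where "g = tvar j" by blast
  then show ?case by (cases "i = 0") (auto simp: s_z_gens s_z_0_gens)
qed (auto simp: rhom_simps[OF rhom_s_z])

text \<open>The operator at i is linear over \<open>Zt\<close> and sends the basis elements with a
  right descent at i to distinct basis elements, the others to 0. Hence a kernel element has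
  coefficient 0 at every w with a right descent, and the identity is the only element without
  one.\<close>

lemma ddiff_z_kernel:
  assumes ker: "\<And>i. ddiff_z i f = 0"
  shows "f \<in> Zt"
proof -
  have "\<exists>!a. (\<forall>w\<in>W_inf. a w \<in> Zt) \<and> (\<forall>w. w \<notin> W_inf \<longrightarrow> a w = 0) \<and> finite {w. a w \<noteq> 0} \<and>
      f = (\<Sum>w | a w \<noteq> 0. a w * C w)"
    using basis unfolding is_Zt_basis_def by (rule spec)
  then obtain a where a_all: "(\<forall>w\<in>W_inf. a w \<in> Zt) \<and> (\<forall>w. w \<notin> W_inf \<longrightarrow> a w = 0) \<and> finite {w. a w \<noteq> 0} \<and>
      f = (\<Sum>w | a w \<noteq> 0. a w * C w)"
    by (rule ex1E)
  note a = a_all[THEN conjunct1, THEN bspec] a_all[THEN conjunct2, THEN conjunct1, THEN spec, THEN mp]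
    a_all[THEN conjunct2, THEN conjunct2, THEN conjunct1] a_all[THEN conjunct2, THEN conjunct2, THEN conjunct2]
  have az: "a w \<in> Zt" for w using a(1,2)[of w] subring_gen_zero by (cases "w \<in> W_inf") (auto simp: Zt_def)
  have zero: "a w = 0" if w: "w \<in> W_inf" and less: "len (w \<circ> gen_s i) < len w" for w i
  proof -
    let ?s = "gen_s i"
    define A where "A = {w. a w \<noteq> 0 \<and> len (w \<circ> ?s) < len w}"
    have AW: "w \<in> W_inf" if "w \<in> A" for w using that a(2) by (auto simp: A_def)
    have "f - s_z i f = (\<Sum>w | a w \<noteq> 0. a w * (C w - s_z i (C w)))"
      unfolding a(4) rhom_sum[OF rhom_s_z] rhom_mult[OF rhom_s_z] s_z_Zt[OF az]
      by (simp only: sum_subtractf right_diff_distrib)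
    also have "\<dots> = omega (alpha i) * (\<Sum>w | a w \<noteq> 0. a w * ddiff_z i (C w))"
      unfolding ddiff_z_eq by (simp add: sum_distrib_left mult.left_commute)
    finally have "ddiff_z i f = (\<Sum>w | a w \<noteq> 0. a w * ddiff_z i (C w))"
      by (rule ddiff_zI)
    then have "0 = (\<Sum>w | a w \<noteq> 0. a w * ddiff_z i (C w))" by (simp only: ker)
    also have "(\<Sum>w | a w \<noteq> 0. a w * ddiff_z i (C w)) = (\<Sum>w\<in>A. a w * C (w \<circ> ?s))"
    proof (rule sum.mono_neutral_cong_right)
      show "finite {w. a w \<noteq> 0}" by (rule a)
      show "A \<subseteq> {w. a w \<noteq> 0}" by (auto simp: A_def)
      show "\<forall>w\<in>{w. a w \<noteq> 0} - A. a w * ddiff_z i (C w) = 0"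
      proof
        fix w assume w: "w \<in> {w. a w \<noteq> 0} - A"
        then have "w \<in> W_inf" using a(2) by blast
        moreover have "\<not> len (w \<circ> ?s) < len w" using w unfolding A_def by blast
        ultimately show "a w * ddiff_z i (C w) = 0" by (simp only: ddiff_z_C if_False mult_zero_right)
      qed
      show "a w * ddiff_z i (C w) = a w * C (w \<circ> ?s)" if "w \<in> A" for w
        using that by (simp only: ddiff_z_C[OF AW[OF that], of i] A_def mem_Collect_eq if_True)
    qed
    finally have sum0: "(\<Sum>w\<in>A. a w * C (w \<circ> ?s)) = 0" by (rule sym)
    \<comment> \<open>b transports the surviving coefficients to the elements w s_i. It expands 0,
      so by uniqueness of expansions it is the zero family.\<close>
    define b where "b = (\<lambda>v. if v \<in> (\<lambda>w. w \<circ> ?s) ` A then a (v \<circ> ?s) else 0)"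
    have inj: "inj_on (\<lambda>w. w \<circ> ?s) A"
      by (rule inj_on_inverseI[of _ "\<lambda>w. w \<circ> ?s"]) (rule comp_gen_s_gen_s)
    have supp: "{v. b v \<noteq> 0} = (\<lambda>w. w \<circ> ?s) ` A"
      by (auto simp only: b_def comp_gen_s_gen_s A_def split: if_splits)
    define P where "P a \<longleftrightarrow> (\<forall>w\<in>W_inf. a w \<in> Zt) \<and> (\<forall>w. w \<notin> W_inf \<longrightarrow> a w = 0) \<and>
      finite {w. a w \<noteq> 0} \<and> 0 = (\<Sum>w | a w \<noteq> 0. a w * C w)" for a
    have ex1: "\<exists>!a. P a"
      using basis unfolding is_Zt_basis_def P_def by (rule spec)
    have P0: "P (\<lambda>_. 0)"
      by (simp add: P_def Zt_def subring_gen_zero)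
    have Pb: "P b"
      unfolding P_def
    proof (intro conjI ballI allI impI)
      have "(\<Sum>v | b v \<noteq> 0. b v * C v) = (\<Sum>w\<in>A. a w * C (w \<circ> ?s))"
        unfolding supp by (rule sum.reindex_cong[OF inj refl]) (simp only: b_def comp_gen_s_gen_s image_eqI if_True)
      then show "0 = (\<Sum>v | b v \<noteq> 0. b v * C v)" by (simp only: sum0)
      show "b v \<in> Zt" for v using az[of "v \<circ> ?s"] by (simp only: b_def Zt_def split: if_split) (simp add: subring_gen_zero)
      show "b v = 0" if "v \<notin> W_inf" for v
      proof -
        have "v \<notin> (\<lambda>w. w \<circ> ?s) ` A" using that AW comp_W_inf gen_s_W_inf by blast
        then show ?thesis by (simp only: b_def if_False)
      qed
      show "finite {v. b v \<noteq> 0}" unfolding supp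
        by (rule finite_imageI, rule finite_subset[OF _ a(3)]) (auto simp: A_def)
    qed
    have "b = (\<lambda>_. 0)" using ex1 P0 Pb by blast
    then have "b (w \<circ> ?s) = 0" by (rule fun_cong)
    then show "a w = 0"
    proof (rule contrapos_pp)
      assume "a w \<noteq> 0"
      then have "w \<in> A" using less unfolding A_def by blast
      then have "b (w \<circ> ?s) = a w" by (simp only: b_def comp_gen_s_gen_s image_eqI if_True)
      then show "b (w \<circ> ?s) \<noteq> 0" using \<open>a w \<noteq> 0\<close> by (simp only: not_False_eq_True)
    qed
  qed
  have "w = id" if "a w \<noteq> 0" for w
    using that a(2)[of w] zero[of w] ex_right_descent[of w] by metis
  then have sub: "{w. a w \<noteq> 0} \<subseteq> {id}" by blast
  have "f = (\<Sum>w\<in>{id}. a w * C w)"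
    unfolding a(4)
  proof (rule sum.mono_neutral_left)
    show "\<forall>w\<in>{id} - {w. a w \<noteq> 0}. a w * C w = 0"
    proof
      fix w assume "w \<in> {id} - {w. a w \<noteq> 0}"
      then have "a w = 0" by blast
      then show "a w * C w = 0" by (simp only: mult_zero_left)
    qed
  qed (simp, rule sub)
  then have "f = a id" by (simp only: sum.insert finite.emptyI empty_iff not_False_eq_True sum.empty C_id mult_1_right add_0_right)
  then show ?thesis using az by simp
qed

lemma neg_ok: "subst_ok (\<lambda>_. -1) (\<lambda>v::var. v)"
  by (rule subst_okI) simp

text \<open>omega sends t_i to -z_i, which localizes to -t_i. So on \<open>Zt\<close> the composite
  merely changes the signs of the variables, and this is injective.\<close>

lemma ev_omega_Zt:
  assumes "g \<in> Zt" "ev (omega g) = 0"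
  shows "g = 0"
proof -
  let ?n = "msub (\<lambda>_. -1) (\<lambda>v::var. v)"
  have "ev (omega g) = ?n (series_of g)"
    using assms(1) unfolding Zt_def
  proof (induction rule: subring_gen.induct)
    case one
    show ?case by (simp add: rhom_simps[OF rhom_omega] rhom_simps[OF rhom_ev] series_of_simps msub_one[OF neg_ok])
  next
    case (gen g)
    then obtain i where "g = tvar i" "i \<ge> 1" by blast
    then show ?case by (simp add: rhom_simps[OF rhom_ev] ev_z_t series_of_tvar msub_mvar[OF neg_ok])
  qed (simp_all add: rhom_simps[OF rhom_omega] rhom_simps[OF rhom_ev] series_of_simps rhom_simps[OF rhom_msub[OF neg_ok]])
  then have n0: "?n (series_of g) = 0" using assms(2) by simp
  have "mcoeff (series_of g) m = 0" for m
  proof -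
    have "fib (\<lambda>_. -1) (\<lambda>v::var. v) m = {m}"
      by (auto simp: fib_def mon_wt_nonzero mon_map_ident)
    moreover have "mcoeff (?n (series_of g)) m = 0" by (simp add: n0 zero_mfps.rep_eq)
    ultimately have "mon_wt (\<lambda>_. -1) m * mcoeff (series_of g) m = 0" by (simp add: mcoeff_msub)
    moreover have "mon_wt (\<lambda>_. -1) m \<noteq> 0" by (simp add: mon_wt_nonzero)
    ultimately show ?thesis by simp
  qed
  then have "series_of g = 0" by (intro mfps_eqI) (simp add: zero_mfps.rep_eq)
  then show ?thesis by (simp add: series_of_inject[symmetric] zero_rinf.rep_eq)
qed

text \<open>The difference F - C w is fixed by all s_t, so omega maps it into the kernel of all
  z-operators, that is into \<open>Zt\<close>, where localization detects it. The recursion is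
  stated before division by alpha_i, the form in which candidates satisfy it.\<close>

lemma C_unique:
  assumes w: "w \<in> W_inf" "w \<noteq> id"
    and F: "\<And>i. F - s_t i F = alpha i * (if len (gen_s i \<circ> w) < len w then C (gen_s i \<circ> w) else 0)"
    and "ev F = 0"
  shows "C w = F"
proof -
  define h where "h = F - C w"
  have fix_h: "s_t i h = h" for i
  proof -
    have "F - s_t i F = C w - s_t i (C w)"
      using F[of i] ddiff_t_eq[of "C w" i] unfolding ddiff_t_C[OF w(1)] by (simp only:)
    then show ?thesis by (simp add: h_def rhom_diff[OF rhom_s_t] algebra_simps)
  qed
  have "s_z i (omega h) = omega h" for i
    using arg_cong[OF fix_h[of i], of omega] by (simp only: s_t_apply omega_invol)
  then have "ddiff_z i (omega h) = 0" for i
    by (intro ddiff_zI) simp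
  then have "omega h \<in> Zt" by (rule ddiff_z_kernel)
  moreover have "ev (omega (omega h)) = 0"
    using assms(4) ev_C[OF w(1)] w(2) by (simp add: h_def rhom_simps[OF rhom_ev])
  ultimately have "omega h = 0" by (rule ev_omega_Zt)
  then have "h = 0" by (metis omega_invol rhom_zero[OF rhom_omega])
  then show ?thesis by (simp add: h_def)
qed

text \<open>S only has to be closed under left descents, so the same induction serves all
  k-Grassmannian elements and the subset on which the determinant formula is proved.\<close>

lemma C_family:
  assumes "S \<subseteq> W_inf" and F_id: "F id = 1"
    and desc: "\<And>w i. w \<in> S \<Longrightarrow> len (gen_s i \<circ> w) < len w \<Longrightarrow>
        gen_s i \<circ> w \<in> S \<and> F w - s_t i (F w) = alpha i * F (gen_s i \<circ> w)"
    and asc: "\<And>w i. w \<in> S \<Longrightarrow> \<not> len (gen_s i \<circ> w) < len w \<Longrightarrow> s_t i (F w) = F w"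
    and ev: "\<And>w. w \<in> S \<Longrightarrow> w \<noteq> id \<Longrightarrow> ev (F w) = 0"
    and "w \<in> S"
  shows "C w = F w"
  using \<open>w \<in> S\<close>
proof (induction "len w" arbitrary: w rule: less_induct)
  case less
  show ?case
  proof (cases "w = id")
    case True
    then show ?thesis by (simp only: C_id F_id)
  next
    case False
    show ?thesis
    proof (rule C_unique)
      show "w \<in> W_inf" using less.prems assms(1) by (rule rev_subsetD)
      show "F w - s_t i (F w) = alpha i * (if len (gen_s i \<circ> w) < len w then C (gen_s i \<circ> w) else 0)" for i
      proof (cases "len (gen_s i \<circ> w) < len w")
        case True
        note step = desc[OF less.prems True]
        have "C (gen_s i \<circ> w) = F (gen_s i \<circ> w)"
          by (rule less.hyps[OF True conjunct1[OF step]])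
        then show ?thesis using conjunct2[OF step] True by (simp only: if_True)
      next
        case ge: False
        then show ?thesis using asc[OF less.prems ge] ge by (simp only: if_False diff_self mult_zero_right)
      qed
      show "w \<noteq> id" by fact
      show "ev (F w) = 0" by (rule ev[OF less.prems False])
    qed
  qed
qed

end

section \<open>Pfaffians of upper triangular arrays\<close>

text \<open>\<open>alt_exp a P ys = \<Sum>s. (-1)\<^sup>s a(y\<^sub>s) P(ys without y\<^sub>s)\<close>\<close>

fun alt_exp :: "('b \<Rightarrow> 'a) \<Rightarrow> ('b list \<Rightarrow> 'a) \<Rightarrow> 'b list \<Rightarrow> 'a::comm_ring_1" where
  "alt_exp a P [] = 0"
| "alt_exp a P (y # ys) = a y * P ys - alt_exp a (\<lambda>zs. P (y # zs)) ys"

text \<open>The recursive calls are made by \<open>alt_exp\<close> on sublists that it forms itself,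
  so the recursion runs over a bound on the length instead.\<close>

primrec pf_fuel :: "nat \<Rightarrow> ('b \<Rightarrow> 'b \<Rightarrow> 'a::comm_ring_1) \<Rightarrow> 'b list \<Rightarrow> 'a" where
  "pf_fuel 0 K xs = 1"
| "pf_fuel (Suc n) K xs = (case xs of [] \<Rightarrow> 1 | x # ys \<Rightarrow> alt_exp (K x) (pf_fuel n K) ys)"

text \<open>Only values \<open>K x y\<close> with x before y in the list are read, and no
  antisymmetry of K is assumed, since Schur-Pfaffian entries lack it. On lists of odd length the
  value is 0.\<close>

definition pfm :: "('b \<Rightarrow> 'b \<Rightarrow> 'a::comm_ring_1) \<Rightarrow> 'b list \<Rightarrow> 'a" where
  "pfm K xs = pf_fuel (length xs) K xs"

lemma alt_exp_cong:
  assumes "\<And>y. y \<in> set ys \<Longrightarrow> a y = b y"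
    "\<And>zs. Suc (length zs) = length ys \<Longrightarrow> set zs \<subseteq> set ys \<Longrightarrow> P zs = Q zs"
  shows "alt_exp a P ys = alt_exp b Q ys"
  using assms
proof (induction ys arbitrary: P Q)
  case (Cons y ys)
  have "alt_exp a (\<lambda>zs. P (y # zs)) ys = alt_exp b (\<lambda>zs. Q (y # zs)) ys"
    by (rule Cons.IH) (auto intro!: Cons.prems)
  moreover have "P ys = Q ys" by (rule Cons.prems) auto
  ultimately show ?case using Cons.prems(1) by simp
qed simp

lemma pf_fuel_eq:
  fixes xs :: "'b list"
  shows "length xs \<le> n \<Longrightarrow> pf_fuel n K xs = pf_fuel (length xs) K xs"
proof (induction "length xs" arbitrary: n xs rule: less_induct)
  case less
  show ?case
  proof (cases xs)
    case Nil
    then show ?thesis by (cases n) auto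
  next
    case (Cons x ys)
    then obtain m where n: "n = Suc m" using less by (cases n) auto
    have "alt_exp (K x) (pf_fuel m K) ys = alt_exp (K x) (pf_fuel (length ys) K) ys"
    proof (rule alt_exp_cong)
      fix zs :: "'b list" assume "Suc (length zs) = length ys"
      then show "pf_fuel m K zs = pf_fuel (length ys) K zs"
        using less(1)[of zs m] less(1)[of zs "length ys"] less(2) Cons n by simp
    qed simp
    then show ?thesis by (simp add: Cons n)
  qed
qed

lemma pfm_Nil [simp]: "pfm K [] = 1"
  by (simp add: pfm_def)

lemma pfm_Cons: "pfm K (x # ys) = alt_exp (K x) (pfm K) ys"
  unfolding pfm_def by (simp, rule alt_exp_cong) (auto intro: pf_fuel_eq)

lemma alt_exp_add: "alt_exp a (\<lambda>z. P z + Q z) ys = alt_exp a P ys + alt_exp a Q ys"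
  by (induction ys arbitrary: P Q) (auto simp: algebra_simps)

lemma alt_exp_scale: "alt_exp a (\<lambda>z. c * P z) ys = c * alt_exp a P ys"
  by (induction ys arbitrary: P) (auto simp: algebra_simps)

lemma alt_exp_diff: "alt_exp a (\<lambda>z. P z - Q z) ys = alt_exp a P ys - alt_exp a Q ys"
  by (induction ys arbitrary: P Q) (auto simp: algebra_simps)

lemma alt_exp_zero: "(\<And>y. y \<in> set ys \<Longrightarrow> a y = 0) \<Longrightarrow> alt_exp a P ys = 0"
  by (induction ys arbitrary: P) auto

lemma alt_exp_zero': "(\<And>zs. Suc (length zs) = length ys \<Longrightarrow> set zs \<subseteq> set ys \<Longrightarrow> P zs = 0) \<Longrightarrow> alt_exp a P ys = 0"
  using alt_exp_cong[of ys a a P "\<lambda>_. 0"] alt_exp_scale[of a 0 P ys] by simp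

lemma alt_exp_alt_exp_Cons:
  "alt_exp a (alt_exp b P) (y # ys) =
    a y * alt_exp b P ys - b y * alt_exp a P ys + alt_exp a (alt_exp b (\<lambda>w. P (y # w))) ys"
  by (simp add: alt_exp_diff alt_exp_scale)

lemma alt_exp_anticommute: "alt_exp a (alt_exp b P) ys + alt_exp b (alt_exp a P) ys = 0"
proof (induction ys arbitrary: P)
  case (Cons y ys)
  show ?case using Cons[of "\<lambda>w. P (y # w)"]
    by (simp only: alt_exp_alt_exp_Cons) (simp add: algebra_simps)
qed simp

text \<open>Not a special case of \<open>alt_exp_anticommute\<close>, as the ring may have
  2-torsion.\<close>

lemma alt_exp_twice: "alt_exp a (alt_exp a P) ys = 0"
proof (induction ys arbitrary: P)
  case (Cons y ys)
  show ?case using Cons[of "\<lambda>w. P (y # w)"] by (simp only: alt_exp_alt_exp_Cons) simp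
qed simp

text \<open>Removing x from either list leaves the same list, at positions of opposite sign, and
  likewise for y; the other terms inherit the exchange relation of P. The bound on the length of cs
  lets that relation be supplied by an induction hypothesis.\<close>

lemma alt_exp_swap:
  assumes "\<And>cs zs. length cs \<le> length as \<Longrightarrow> P (cs @ x # y # zs) + P (cs @ y # x # zs) = \<kappa> * P (cs @ zs)"
  shows "alt_exp a P (as @ x # y # bs) + alt_exp a P (as @ y # x # bs) = \<kappa> * alt_exp a P (as @ bs)"
  using assms
proof (induction as arbitrary: P)
  case Nil
  have "alt_exp a (\<lambda>z. P (x # y # z)) bs + alt_exp a (\<lambda>z. P (y # x # z)) bs = \<kappa> * alt_exp a P bs"
    unfolding alt_exp_add[symmetric] alt_exp_scale[symmetric]
    using Nil[of "[]"] by simp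
  then show ?case by (simp add: algebra_simps)
next
  case (Cons c as)
  have 1: "alt_exp a (\<lambda>z. P (c # z)) (as @ x # y # bs) + alt_exp a (\<lambda>z. P (c # z)) (as @ y # x # bs)
     = \<kappa> * alt_exp a (\<lambda>z. P (c # z)) (as @ bs)"
    using Cons.prems[of "c # cs" for cs] by (intro Cons.IH) simp
  have 2: "P (as @ x # y # bs) + P (as @ y # x # bs) = \<kappa> * P (as @ bs)"
    using Cons.prems[of as bs] by simp
  have "alt_exp a P ((c # as) @ x # y # bs) + alt_exp a P ((c # as) @ y # x # bs) =
     a c * (P (as @ x # y # bs) + P (as @ y # x # bs)) -
     (alt_exp a (\<lambda>z. P (c # z)) (as @ x # y # bs) + alt_exp a (\<lambda>z. P (c # z)) (as @ y # x # bs))"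
    by (simp add: algebra_simps)
  also have "\<dots> = \<kappa> * alt_exp a P ((c # as) @ bs)"
    unfolding 1 2 by (simp add: algebra_simps)
  finally show ?case .
qed

text \<open>For antisymmetric K the right side is 0, the usual sign change. In general the defect is
  the symmetrized entry times the Pfaffian without the two rows, and this is the quantity to control
  when two rows carry the same sequence.\<close>

lemma pfm_swap:
  "pfm K (as @ x # y # bs) + pfm K (as @ y # x # bs) = (K x y + K y x) * pfm K (as @ bs)"
proof (induction "length as" arbitrary: as bs rule: less_induct)
  case less
  show ?case
  proof (cases as)
    case Nil
    have "(\<lambda>z. pfm K (u # z)) = alt_exp (K u) (pfm K)" for u
      by (simp add: fun_eq_iff pfm_Cons)
    then show ?thesis using alt_exp_anticommute[of "K x" "K y" "pfm K" bs]
      by (simp add: Nil pfm_Cons algebra_simps)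
  next
    case (Cons a as')
    show ?thesis unfolding Cons append_Cons pfm_Cons
      by (rule alt_exp_swap) (rule less, simp add: Cons)
  qed
qed

lemma alt_exp_snoc:
  "alt_exp a P (ys @ [u]) = alt_exp a (\<lambda>z. P (z @ [u])) ys + (-1) ^ length ys * a u * P ys"
  by (induction ys arbitrary: P) (auto simp: algebra_simps)

text \<open>The border g is a last column on one side and a first row on the other. Moving it past
  an odd number of rows and reversing its entries gives two signs that cancel.\<close>

lemma pfm_snoc_unit:
  assumes "odd (length xs)" "\<And>x. x \<in> set xs \<Longrightarrow> K x u = g x"
  shows "pfm K (xs @ [u]) = alt_exp g (pfm K) xs"
  using assms
proof (induction "length xs" arbitrary: xs rule: less_induct)
  case less
  then obtain x ys where xs: "xs = x # ys" by (cases xs) auto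
  have "alt_exp (K x) (\<lambda>z. pfm K (z @ [u])) ys = alt_exp (K x) (alt_exp g (pfm K)) ys"
  proof (rule alt_exp_cong)
    fix zs assume zs: "Suc (length zs) = length ys" "set zs \<subseteq> set ys"
    then have "odd (length zs)" using less.prems(1) xs by (metis even_Suc length_Cons)
    then show "pfm K (zs @ [u]) = alt_exp g (pfm K) zs"
      using zs less.prems(2) xs by (intro less.hyps) auto
  qed simp
  then have "pfm K (xs @ [u]) = alt_exp (K x) (alt_exp g (pfm K)) ys + g x * pfm K ys"
    using less.prems by (simp add: xs pfm_Cons alt_exp_snoc)
  also have "\<dots> = g x * pfm K ys - alt_exp g (alt_exp (K x) (pfm K)) ys"
    using alt_exp_anticommute[of "K x" g "pfm K" ys] by (simp add: algebra_simps eq_neg_iff_add_eq_0)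
  also have "\<dots> = alt_exp g (pfm K) xs"
    by (simp add: xs pfm_Cons)
  finally show ?case .
qed

text \<open>For odd length, the Pfaffian bordered by a first row with entries \<open>g\<close>.\<close>

definition bpf :: "('b \<Rightarrow> 'b \<Rightarrow> 'a::comm_ring_1) \<Rightarrow> ('b \<Rightarrow> 'a) \<Rightarrow> 'b list \<Rightarrow> 'a" where
  "bpf K g xs = (if even (length xs) then pfm K xs else alt_exp g (pfm K) xs)"

lemma bpf_Nil [simp]: "bpf K g [] = 1"
  by (simp add: bpf_def)

lemma bpf_swap:
  "bpf K g (as @ x # y # bs) + bpf K g (as @ y # x # bs) = (K x y + K y x) * bpf K g (as @ bs)"
proof (cases "even (length (as @ bs))")
  case True
  then show ?thesis by (simp add: bpf_def pfm_swap)
next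
  case False
  have "alt_exp g (pfm K) (as @ x # y # bs) + alt_exp g (pfm K) (as @ y # x # bs) =
      (K x y + K y x) * alt_exp g (pfm K) (as @ bs)"
    by (rule alt_exp_swap) (rule pfm_swap)
  then show ?thesis using False by (simp add: bpf_def)
qed

text \<open>Meant for a row of index 0, whose Pfaffian entries against earlier rows reduce to the
  single entries of those rows. For an even number of remaining rows the surplus is g expanded
  twice, which is 0.\<close>

lemma bpf_snoc_unit:
  assumes "g u = 1" "\<And>x. x \<in> set xs \<Longrightarrow> K x u = g x"
  shows "bpf K g (xs @ [u]) = bpf K g xs"
proof (cases "even (length xs)")
  case False
  then show ?thesis using pfm_snoc_unit[of xs K u g] assms by (simp add: bpf_def)
next
  case True
  have "alt_exp g (\<lambda>z. pfm K (z @ [u])) xs = alt_exp g (alt_exp g (pfm K)) xs"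
  proof (rule alt_exp_cong)
    fix zs assume "Suc (length zs) = length xs" "set zs \<subseteq> set xs"
    moreover from this have "odd (length zs)" using True by (metis even_Suc)
    ultimately show "pfm K (zs @ [u]) = alt_exp g (pfm K) zs"
      using assms(2) by (intro pfm_snoc_unit) auto
  qed simp
  then show ?thesis using True assms(1) by (simp add: bpf_def alt_exp_snoc alt_exp_twice)
qed

lemma pfm_cong: "(\<And>x y. x \<in> set xs \<Longrightarrow> y \<in> set xs \<Longrightarrow> K x y = K' x y) \<Longrightarrow> pfm K xs = pfm K' xs"
proof (induction "length xs" arbitrary: xs rule: less_induct)
  case less
  show ?case
  proof (cases xs)
    case (Cons x ys)
    show ?thesis unfolding Cons pfm_Cons
    proof (rule alt_exp_cong)
      show "K x y = K' x y" if "y \<in> set ys" for y using that Cons by (intro less.prems) auto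
      show "pfm K zs = pfm K' zs" if "Suc (length zs) = length ys" "set zs \<subseteq> set ys" for zs
        using that Cons by (intro less.hyps less.prems) auto
    qed
  qed simp
qed

lemma bpf_cong:
  assumes "\<And>x y. x \<in> set xs \<Longrightarrow> y \<in> set xs \<Longrightarrow> K x y = K' x y" "\<And>x. x \<in> set xs \<Longrightarrow> g x = g' x"
  shows "bpf K g xs = bpf K' g' xs"
proof -
  have "alt_exp g (pfm K) xs = alt_exp g' (pfm K') xs"
    by (rule alt_exp_cong) (auto intro!: pfm_cong assms)
  then show ?thesis using pfm_cong[of xs K K'] assms(1) by (simp add: bpf_def)
qed

lemma alt_exp_map: "alt_exp a P (map f ys) = alt_exp (\<lambda>y. a (f y)) (\<lambda>zs. P (map f zs)) ys"
  by (induction ys arbitrary: P) auto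

lemma pfm_map: "pfm K (map f xs) = pfm (\<lambda>x y. K (f x) (f y)) xs"
proof (induction "length xs" arbitrary: xs rule: less_induct)
  case less
  show ?case
  proof (cases xs)
    case (Cons x ys)
    show ?thesis unfolding Cons list.map pfm_Cons alt_exp_map
      by (rule alt_exp_cong) (auto intro!: less simp: Cons)
  qed simp
qed

lemma bpf_map: "bpf K g (map f xs) = bpf (\<lambda>x y. K (f x) (f y)) (\<lambda>x. g (f x)) xs"
  by (simp add: bpf_def alt_exp_map pfm_map)

lemma alt_exp_hom:
  assumes "\<And>a b. h (a - b) = h a - h b" "\<And>a b. h (a * b) = h a * h b"
  shows "h (alt_exp a P ys) = alt_exp (\<lambda>y. h (a y)) (\<lambda>zs. h (P zs)) ys"
proof -
  have "h 0 = 0" using assms(1)[of 0 0] by simp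
  then show ?thesis by (induction ys arbitrary: P) (auto simp: assms)
qed

lemma pfm_hom:
  assumes "\<And>a b. h (a - b) = h a - h b" "\<And>a b. h (a * b) = h a * h b" "h 1 = 1"
  shows "h (pfm K xs) = pfm (\<lambda>x y. h (K x y)) xs"
proof (induction "length xs" arbitrary: xs rule: less_induct)
  case less
  show ?case
  proof (cases xs)
    case (Cons x ys)
    show ?thesis unfolding Cons pfm_Cons alt_exp_hom[of h, OF assms(1,2)]
      by (rule alt_exp_cong) (auto intro!: less simp: Cons)
  qed (simp add: assms)
qed

lemma bpf_hom:
  assumes "\<And>a b. h (a - b) = h a - h b" "\<And>a b. h (a * b) = h a * h b" "h 1 = 1"
  shows "h (bpf K g xs) = bpf (\<lambda>x y. h (K x y)) (\<lambda>x. h (g x)) xs"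
  unfolding bpf_def by (simp add: pfm_hom[of h, OF assms] alt_exp_hom[of h, OF assms(1,2)])

lemma alt_exp_linear_row:
  assumes "\<And>y. y \<in> set as \<union> set bs \<Longrightarrow> f1 y = f y \<and> f2 y = f y" "f x = f1 x + \<beta> * f2 x"
    and "\<And>cs zs. set cs \<subseteq> set as \<Longrightarrow> set zs \<subseteq> set bs \<Longrightarrow> length (cs @ zs) < length (as @ bs) \<Longrightarrow>
       P (cs @ x # zs) = P1 (cs @ x # zs) + \<beta> * P2 (cs @ x # zs)"
    and "P1 (as @ bs) = P (as @ bs)" "P2 (as @ bs) = P (as @ bs)"
  shows "alt_exp f P (as @ x # bs) = alt_exp f1 P1 (as @ x # bs) + \<beta> * alt_exp f2 P2 (as @ x # bs)"
  using assms
proof (induction as arbitrary: P P1 P2)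
  case Nil
  have "alt_exp f (\<lambda>zs. P (x # zs)) bs = alt_exp f (\<lambda>zs. P1 (x # zs) + \<beta> * P2 (x # zs)) bs"
  proof (rule alt_exp_cong)
    fix zs assume "Suc (length zs) = length bs" "set zs \<subseteq> set bs"
    then show "P (x # zs) = P1 (x # zs) + \<beta> * P2 (x # zs)" using Nil(3)[of "[]" zs] by simp
  qed simp
  also have "\<dots> = alt_exp f (\<lambda>zs. P1 (x # zs)) bs + \<beta> * alt_exp f (\<lambda>zs. P2 (x # zs)) bs"
    by (simp add: alt_exp_add alt_exp_scale)
  also have "alt_exp f (\<lambda>zs. P1 (x # zs)) bs = alt_exp f1 (\<lambda>zs. P1 (x # zs)) bs"
    using Nil(1) by (intro alt_exp_cong) auto
  also have "alt_exp f (\<lambda>zs. P2 (x # zs)) bs = alt_exp f2 (\<lambda>zs. P2 (x # zs)) bs"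
    using Nil(1) by (intro alt_exp_cong) auto
  finally have "alt_exp f (\<lambda>zs. P (x # zs)) bs =
    alt_exp f1 (\<lambda>zs. P1 (x # zs)) bs + \<beta> * alt_exp f2 (\<lambda>zs. P2 (x # zs)) bs" .
  then show ?case using Nil(2,4,5) by (simp add: algebra_simps)
next
  case (Cons c as)
  have 1: "alt_exp f (\<lambda>z. P (c # z)) (as @ x # bs) =
     alt_exp f1 (\<lambda>z. P1 (c # z)) (as @ x # bs) + \<beta> * alt_exp f2 (\<lambda>z. P2 (c # z)) (as @ x # bs)"
  proof (rule Cons.IH)
    fix cs zs assume "set cs \<subseteq> set as" "set zs \<subseteq> set bs" "length (cs @ zs) < length (as @ bs)"
    then show "P (c # cs @ x # zs) = P1 (c # cs @ x # zs) + \<beta> * P2 (c # cs @ x # zs)"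
      using Cons.prems(3)[of "c # cs" zs] by auto
  qed (use Cons.prems in auto)
  have 2: "P (as @ x # bs) = P1 (as @ x # bs) + \<beta> * P2 (as @ x # bs)"
    by (rule Cons.prems(3)) auto
  have 3: "f c = f1 c" "f c = f2 c" using Cons.prems(1) by auto
  show ?case using 1 2 3 by (simp add: algebra_simps)
qed

text \<open>Linearity in x: each term of the expansion contains exactly one entry involving x, taken
  either from its row or from its column, so both have to be split alike.\<close>

lemma pfm_linear_row:
  assumes "\<And>a b. a \<in> set as \<union> set bs \<Longrightarrow> b \<in> set as \<union> set bs \<Longrightarrow> K1 a b = K a b \<and> K2 a b = K a b"
    "\<And>a. a \<in> set as \<union> set bs \<Longrightarrow> K a x = K1 a x + \<beta> * K2 a x \<and> K x a = K1 x a + \<beta> * K2 x a"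
  shows "pfm K (as @ x # bs) = pfm K1 (as @ x # bs) + \<beta> * pfm K2 (as @ x # bs)"
  using assms
proof (induction "length (as @ bs)" arbitrary: as bs rule: less_induct)
  case less
  have pf: "pfm K1 zs = pfm K zs" "pfm K2 zs = pfm K zs" if "set zs \<subseteq> set as \<union> set bs" for zs
    using that less.prems(1) by (auto intro!: pfm_cong)
  show ?case
  proof (cases as)
    case Nil
    have "alt_exp (K x) (pfm K) bs = alt_exp (K1 x) (pfm K) bs + \<beta> * alt_exp (K2 x) (pfm K) bs"
    proof -
      have "alt_exp (K x) P zs = alt_exp (K1 x) P zs + \<beta> * alt_exp (K2 x) P zs" if "set zs \<subseteq> set bs" for P zs
        using that less.prems(2) by (induction zs arbitrary: P) (auto simp: algebra_simps)
      then show ?thesis by simp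
    qed
    also have "alt_exp (K1 x) (pfm K) bs = alt_exp (K1 x) (pfm K1) bs"
      by (rule alt_exp_cong) (auto intro!: pf[symmetric])
    also have "alt_exp (K2 x) (pfm K) bs = alt_exp (K2 x) (pfm K2) bs"
      by (rule alt_exp_cong) (auto intro!: pf[symmetric])
    finally show ?thesis by (simp add: Nil pfm_Cons)
  next
    case (Cons c as')
    show ?thesis unfolding Cons append_Cons pfm_Cons
    proof (rule alt_exp_linear_row)
      show "pfm K (cs @ x # zs) = pfm K1 (cs @ x # zs) + \<beta> * pfm K2 (cs @ x # zs)"
        if "set cs \<subseteq> set as'" "set zs \<subseteq> set bs" "length (cs @ zs) < length (as' @ bs)" for cs zs
        using that by (intro less.hyps less.prems) (auto simp: Cons)
      show "pfm K1 (as' @ bs) = pfm K (as' @ bs)" "pfm K2 (as' @ bs) = pfm K (as' @ bs)"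
        by (rule pf; auto simp: Cons)+
    qed (use less.prems in \<open>auto simp: Cons\<close>)
  qed
qed

lemma bpf_linear_row:
  assumes "\<And>a b. a \<in> set as \<union> set bs \<Longrightarrow> b \<in> set as \<union> set bs \<Longrightarrow> K1 a b = K a b \<and> K2 a b = K a b"
    "\<And>a. a \<in> set as \<union> set bs \<Longrightarrow> K a x = K1 a x + \<beta> * K2 a x \<and> K x a = K1 x a + \<beta> * K2 x a"
    "\<And>a. a \<in> set as \<union> set bs \<Longrightarrow> g1 a = g a \<and> g2 a = g a" "g x = g1 x + \<beta> * g2 x"
  shows "bpf K g (as @ x # bs) = bpf K1 g1 (as @ x # bs) + \<beta> * bpf K2 g2 (as @ x # bs)"
proof -
  have "alt_exp g (pfm K) (as @ x # bs) = alt_exp g1 (pfm K1) (as @ x # bs) + \<beta> * alt_exp g2 (pfm K2) (as @ x # bs)"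
  proof (rule alt_exp_linear_row)
    show "pfm K (cs @ x # zs) = pfm K1 (cs @ x # zs) + \<beta> * pfm K2 (cs @ x # zs)"
      if "set cs \<subseteq> set as" "set zs \<subseteq> set bs" for cs zs
      using that assms(1,2) by (intro pfm_linear_row) blast+
    show "pfm K1 (as @ bs) = pfm K (as @ bs)" "pfm K2 (as @ bs) = pfm K (as @ bs)"
      using assms(1) by (auto intro!: pfm_cong)
  qed (use assms in auto)
  moreover have "pfm K (as @ x # bs) = pfm K1 (as @ x # bs) + \<beta> * pfm K2 (as @ x # bs)"
    by (rule pfm_linear_row) (use assms in auto)
  ultimately show ?thesis by (simp add: bpf_def)
qed

lemma bpf_zero_first:
  assumes "\<And>b. b \<in> set bs \<Longrightarrow> K x b = 0" "g x = 0"
  shows "bpf K g (x # bs) = 0"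
proof -
  have pf: "pfm K (x # zs) = 0" if "set zs \<subseteq> set bs" for zs
    unfolding pfm_Cons using that assms(1) by (intro alt_exp_zero) auto
  then have "alt_exp g (\<lambda>z. pfm K (x # z)) bs = 0"
    by (intro alt_exp_zero') simp
  then show ?thesis using pf[of bs] assms(2) by (simp add: bpf_def)
qed

lemma bpf_zero_last:
  assumes "\<And>b. b \<in> set bs \<Longrightarrow> K b u = 0" "g u = 0"
  shows "bpf K g (bs @ [u]) = 0"
proof -
  have pf: "pfm K (zs @ [u]) = 0" if "set zs \<subseteq> set bs" for zs
    using that
  proof (induction "length zs" arbitrary: zs rule: less_induct)
    case less
    show ?case
    proof (cases zs)
      case Nil
      then show ?thesis by (simp add: pfm_Cons)
    next
      case (Cons z ys)
      have "alt_exp (K z) (\<lambda>w. pfm K (w @ [u])) ys = 0"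
        using less Cons by (intro alt_exp_zero') auto
      then show ?thesis using assms(1) less.prems by (simp add: Cons pfm_Cons alt_exp_snoc)
    qed
  qed
  have "alt_exp g (\<lambda>w. pfm K (w @ [u])) bs = 0"
    by (intro alt_exp_zero' pf)
  then show ?thesis using pf[of bs] assms(2) by (simp add: bpf_def alt_exp_snoc)
qed

section \<open>Comparison with the multi Schur-Pfaffian\<close>

lemma alt_exp_sum:
  "alt_exp a P ys = (\<Sum>s<length ys. (-1) ^ s * a (ys ! s) * P (take s ys @ drop (Suc s) ys))"
proof (induction ys arbitrary: P)
  case (Cons y ys)
  show ?case
    by (simp add: Cons sum.lessThan_Suc_shift sum_negf del: sum.lessThan_Suc)
qed simp

definition pf_entry :: "(int \<Rightarrow> 'a::comm_ring_1) \<times> int \<Rightarrow> (int \<Rightarrow> 'a) \<times> int \<Rightarrow> 'a" where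
  "pf_entry x y = fst x (snd x) * fst y (snd y) +
    2 * (\<Sum>s=1..nat (snd y). (-1) ^ s * fst x (snd x + int s) * fst y (snd y - int s))"

text \<open>An even list is expanded along its first row, an odd one along the border formed by the
  single entries. The removals at position s are those of \<open>alt_exp_sum\<close>, after a shift
  by one in the even case.\<close>

lemma schur_pf_eq_bpf: "schur_pf ps = bpf pf_entry (\<lambda>x. fst x (snd x)) ps"
proof (induction ps rule: schur_pf.induct)
  case (4 x y v ps)
  define xs where "xs = x # y # v # ps"
  have IH: "schur_pf (take s xs @ drop (s + 1) xs) = bpf pf_entry (\<lambda>x. fst x (snd x)) (take s xs @ drop (s + 1) xs)"
    if "odd (length xs)" "s < length xs" for s
    using that 4(3)[OF xs_def refl, of s] by simp
  have IH2: "schur_pf [x, xs ! s] = pf_entry x (xs ! s)" for s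
    by (cases x; cases "xs ! s") (simp add: pf_entry_def)
  show ?case
  proof (cases "even (length xs)")
    case True
    have "schur_pf xs = (\<Sum>s\<in>{1..<length xs}. (-1) ^ (s + 1) * schur_pf [x, xs ! s] * schur_pf (tl (take s xs @ drop (s + 1) xs)))"
      using True by (simp add: xs_def Let_def)
    also have "\<dots> = (\<Sum>s<length (tl xs). (-1) ^ s * schur_pf [x, tl xs ! s] * schur_pf (take s (tl xs) @ drop (Suc s) (tl xs)))"
    proof -
      have len: "length xs = Suc (length (tl xs))" by (simp add: xs_def)
      show ?thesis
        unfolding len One_nat_def sum.shift_bounds_Suc_ivl atLeast0LessThan
        by (rule sum.cong) (simp_all add: xs_def)
    qed
    also have "\<dots> = (\<Sum>s<length (tl xs). (-1) ^ s * pf_entry x (tl xs ! s) * pfm pf_entry (take s (tl xs) @ drop (Suc s) (tl xs)))"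
    proof (rule sum.cong[OF refl])
      fix s assume s: "s \<in> {..<length (tl xs)}"
      have "schur_pf (tl (take (Suc s) xs @ drop (Suc s + 1) xs)) =
         bpf pf_entry (\<lambda>x. fst x (snd x)) (tl (take (Suc s) xs @ drop (Suc s + 1) xs))"
        using 4(2)[OF xs_def refl True, of "Suc s"] s by (auto simp: xs_def)
      moreover have "even (length (take s (tl xs) @ drop (Suc s) (tl xs)))"
        using True s by (auto simp: xs_def)
      ultimately have "schur_pf (take s (tl xs) @ drop (Suc s) (tl xs)) = pfm pf_entry (take s (tl xs) @ drop (Suc s) (tl xs))"
        by (simp add: xs_def bpf_def)
      moreover have "schur_pf [x, tl xs ! s] = pf_entry x (tl xs ! s)"
        by (cases x; cases "tl xs ! s") (simp add: pf_entry_def)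
      ultimately show "(-1) ^ s * schur_pf [x, tl xs ! s] * schur_pf (take s (tl xs) @ drop (Suc s) (tl xs)) =
        (-1) ^ s * pf_entry x (tl xs ! s) * pfm pf_entry (take s (tl xs) @ drop (Suc s) (tl xs))" by simp
    qed
    also have "\<dots> = pfm pf_entry xs"
      by (simp add: xs_def pfm_Cons alt_exp_sum del: drop_Suc_Cons)
    finally have "schur_pf xs = bpf pf_entry (\<lambda>x. fst x (snd x)) xs" using True by (simp add: bpf_def)
    then show ?thesis by (simp only: xs_def)
  next
    case False
    have "schur_pf xs = (\<Sum>s\<in>{0..<length xs}. (-1) ^ s * (case xs ! s of (c, r) \<Rightarrow> c r) * schur_pf (take s xs @ drop (s + 1) xs))"
      using False by (simp add: xs_def Let_def)
    also have "\<dots> = (\<Sum>s<length xs. (-1) ^ s * fst (xs ! s) (snd (xs ! s)) * pfm pf_entry (take s xs @ drop (Suc s) xs))"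
    proof (rule sum.cong)
      fix s assume s: "s \<in> {..<length xs}"
      then have "even (length (take s xs @ drop (s + 1) xs))" using False by auto
      then show "(-1) ^ s * (case xs ! s of (c, r) \<Rightarrow> c r) * schur_pf (take s xs @ drop (s + 1) xs) =
        (-1) ^ s * fst (xs ! s) (snd (xs ! s)) * pfm pf_entry (take s xs @ drop (Suc s) xs)"
        using IH[OF False, of s] s False by (simp add: bpf_def case_prod_unfold)
    qed auto
    also have "\<dots> = alt_exp (\<lambda>x. fst x (snd x)) (pfm pf_entry) xs"
      by (simp add: alt_exp_sum)
    finally have "schur_pf xs = bpf pf_entry (\<lambda>x. fst x (snd x)) xs" using False by (simp add: bpf_def)
    then show ?thesis by (simp only: xs_def)
  qed
qed (auto simp: bpf_def pfm_Cons pf_entry_def)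

section \<open>Divided differences of theta polynomials\<close>

text \<open>With integer index and value 0 below 0, multiplication by a linear factor gives one
  recursion in r and r - 1 without a boundary case.\<close>

definition fps_int_nth :: "'a::comm_ring_1 fps \<Rightarrow> int \<Rightarrow> 'a" where
  "fps_int_nth f r = (if r < 0 then 0 else fps_nth f (nat r))"

lemma fps_int_nth_lin:
  "fps_int_nth (fps_lin a * f) r = fps_int_nth f r + a * fps_int_nth f (r - 1)"
proof (cases "r < 1")
  case True
  then show ?thesis by (cases "r = 0") (auto simp: fps_int_nth_def fps_lin_def)
next
  case False
  define n where "n = nat (r - 1)"
  have "\<not> r < 0" "nat r = Suc n" "\<not> r - 1 < 0" "nat (r - 1) = n" using False by (simp_all add: n_def)
  then show ?thesis by (simp add: fps_int_nth_def fps_lin_def distrib_right mult.assoc)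
qed

lemma fps_int_nth_add: "fps_int_nth (f + g) r = fps_int_nth f r + fps_int_nth g r"
  by (simp add: fps_int_nth_def)

lemma fps_int_nth_X: "fps_int_nth (fps_const a * (fps_X * f)) r = a * fps_int_nth f (r - 1)"
  using fps_int_nth_lin[of a f r] fps_int_nth_add[of f "fps_const a * (fps_X * f)" r]
  by (simp add: fps_lin_def distrib_right mult.assoc)

lemma fps_int_nth_map: "rhom h \<Longrightarrow> h (fps_int_nth f r) = fps_int_nth (fps_map h f) r"
  by (simp add: fps_int_nth_def rhom_zero)

lemma theta_eq: "theta k l r = fps_int_nth (theta_ser k l) r"
  by (simp add: theta_def fps_int_nth_def)

lemma theta_neg [simp]: "r < 0 \<Longrightarrow> theta k l r = 0"
  by (simp add: theta_def)

definition t_factor :: "int \<Rightarrow> rinf fps" where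
  "t_factor l = (if l \<ge> 0 then \<Prod>i=1..nat l. fps_lin (- tvar i) else \<Prod>i=1..nat (- l). fps_geom (- tvar i))"

definition z_factor :: "nat \<Rightarrow> rinf fps" where
  "z_factor k = (\<Prod>i=1..k. fps_lin (zvar i))"

lemma theta_ser_eq: "theta_ser k l = Abs_fps Qpol * z_factor k * t_factor l"
  by (simp only: theta_ser_def t_factor_def z_factor_def)

text \<open>Lowering l by one removes the numerator 1 - t_i u when l = i > 0, and adds the
  denominator 1 + t_(i+1) u when l = -i \<le> 0. Either way one linear factor relates consecutive
  indices, which is why delta_i acts on theta uniformly in the sign of l.\<close>

lemma t_factor_pos:
  assumes "i \<ge> 1"
  shows "t_factor (int i) = fps_lin (- tvar i) * t_factor (int i - 1)"
proof -
  obtain n where "i = Suc n" using assms by (cases i) auto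
  then show ?thesis by (simp add: t_factor_def nat_add_distrib mult.commute)
qed

lemma t_factor_neg: "t_factor (- int i) = fps_lin (tvar (Suc i)) * t_factor (- int i - 1)"
proof -
  have n: "nat (1 + int i) = Suc i" by simp
  have "t_factor (- int i) = (\<Prod>j=1..i. fps_geom (- tvar j))"
    by (cases "i = 0") (simp_all add: t_factor_def del: prod.cl_ivl_Suc)
  moreover have "t_factor (- int i - 1) = (\<Prod>j=1..i. fps_geom (- tvar j)) * fps_geom (- tvar (Suc i))"
    by (simp add: t_factor_def n add.commute)
  moreover have "fps_lin (tvar (Suc i)) * ((\<Prod>j=1..i. fps_geom (- tvar j)) * fps_geom (- tvar (Suc i))) =
      (\<Prod>j=1..i. fps_geom (- tvar j)) * (fps_lin (tvar (Suc i)) * fps_geom (- tvar (Suc i)))"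
    by (simp only: mult_ac)
  ultimately show ?thesis
    by (simp only: fps_lin_mult_geom mult_1_right)
qed

lemma fps_map_s_t_z_factor: "fps_map (s_t i) (z_factor k) = z_factor k"
  by (cases "i = 0")
    (simp_all add: z_factor_def rhom_prod[OF rhom_fps_map[OF rhom_s_t]] fps_map_lin[OF rhom_s_t] s_t_gens s_t_0_gens)

lemma fps_map_s_t_Q: "i \<ge> 1 \<Longrightarrow> fps_map (s_t i) (Abs_fps Qpol) = Abs_fps Qpol"
  by (simp add: fps_eq_iff s_t_gens)

text \<open>The range 1..n is stable under exchanging i and i + 1 unless it contains i but not i +
  1, that is unless n = i.\<close>

lemma prod_transpose:
  fixes i n :: nat
  assumes "i \<ge> 1" "n \<noteq> i"
  shows "(\<Prod>j=1..n. f (transpose i (i + 1) j)) = (\<Prod>j=1..n. f j)"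
proof (cases "n < i")
  case True
  then have "transpose i (i + 1) j = j" if "j \<in> {1..n}" for j
    using that True by (auto simp: transpose_def)
  then show ?thesis by (intro prod.cong) simp_all
next
  case False
  then have "transpose i (i + 1) permutes {1..n}"
    using assms by (intro permutes_swap_id) auto
  from prod.permute[OF this, of f] show ?thesis by (simp add: comp_def)
qed

lemma fps_map_s_t_t_factor:
  assumes "i \<ge> 1" "l \<noteq> int i" "l \<noteq> - int i"
  shows "fps_map (s_t i) (t_factor l) = t_factor l"
proof (cases "l \<ge> 0")
  case True
  then have "nat l \<noteq> i" using assms by auto
  from prod_transpose[OF assms(1) this, of "\<lambda>j. fps_lin (- tvar j)"] show ?thesis using True assms(1)
    by (simp add: t_factor_def rhom_prod[OF rhom_fps_map[OF rhom_s_t]] fps_map_lin[OF rhom_s_t] s_t_gens rhom_uminus[OF rhom_s_t])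
next
  case False
  then have "nat (- l) \<noteq> i" using assms by auto
  from prod_transpose[OF assms(1) this, of "\<lambda>j. fps_geom (- tvar j)"] show ?thesis using False assms(1)
    by (simp add: t_factor_def rhom_prod[OF rhom_fps_map[OF rhom_s_t]] fps_map_geom[OF rhom_s_t] s_t_gens rhom_uminus[OF rhom_s_t])
qed

text \<open>s_0 multiplies Q by (1 - t_1 u)/(1 + t_1 u) and reverses t_1. If l \<noteq> 0, the
  factor of t_1 in \<open>t_factor l\<close> is 1 - t_1 u or 1/(1 + t_1 u); after the reversal the
  multiplier restores it.\<close>

lemma fps_map_s_t_0:
  assumes "l \<noteq> 0"
  shows "fps_map (s_t 0) (theta_ser k l) = theta_ser k l"
proof -
  note h = rhom_fps_map[OF rhom_s_t[of 0]]
  let ?t = "tvar 1"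
  have core: "fps_lin (- ?t) * fps_geom (- ?t) * fps_map (s_t 0) (t_factor l) = t_factor l"
  proof (cases "l \<ge> 0")
    case True
    then obtain n where n: "nat l = Suc n" using assms by (cases "nat l") auto
    have split: "t_factor l = fps_lin (- ?t) * (\<Prod>j=Suc 1..Suc n. fps_lin (- tvar j))"
      using True n unfolding t_factor_def by (simp add: prod.atLeast_Suc_atMost del: prod.cl_ivl_Suc)
    have "fps_map (s_t 0) (t_factor l) = fps_lin ?t * (\<Prod>j=Suc 1..Suc n. fps_lin (- tvar j))"
      unfolding split by (simp add: rhom_mult[OF h] rhom_prod[OF h] fps_map_lin[OF rhom_s_t] rhom_uminus[OF rhom_s_t] s_t_0_gens del: prod.cl_ivl_Suc)
    then have "fps_lin (- ?t) * fps_geom (- ?t) * fps_map (s_t 0) (t_factor l) =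
        (fps_lin ?t * fps_geom (- ?t)) * (fps_lin (- ?t) * (\<Prod>j=Suc 1..Suc n. fps_lin (- tvar j)))"
      by (simp only: mult_ac)
    then show ?thesis by (simp only: fps_lin_mult_geom split mult_1_left)
  next
    case False
    then obtain n where n: "nat (- l) = Suc n" by (cases "nat (- l)") auto
    have split: "t_factor l = fps_geom (- ?t) * (\<Prod>j=Suc 1..Suc n. fps_geom (- tvar j))"
      using False n unfolding t_factor_def by (simp add: prod.atLeast_Suc_atMost del: prod.cl_ivl_Suc)
    have "fps_map (s_t 0) (t_factor l) = fps_geom ?t * (\<Prod>j=Suc 1..Suc n. fps_geom (- tvar j))"
      unfolding split by (simp add: rhom_mult[OF h] rhom_prod[OF h] fps_map_geom[OF rhom_s_t] rhom_uminus[OF rhom_s_t] s_t_0_gens del: prod.cl_ivl_Suc)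
    then have "fps_lin (- ?t) * fps_geom (- ?t) * fps_map (s_t 0) (t_factor l) =
        (fps_lin (- ?t) * fps_geom ?t) * (fps_geom (- ?t) * (\<Prod>j=Suc 1..Suc n. fps_geom (- tvar j)))"
      by (simp only: mult_ac)
    then show ?thesis by (simp only: fps_geom_inverse split mult_1_left)
  qed
  have "fps_map (s_t 0) (theta_ser k l) =
      Abs_fps Qpol * z_factor k * (fps_lin (- ?t) * fps_geom (- ?t) * fps_map (s_t 0) (t_factor l))"
    by (simp only: theta_ser_eq rhom_mult[OF h] s_t_0_Q fps_map_s_t_z_factor mult_ac)
  then show ?thesis by (simp only: core theta_ser_eq)
qed

lemma theta_s_t_fixed:
  assumes "\<bar>l\<bar> \<noteq> int i"
  shows "s_t i (theta k l r) = theta k l r"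
proof -
  have "fps_map (s_t i) (theta_ser k l) = theta_ser k l"
  proof (cases "i = 0")
    case True
    then show ?thesis using fps_map_s_t_0[of l k] assms by simp
  next
    case False
    then show ?thesis using assms
      by (simp add: theta_ser_eq rhom_mult[OF rhom_fps_map[OF rhom_s_t]] fps_map_s_t_Q fps_map_s_t_z_factor fps_map_s_t_t_factor)
  qed
  then show ?thesis by (simp add: theta_eq fps_int_nth_map[OF rhom_s_t])
qed

lemma theta_pos:
  assumes "i \<ge> 1"
  shows "theta k (int i) r = theta k (int i - 1) r - tvar i * theta k (int i - 1) (r - 1)"
proof -
  have "theta_ser k (int i) = fps_lin (- tvar i) * theta_ser k (int i - 1)"
    by (simp add: theta_ser_eq t_factor_pos[OF assms] mult_ac)
  then show ?thesis by (simp add: theta_eq fps_int_nth_lin)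
qed

lemma theta_nonpos:
  "theta k (- int i) r = theta k (- int i - 1) r + tvar (Suc i) * theta k (- int i - 1) (r - 1)"
proof -
  have "theta_ser k (- int i) = fps_lin (tvar (Suc i)) * theta_ser k (- int i - 1)"
    by (simp only: theta_ser_eq t_factor_neg mult_ac)
  then show ?thesis by (simp add: theta_eq fps_int_nth_lin)
qed

lemma s_t_theta_pos:
  assumes "i \<ge> 1"
  shows "s_t i (theta k (int i) r) = theta k (int i - 1) r - tvar (Suc i) * theta k (int i - 1) (r - 1)"
proof -
  have "\<bar>int i - 1\<bar> \<noteq> int i" using assms by auto
  then show ?thesis using theta_s_t_fixed[of "int i - 1" i k] assms
    by (simp add: theta_pos[OF assms] rhom_simps[OF rhom_s_t] s_t_gens)
qed

lemma s_t_theta_nonpos: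
  assumes "i \<ge> 1"
  shows "s_t i (theta k (- int i) r) = theta k (- int i - 1) r + tvar i * theta k (- int i - 1) (r - 1)"
proof -
  have "\<bar>- int i - 1\<bar> \<noteq> int i" by auto
  then show ?thesis using theta_s_t_fixed[of "- int i - 1" i k] assms
    by (simp add: theta_nonpos rhom_simps[OF rhom_s_t] s_t_gens)
qed

text \<open>For i \<ge> 1 both sides are expanded in index l - 1, on which s_i acts trivially. For i
  = 0 the change comes from Q: (1 - t_1 u)/(1 + t_1 u) is 1 - 2 t_1 u/(1 + t_1 u), where 2 t_1 is
  alpha_0 and the denominator turns index 0 into -1.\<close>

lemma theta_s_t_diff:
  assumes "\<bar>l\<bar> = int i"
  shows "s_t i (theta k l r) = theta k l r - alpha i * theta k (l - 1) (r - 1)"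
proof (cases "i = 0")
  case True
  then have l: "l = 0" using assms by simp
  note h = rhom_fps_map[OF rhom_s_t[of 0]]
  have t: "t_factor 0 = 1" "t_factor (- 1) = fps_geom (- tvar 1)" by (simp_all add: t_factor_def)
  have "fps_map (s_t 0) (theta_ser k 0) = theta_ser k 0 + fps_const (- (2 * tvar 1)) * (fps_X * theta_ser k (- 1))"
  proof -
    have "fps_map (s_t 0) (theta_ser k 0) = fps_lin (- tvar 1) * fps_geom (- tvar 1) * Abs_fps Qpol * z_factor k"
      by (simp add: theta_ser_eq rhom_mult[OF h] rhom_one[OF h] s_t_0_Q fps_map_s_t_z_factor t)
    also have "\<dots> = theta_ser k 0 + (fps_const (- tvar 1) + fps_const (- tvar 1)) * (fps_X * theta_ser k (- 1))"
      unfolding fps_lin_geom_eq theta_ser_eq t mult_2 by (simp add: algebra_simps del: fps_const_add fps_const_neg)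
    also have "fps_const (- tvar 1) + fps_const (- tvar 1) = fps_const (- (2 * tvar 1))"
      by (simp add: fps_const_add)
    finally show ?thesis .
  qed
  then have "s_t 0 (theta k 0 r) = theta k 0 r - 2 * tvar 1 * theta k (- 1) (r - 1)"
    by (simp add: theta_eq fps_int_nth_map[OF rhom_s_t] fps_int_nth_add fps_int_nth_X del: fps_const_neg)
  then show ?thesis by (simp add: True l alpha_def)
next
  case False
  then have i: "i \<ge> 1" by simp
  show ?thesis
  proof (cases "l \<ge> 0")
    case True
    then have l: "l = int i" using assms by simp
    show ?thesis unfolding l s_t_theta_pos[OF i]
      unfolding theta_pos[OF i, of k r] using False by (simp add: alpha_def algebra_simps)
  next
    case neg: False
    then have l: "l = - int i" using assms by simp
    show ?thesis unfolding l s_t_theta_nonpos[OF i]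
      unfolding theta_nonpos[of k i r] using False by (simp add: alpha_def algebra_simps)
  qed
qed

lemma theta_0 [simp]: "theta k l 0 = 1"
proof -
  have lin0: "fps_nth (fps_lin a) 0 = 1" for a :: rinf by (simp add: fps_lin_def)
  have geom0: "fps_nth (fps_geom a) 0 = 1" for a :: rinf by (simp add: fps_geom_def)
  have prod0: "fps_nth (prod f A) 0 = (\<Prod>i\<in>A. fps_nth (f i) 0)" for f :: "nat \<Rightarrow> rinf fps" and A
    by (induction A rule: infinite_finite_induct) auto
  have "Qpol 0 = 1" by (simp add: series_of_inject[symmetric] Qpol.rep_eq Qser_0 one_rinf.rep_eq)
  then show ?thesis
    by (simp add: theta_def theta_ser_eq z_factor_def t_factor_def prod0 lin0 geom0)
qed

section \<open>Degree bounds for theta series\<close>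

definition fps_deg_le :: "nat \<Rightarrow> 'a::comm_ring_1 fps \<Rightarrow> bool" where
  "fps_deg_le d f \<longleftrightarrow> (\<forall>n>d. fps_nth f n = 0)"

lemma fps_deg_le_mult:
  assumes "fps_deg_le d f" "fps_deg_le e g"
  shows "fps_deg_le (d + e) (f * g)"
  unfolding fps_deg_le_def fps_mult_nth
proof (intro allI impI sum.neutral ballI)
  fix n i assume "d + e < n" "i \<in> {0..n}"
  then have "i > d \<or> n - i > e" by auto
  then show "fps_nth f i * fps_nth g (n - i) = 0"
    using assms by (auto simp: fps_deg_le_def)
qed

lemma fps_deg_le_1: "fps_deg_le 0 1"
  by (simp add: fps_deg_le_def)

lemma fps_deg_le_lin: "fps_deg_le 1 (fps_lin a)"
  by (auto simp: fps_deg_le_def fps_lin_def fps_X_def)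

lemma fps_deg_le_prod:
  assumes "\<And>i. i \<in> A \<Longrightarrow> fps_deg_le d (f i)"
  shows "fps_deg_le (card A * d) (prod f A)"
  using assms
proof (induction A rule: infinite_finite_induct)
  case (insert x A)
  then show ?case using fps_deg_le_mult[of d "f x" "card A * d" "prod f A"] by (simp add: add.commute)
qed (auto simp: fps_deg_le_1)

lemma Qpol_alt: "Abs_fps Qpol * fps_alt (Abs_fps Qpol) = 1"
proof (rule fps_map_series_inj)
  note h = rhom_fps_map[OF rhom_series_of]
  have "fps_map series_of (fps_alt (Abs_fps Qpol)) = fps_alt (Abs_fps Qser)"
    by (simp add: fps_eq_iff rhom_simps[OF rhom_series_of] Qpol.rep_eq)
  moreover have "fps_map series_of (Abs_fps Qpol) = Abs_fps Qser"
    by (simp add: fps_eq_iff Qpol.rep_eq)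
  ultimately show "fps_map series_of (Abs_fps Qpol * fps_alt (Abs_fps Qpol)) = fps_map series_of 1"
    by (simp add: rhom_mult[OF h] rhom_one[OF h] Qser_alt)
qed

text \<open>Since Q(u) Q(-u) = 1, what remains is the product of the factors 1 - z_i^2 u^2 and 1 -
  t_i^2 u^2. For l < 0 the latter would be denominators.\<close>

lemma theta_ser_alt:
  assumes "l \<ge> 0"
  shows "fps_deg_le (2 * (k + nat l)) (theta_ser k l * fps_alt (theta_ser k l))"
proof -
  let ?g = "z_factor k * t_factor l"
  have "fps_deg_le (card {1..k} * 1 + card {1..nat l} * 1) ?g"
    unfolding z_factor_def t_factor_def using assms
    by (simp only: if_True) (intro fps_deg_le_mult fps_deg_le_prod fps_deg_le_lin)
  then have g: "fps_deg_le (k + nat l) ?g" by simp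
  then have "fps_deg_le (k + nat l) (fps_alt ?g)" by (simp add: fps_deg_le_def)
  with g have "fps_deg_le ((k + nat l) + (k + nat l)) (?g * fps_alt ?g)" by (rule fps_deg_le_mult)
  moreover have "theta_ser k l * fps_alt (theta_ser k l) =
      (Abs_fps Qpol * fps_alt (Abs_fps Qpol)) * (?g * fps_alt ?g)"
    by (simp only: theta_ser_eq rhom_mult[OF rhom_fps_alt] mult_ac)
  ultimately show ?thesis by (simp only: Qpol_alt mult_1_left mult_2)
qed

text \<open>At x = 0 and z = t the series is the product of the 1 + t_i u for i \<le> k, times the
  t-factor. The lower bound on l makes every denominator 1 + t_i u cancel against one of these,
  leaving a polynomial of degree at most k + l.\<close>

lemma ev_theta_vanish:
  assumes "l \<ge> - int k" "r > int k + l"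
  shows "ev (theta k l r) = 0"
proof -
  note h = rhom_fps_map[OF rhom_ev]
  have eq: "fps_map ev (theta_ser k l) = fps_map ev (z_factor k) * fps_map ev (t_factor l)"
    by (simp add: theta_ser_eq rhom_mult[OF h] ev_Q)
  have z: "fps_map ev (z_factor k) = (\<Prod>i=1..k. fps_lin (ev (tvar i)))"
    by (simp add: z_factor_def rhom_prod[OF h] fps_map_lin[OF rhom_ev] ev_z_t)
  have "fps_deg_le (nat (int k + l)) (fps_map ev (theta_ser k l))"
  proof (cases "l \<ge> 0")
    case True
    then have t: "fps_map ev (t_factor l) = (\<Prod>i=1..nat l. fps_lin (- ev (tvar i)))"
      by (simp add: t_factor_def rhom_prod[OF h] fps_map_lin[OF rhom_ev] rhom_uminus[OF rhom_ev])
    have "fps_deg_le (card {1..k} * 1 + card {1..nat l} * 1) (fps_map ev (theta_ser k l))"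
      unfolding eq z t by (intro fps_deg_le_mult fps_deg_le_prod fps_deg_le_lin)
    then show ?thesis using True by (simp add: nat_add_distrib)
  next
    case False
    define j where "j = nat (- l)"
    have j: "j \<le> k" using assms(1) by (simp add: j_def)
    have t: "fps_map ev (t_factor l) = (\<Prod>i=1..j. fps_geom (- ev (tvar i)))"
      using False by (simp add: t_factor_def j_def rhom_prod[OF h] fps_map_geom[OF rhom_ev] rhom_uminus[OF rhom_ev])
    have "(\<Prod>i=1..k. fps_lin (ev (tvar i))) = (\<Prod>i=1..j. fps_lin (ev (tvar i))) * (\<Prod>i=Suc j..k. fps_lin (ev (tvar i)))"
      using prod.ub_add_nat[of 1 j "\<lambda>i. fps_lin (ev (tvar i))" "k - j"] j by simp
    then have "fps_map ev (theta_ser k l) =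
      (\<Prod>i=1..j. fps_lin (ev (tvar i)) * fps_geom (- ev (tvar i))) * (\<Prod>i=Suc j..k. fps_lin (ev (tvar i)))"
      unfolding eq z t prod.distrib by (simp only: mult_ac)
    also have "\<dots> = (\<Prod>i=Suc j..k. fps_lin (ev (tvar i)))"
      by (simp only: fps_lin_mult_geom prod.neutral_const mult_1_left)
    finally have "fps_map ev (theta_ser k l) = (\<Prod>i=Suc j..k. fps_lin (ev (tvar i)))" .
    moreover have "fps_deg_le (card {Suc j..k} * 1) (\<Prod>i=Suc j..k. fps_lin (ev (tvar i)))"
      by (intro fps_deg_le_prod fps_deg_le_lin)
    moreover have "card {Suc j..k} * 1 = nat (int k + l)" using j False by (simp add: j_def nat_diff_distrib' flip: diff_conv_add_uminus)
    ultimately show ?thesis by simp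
  qed
  then show ?thesis using assms by (auto simp: theta_eq fps_int_nth_map[OF rhom_ev] fps_int_nth_def fps_deg_le_def)
qed

section \<open>Raising operators\<close>

text \<open>Raising operators act on the indices before the sequences are evaluated, so the Pfaffian
  is regarded as a function of the index vector r. Rows are numbered from 0.\<close>

definition Phi :: "nat \<Rightarrow> (nat \<Rightarrow> int \<Rightarrow> 'a::comm_ring_1) \<Rightarrow> (nat \<Rightarrow> int) \<Rightarrow> 'a" where
  "Phi m c r = bpf (\<lambda>i j. pf_entry (c i, r i) (c j, r j)) (\<lambda>i. c i (r i)) [0..<m]"

text \<open>The exponent vector of the product of the R_ij over the pairs in I, where R_ij raises
  index i and lowers index j.\<close>

definition shift :: "(nat \<times> nat) set \<Rightarrow> nat \<Rightarrow> int" where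
  "shift I l = int (card {p \<in> I. fst p = l}) - int (card {p \<in> I. snd p = l})"

text \<open>\<open>raise D \<Phi> r\<close> is the product of the operators \<open>1 + R\<^sub>i\<^sub>j\<close>, \<open>(i, j) \<in> D\<close>, applied to \<open>\<Phi>\<close>.\<close>

definition raise :: "(nat \<times> nat) set \<Rightarrow> ((nat \<Rightarrow> int) \<Rightarrow> 'a::comm_ring_1) \<Rightarrow> (nat \<Rightarrow> int) \<Rightarrow> 'a" where
  "raise D \<Phi> r = (\<Sum>I\<in>Pow D. \<Phi> (\<lambda>l. r l + shift I l))"

lemma shift_empty [simp]: "shift {} = (\<lambda>_. 0)"
  by (simp add: shift_def fun_eq_iff)

lemma raise_empty [simp]: "raise {} \<Phi> r = \<Phi> r"
  by (simp add: raise_def)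

lemma shift_insert:
  assumes "finite I" "(i, j) \<notin> I"
  shows "shift (insert (i, j) I) l = shift I l + (if l = i then 1 else 0) - (if l = j then 1 else 0)"
proof -
  have "{p \<in> insert (i, j) I. fst p = l} = (if l = i then insert (i, j) {p \<in> I. fst p = l} else {p \<in> I. fst p = l})"
    "{p \<in> insert (i, j) I. snd p = l} = (if l = j then insert (i, j) {p \<in> I. snd p = l} else {p \<in> I. snd p = l})"
    by auto
  then show ?thesis using assms by (auto simp: shift_def card_insert_if)
qed

lemma raise_insert:
  assumes "finite D" "(i, j) \<notin> D"
  shows "raise (insert (i, j) D) \<Phi> r =
    raise D (\<lambda>r. \<Phi> r + \<Phi> (\<lambda>l. r l + (if l = i then 1 else 0) - (if l = j then 1 else 0))) r"
proof -
  have start: "raise (insert (i, j) D) \<Phi> r =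
    (\<Sum>I\<in>Pow D. \<Phi> (\<lambda>l. r l + shift I l)) + (\<Sum>I\<in>insert (i, j) ` Pow D. \<Phi> (\<lambda>l. r l + shift I l))"
    unfolding raise_def Pow_insert using assms by (intro sum.union_disjoint) auto
  have inj: "inj_on (insert (i, j)) (Pow D)"
    using assms(2) by (intro inj_onI) (metis PowD insert_ident subsetD)
  note start
  also have "(\<Sum>I\<in>insert (i, j) ` Pow D. \<Phi> (\<lambda>l. r l + shift I l)) =
    (\<Sum>I\<in>Pow D. \<Phi> (\<lambda>l. r l + shift (insert (i, j) I) l))"
    by (simp add: sum.reindex[OF inj])
  also have "\<dots> = (\<Sum>I\<in>Pow D. \<Phi> (\<lambda>l. (r l + shift I l) + (if l = i then 1 else 0) - (if l = j then 1 else 0)))"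
  proof (rule sum.cong[OF refl])
    fix I assume I: "I \<in> Pow D"
    then have "finite I" "(i, j) \<notin> I" using assms finite_subset by auto
    note eq = shift_insert[OF this]
    show "\<Phi> (\<lambda>l. r l + shift (insert (i, j) I) l) =
      \<Phi> (\<lambda>l. (r l + shift I l) + (if l = i then 1 else 0) - (if l = j then 1 else 0))"
      by (rule arg_cong[of _ _ \<Phi>]) (simp add: eq fun_eq_iff)
  qed
  finally show ?thesis by (simp add: raise_def sum.distrib)
qed

lemma raise_cong:
  assumes "\<And>I. I \<subseteq> D \<Longrightarrow> \<Phi> (\<lambda>l. r l + shift I l) = \<Psi> (\<lambda>l. r' l + shift I l)"
  shows "raise D \<Phi> r = raise D \<Psi> r'"
  unfolding raise_def by (rule sum.cong) (auto simp: assms)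

lemma raise_scale: "raise D (\<lambda>r. a * \<Phi> r) r = a * raise D \<Phi> r"
  by (simp add: raise_def sum_distrib_left)

lemma raise_diff: "raise D (\<lambda>r. \<Phi> r - \<Psi> r) r = raise D \<Phi> r - raise D \<Psi> r"
  by (simp add: raise_def sum_subtractf)

lemma raise_hom: "rhom h \<Longrightarrow> h (raise D \<Phi> r) = raise D (\<lambda>r. h (\<Phi> r)) r"
  by (simp add: raise_def rhom_sum)

lemma raise_translate:
  "raise D (\<lambda>r. \<Phi> (\<lambda>l. r l + e l)) r = raise D \<Phi> (\<lambda>l. r l + e l)"
  by (rule raise_cong) (simp add: algebra_simps)

definition swap_pairs :: "nat \<Rightarrow> (nat \<times> nat) \<Rightarrow> (nat \<times> nat)" where
  "swap_pairs j p = (transpose j (Suc j) (fst p), transpose j (Suc j) (snd p))"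

lemma swap_pairs_invol [simp]: "swap_pairs j (swap_pairs j p) = p"
  by (simp add: swap_pairs_def)

lemma shift_swap_pairs: "shift (swap_pairs j ` I) l = shift I (transpose j (Suc j) l)"
proof -
  have inj: "inj (swap_pairs j)" by (rule inj_on_inverseI[of _ "swap_pairs j"]) simp
  have inj_t: "transpose j (Suc j) a = transpose j (Suc j) b \<longleftrightarrow> a = b" for a b
    by (metis transpose_involutory)
  have mem: "p \<in> swap_pairs j ` J \<longleftrightarrow> swap_pairs j p \<in> J" for p J
    by (metis image_iff swap_pairs_invol)
  have "{p \<in> swap_pairs j ` I. fst p = l} = swap_pairs j ` {p \<in> I. fst p = transpose j (Suc j) l}"
    "{p \<in> swap_pairs j ` I. snd p = l} = swap_pairs j ` {p \<in> I. snd p = transpose j (Suc j) l}"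
    unfolding set_eq_iff mem mem_Collect_eq by (auto simp: swap_pairs_def inj_t)
  then show ?thesis
    by (simp add: shift_def card_image[OF inj_on_subset[OF inj subset_UNIV]])
qed

text \<open>Exchanging j and j + 1 permutes the subsets of D and transposes their shifts, so the sum
  equals its own negative; \<open>rinf\<close> has no 2-torsion.\<close>

lemma raise_antisymmetric:
  fixes \<Phi> :: "(nat \<Rightarrow> int) \<Rightarrow> rinf"
  assumes D: "swap_pairs j ` D = D"
    and anti: "\<And>I. I \<subseteq> D \<Longrightarrow>
      \<Phi> (\<lambda>l. r l + shift I l) + \<Phi> (\<lambda>l. r l + shift I (transpose j (Suc j) l)) = 0"
  shows "raise D \<Phi> r = 0"
proof -
  have "(\<Sum>I\<in>Pow D. \<Phi> (\<lambda>l. r l + shift I l)) = (\<Sum>I\<in>Pow D. \<Phi> (\<lambda>l. r l + shift (swap_pairs j ` I) l))"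
  proof (rule sum.reindex_bij_witness[of _ "\<lambda>I. swap_pairs j ` I" "\<lambda>I. swap_pairs j ` I"])
    show "swap_pairs j ` swap_pairs j ` I = I" for I by (simp add: image_image)
    show "swap_pairs j ` swap_pairs j ` I = I" for I by (simp add: image_image)
    show "swap_pairs j ` I \<in> Pow D" if "I \<in> Pow D" for I using that D by blast
    show "swap_pairs j ` I \<in> Pow D" if "I \<in> Pow D" for I using that D by blast
    show "\<Phi> (\<lambda>l. r l + shift (swap_pairs j ` swap_pairs j ` I) l) = \<Phi> (\<lambda>l. r l + shift I l)" for I
      by (simp add: image_image)
  qed
  then have "raise D \<Phi> r + raise D \<Phi> r = (\<Sum>I\<in>Pow D. \<Phi> (\<lambda>l. r l + shift I l) + \<Phi> (\<lambda>l. r l + shift I (transpose j (Suc j) l)))"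
    unfolding sum.distrib raise_def shift_swap_pairs by simp
  also have "\<dots> = 0" using anti by (intro sum.neutral) auto
  finally show ?thesis using two_cancel[of "raise D \<Phi> r"] by simp
qed

section \<open>The Pfaffian as a function of its rows\<close>

lemma Phi_cong: "(\<And>i. i < m \<Longrightarrow> c i = c' i) \<Longrightarrow> (\<And>i. i < m \<Longrightarrow> r i = r' i) \<Longrightarrow> Phi m c r = Phi m c' r'"
  unfolding Phi_def by (rule bpf_cong) auto

lemma Phi_hom:
  assumes h: "rhom h"
  shows "h (Phi m c r) = Phi m (\<lambda>i x. h (c i x)) r"
proof -
  have entry: "h (pf_entry (a, p) (b, q)) = pf_entry (\<lambda>x. h (a x), p) (\<lambda>x. h (b x), q)" for a b p q
    by (simp add: pf_entry_def rhom_simps[OF h])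
  show ?thesis unfolding Phi_def
    using bpf_hom[of h "\<lambda>i j. pf_entry (c i, r i) (c j, r j)" "\<lambda>i. c i (r i)" "[0..<m]"]
    by (simp add: rhom_simps[OF h] entry)
qed

lemma pf_entry_extend:
  assumes "\<And>x. x < 0 \<Longrightarrow> d x = 0" "nat q \<le> N"
  shows "pf_entry (c, p) (d, q) = c p * d q + 2 * (\<Sum>s=1..N. (-1) ^ s * c (p + int s) * d (q - int s))"
proof -
  have "(\<Sum>s=1..nat q. (-1) ^ s * c (p + int s) * d (q - int s)) = (\<Sum>s=1..N. (-1) ^ s * c (p + int s) * d (q - int s))"
    by (rule sum.mono_neutral_left) (use assms in auto)
  then show ?thesis by (simp add: pf_entry_def)
qed

lemma pf_entry_linear_left:
  "pf_entry (\<lambda>x. a x + \<beta> * b (x - 1), p) y = pf_entry (a, p) y + \<beta> * pf_entry (b, p - 1) y"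
proof -
  have "(\<Sum>s=1..nat (snd y). (-1) ^ s * (a (p + int s) + \<beta> * b (p + int s - 1)) * fst y (snd y - int s)) =
    (\<Sum>s=1..nat (snd y). (-1) ^ s * a (p + int s) * fst y (snd y - int s)) +
    \<beta> * (\<Sum>s=1..nat (snd y). (-1) ^ s * b (p - 1 + int s) * fst y (snd y - int s))"
    unfolding sum_distrib_left sum.distrib[symmetric] by (intro sum.cong refl) (simp add: algebra_simps)
  then show ?thesis by (simp add: pf_entry_def algebra_simps)
qed

text \<open>\<open>pf_entry\<close> sums up to the index of its second row, which is p in some terms
  and p - 1 in another; the surplus summands carry negative indices and vanish.\<close>

lemma pf_entry_linear_right:
  assumes a: "\<And>x. x < 0 \<Longrightarrow> a x = 0" and b: "\<And>x. x < 0 \<Longrightarrow> b x = 0"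
  shows "pf_entry y (\<lambda>x. a x + \<beta> * b (x - 1), p) = pf_entry y (a, p) + \<beta> * pf_entry y (b, p - 1)"
proof -
  obtain c q where y: "y = (c, q)" by (cases y)
  have ab: "a x + \<beta> * b (x - 1) = 0" if "x < 0" for x using a b that by simp
  have "(\<Sum>s=1..nat p. (-1) ^ s * c (q + int s) * (a (p - int s) + \<beta> * b (p - int s - 1))) =
    (\<Sum>s=1..nat p. (-1) ^ s * c (q + int s) * a (p - int s)) +
    \<beta> * (\<Sum>s=1..nat p. (-1) ^ s * c (q + int s) * b (p - 1 - int s))"
    unfolding sum_distrib_left sum.distrib[symmetric] by (intro sum.cong refl) (simp add: algebra_simps)
  moreover have "nat (p - 1) \<le> nat p" by simp
  note pf_entry_extend[of b "p - 1" "nat p" c q, OF b this]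
  moreover note pf_entry_extend[of a p "nat p" c q, OF a order_refl]
    pf_entry_extend[of "\<lambda>x. a x + \<beta> * b (x - 1)" p "nat p" c q, OF ab order_refl]
  ultimately show ?thesis unfolding y by (simp add: algebra_simps)
qed

lemma upt_split: "j < m \<Longrightarrow> [0..<m] = [0..<j] @ j # [Suc j..<m]"
  using upt_add_eq_append[of 0 j "m - j"] upt_conv_Cons[of j m] by simp

text \<open>The hypothesis on \<open>c j\<close> is the shape of a theta sequence under a change of
  its index by one; the shifted argument turns into a lowered row index of the second
  Pfaffian.\<close>

lemma Phi_linear:
  assumes j: "j < m" and c: "c j = (\<lambda>x. a x + \<beta> * b (x - 1))"
    and a: "\<And>x. x < 0 \<Longrightarrow> a x = 0" and b: "\<And>x. x < 0 \<Longrightarrow> b x = 0"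
  shows "Phi m c r = Phi m (c(j := a)) r + \<beta> * Phi m (c(j := b)) (r(j := r j - 1))"
proof -
  have left: "pf_entry (c j, r j) y = pf_entry (a, r j) y + \<beta> * pf_entry (b, r j - 1) y" for y
    unfolding c by (rule pf_entry_linear_left)
  have right: "pf_entry y (c j, r j) = pf_entry y (a, r j) + \<beta> * pf_entry y (b, r j - 1)" for y
    unfolding c by (rule pf_entry_linear_right[OF a b])
  have cj: "c j (r j) = a (r j) + \<beta> * b (r j - 1)" by (simp add: c)
  show ?thesis
    unfolding Phi_def upt_split[OF j] by (rule bpf_linear_row) (auto simp: left right cj)
qed

lemma Phi_swap:
  assumes j: "Suc j < m" and c: "c (Suc j) = c j"
  shows "Phi m c r + Phi m c (\<lambda>l. r (transpose j (Suc j) l)) =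
    (pf_entry (c j, r j) (c j, r (Suc j)) + pf_entry (c j, r (Suc j)) (c j, r j)) *
    bpf (\<lambda>i j. pf_entry (c i, r i) (c j, r j)) (\<lambda>i. c i (r i)) ([0..<j] @ [Suc (Suc j)..<m])"
proof -
  let ?K = "\<lambda>i j. pf_entry (c i, r i) (c j, r j)" and ?g = "\<lambda>i. c i (r i)" and ?t = "transpose j (Suc j)"
  have list: "[0..<m] = [0..<j] @ j # Suc j # [Suc (Suc j)..<m]"
    using upt_split[of j m] j by (simp add: upt_conv_Cons)
  have ct: "c (?t l) = c l" for l using c by (auto simp: transpose_def)
  have "Phi m c (\<lambda>l. r (?t l)) = bpf (\<lambda>i j. ?K (?t i) (?t j)) (\<lambda>i. ?g (?t i)) [0..<m]"
    unfolding Phi_def by (simp add: ct)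
  also have "\<dots> = bpf ?K ?g (map ?t [0..<m])"
    by (simp add: bpf_map)
  also have "map ?t [0..<m] = [0..<j] @ Suc j # j # [Suc (Suc j)..<m]"
  proof -
    have "map ?t [0..<j] = [0..<j]" "map ?t [Suc (Suc j)..<m] = [Suc (Suc j)..<m]"
      by (rule map_idI, auto simp: transpose_def)+
    then show ?thesis unfolding list by simp
  qed
  finally show ?thesis
    using bpf_swap[of ?K ?g "[0..<j]" j "Suc j" "[Suc (Suc j)..<m]"]
    by (simp add: Phi_def list c)
qed

definition alt_sign :: "int \<Rightarrow> 'a::comm_ring_1" where
  "alt_sign a = (if even a then 1 else - 1)"

text \<open>The coefficient of u^n in c(-u) c(u).\<close>

definition alt_conv :: "(int \<Rightarrow> 'a::comm_ring_1) \<Rightarrow> int \<Rightarrow> 'a" where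
  "alt_conv c n = (\<Sum>a\<in>{0..n}. alt_sign a * c a * c (n - a))"

lemma alt_sign_power: "(-1) ^ s = alt_sign (int s)"
  by (simp add: alt_sign_def)

text \<open>With n = p + q, putting a = p + s in one entry and a = p - s in the other turns the two
  sums into the parts of the alternating convolution above and below a = p, and the products of c p
  and c q supply the middle term. Only the sign depends on p itself, the rest on p + q.\<close>

lemma pf_entry_symmetrized:
  assumes c: "\<And>x. x < 0 \<Longrightarrow> c x = 0"
  shows "pf_entry (c, p) (c, q) + pf_entry (c, q) (c, p) = 2 * (alt_sign p * alt_conv c (p + q))"
proof -
  \<comment> \<open>Large enough to cover both summation ranges and every a with 0 \<le> a \<le> n;
    the additional terms vanish.\<close>
  define N where "N = nat (\<bar>p\<bar> + \<bar>q\<bar>)"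
  define n where "n = p + q"
  define f where "f a = alt_sign a * c a * c (n - a)" for a
  have sign: "alt_sign p * alt_sign (p + a) = (alt_sign a :: 'a)" "alt_sign p * alt_sign (p - a) = (alt_sign a :: 'a)" for a
    by (auto simp: alt_sign_def)
  have up: "(\<Sum>s=1..N. (-1) ^ s * c (p + int s) * c (q - int s)) = alt_sign p * (\<Sum>a\<in>{p+1..p + int N}. f a)"
  proof -
    have "alt_sign p * f (p + int s) = (-1) ^ s * c (p + int s) * c (q - int s)" for s
    proof -
      have "n - (p + int s) = q - int s" by (simp add: n_def)
      then show ?thesis by (simp only: f_def mult.assoc[symmetric] sign alt_sign_power)
    qed
    then have "(\<Sum>s=1..N. (-1) ^ s * c (p + int s) * c (q - int s)) = (\<Sum>s=1..N. alt_sign p * f (p + int s))"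
      by (simp only:)
    also have "\<dots> = (\<Sum>a\<in>{p+1..p + int N}. alt_sign p * f a)"
      by (rule sum.reindex_bij_witness[of _ "\<lambda>a. nat (a - p)" "\<lambda>s. p + int s"]) auto
    finally show ?thesis by (simp only: sum_distrib_left)
  qed
  have down: "(\<Sum>s=1..N. (-1) ^ s * c (q + int s) * c (p - int s)) = alt_sign p * (\<Sum>a\<in>{p - int N..p - 1}. f a)"
  proof -
    have "alt_sign p * f (p - int s) = (-1) ^ s * c (q + int s) * c (p - int s)" for s
    proof -
      have n: "n - (p - int s) = q + int s" by (simp add: n_def)
      have "alt_sign p * f (p - int s) = (-1) ^ s * c (p - int s) * c (q + int s)"
        by (simp only: f_def n mult.assoc[symmetric] sign alt_sign_power)
      then show ?thesis by (simp only: mult_ac)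
    qed
    then have "(\<Sum>s=1..N. (-1) ^ s * c (q + int s) * c (p - int s)) = (\<Sum>s=1..N. alt_sign p * f (p - int s))"
      by (simp only:)
    also have "\<dots> = (\<Sum>a\<in>{p - int N..p - 1}. alt_sign p * f a)"
      by (rule sum.reindex_bij_witness[of _ "\<lambda>a. nat (p - a)" "\<lambda>s. p - int s"]) auto
    finally show ?thesis by (simp only: sum_distrib_left)
  qed
  have mid: "c p * c q = alt_sign p * f p"
    by (simp add: f_def n_def alt_sign_def)
  have split: "{p - int N..p + int N} = insert p ({p - int N..p - 1} \<union> {p + 1..p + int N})" by auto
  have "(\<Sum>a\<in>{p - int N..p + int N}. f a) = f p + ((\<Sum>a\<in>{p - int N..p - 1}. f a) + (\<Sum>a\<in>{p+1..p + int N}. f a))"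
    unfolding split by (subst sum.insert) (auto intro!: sum.union_disjoint)
  moreover have "(\<Sum>a\<in>{p - int N..p + int N}. f a) = alt_conv c n"
    unfolding alt_conv_def f_def[symmetric]
    by (rule sum.mono_neutral_right) (auto simp: N_def n_def f_def c)
  ultimately have "alt_sign p * alt_conv c n = alt_sign p * f p + (alt_sign p * (\<Sum>a\<in>{p - int N..p - 1}. f a) + alt_sign p * (\<Sum>a\<in>{p+1..p + int N}. f a))"
    by (simp add: algebra_simps)
  moreover have "nat q \<le> N" "nat p \<le> N" by (auto simp: N_def)
  then have E1: "pf_entry (c, p) (c, q) = c p * c q + 2 * (alt_sign p * (\<Sum>a\<in>{p+1..p + int N}. f a))"
    and E2: "pf_entry (c, q) (c, p) = c q * c p + 2 * (alt_sign p * (\<Sum>a\<in>{p - int N..p - 1}. f a))"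
    using pf_entry_extend[of c q N c p, OF c] pf_entry_extend[of c p N c q, OF c] by (simp_all only: up down)
  ultimately show ?thesis unfolding n_def[symmetric] E1 E2
    by (simp only: mid[symmetric] mult.commute[of "c q"]) (simp add: algebra_simps)
qed

lemma shift_first_nonneg:
  assumes "\<And>p. p \<in> D \<Longrightarrow> fst p < snd p" "I \<subseteq> D"
  shows "shift I 0 \<ge> 0"
proof -
  have "{p \<in> I. snd p = 0} = {}" using assms by fastforce
  then show ?thesis by (simp add: shift_def del: Collect_empty_eq)
qed

lemma raise_zero: "(\<And>I. I \<subseteq> D \<Longrightarrow> \<Phi> (\<lambda>l. r l + shift I l) = 0) \<Longrightarrow> raise D \<Phi> r = 0"
  unfolding raise_def by (rule sum.neutral) auto

lemma Phi_first_zero: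
  assumes "m > 0" "\<And>x. x \<ge> r 0 \<Longrightarrow> c 0 x = 0"
  shows "Phi m c r = 0"
proof -
  have "[0..<m] = 0 # [1..<m]" using assms(1) by (simp add: upt_conv_Cons)
  then show ?thesis unfolding Phi_def
    by (simp only:, intro bpf_zero_first) (auto simp: pf_entry_def assms(2))
qed

lemma Phi_last_zero:
  assumes "\<And>x. x < 0 \<Longrightarrow> c m x = 0" "r m < 0"
  shows "Phi (Suc m) c r = 0"
  unfolding Phi_def upt_Suc using assms by (auto intro!: bpf_zero_last simp: pf_entry_def)

lemma Phi_last_unit:
  assumes "c m 0 = 1" "r m = 0"
  shows "Phi (Suc m) c r = Phi m c r"
  unfolding Phi_def upt_Suc using assms by (auto intro!: bpf_snoc_unit simp: pf_entry_def)

lemma shift_last: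
  assumes "finite D" "\<And>p. p \<in> D \<Longrightarrow> fst p < snd p \<and> snd p \<le> m" "I \<subseteq> D"
  shows "shift I m \<le> 0" "\<exists>p\<in>I. snd p = m \<Longrightarrow> shift I m < 0"
proof -
  have e: "{p \<in> I. fst p = m} = {}" using assms by fastforce
  then show "shift I m \<le> 0" by (simp add: shift_def del: Collect_empty_eq)
  assume "\<exists>p\<in>I. snd p = m"
  then have "{p \<in> I. snd p = m} \<noteq> {}" by blast
  moreover have "finite {p \<in> I. snd p = m}" using finite_subset[OF assms(3,1)] by simp
  ultimately have "card {p \<in> I. snd p = m} > 0" by (metis card_gt_0_iff)
  then show "shift I m < 0" by (simp only: shift_def e card.empty)
qed

lemma raise_last_unit:
  assumes D: "finite D" "\<And>p. p \<in> D \<Longrightarrow> fst p < snd p \<and> snd p \<le> m"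
    and c: "c m 0 = 1" "\<And>x. x < 0 \<Longrightarrow> c m x = 0" and r: "r m = 0"
  shows "raise D (Phi (Suc m) c) r = raise {p \<in> D. snd p < m} (Phi m c) r"
proof -
  have "raise D (Phi (Suc m) c) r = (\<Sum>I\<in>Pow {p \<in> D. snd p < m}. Phi (Suc m) c (\<lambda>l. r l + shift I l))"
    unfolding raise_def
  proof (rule sum.mono_neutral_right)
    show "\<forall>I\<in>Pow D - Pow {p \<in> D. snd p < m}. Phi (Suc m) c (\<lambda>l. r l + shift I l) = 0"
    proof
      fix I assume I: "I \<in> Pow D - Pow {p \<in> D. snd p < m}"
      then obtain p where "p \<in> I" "\<not> snd p < m" by blast
      then have "\<exists>p\<in>I. snd p = m" using I D(2)[of p] by (intro bexI[of _ p]) auto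
      then have "shift I m < 0" using shift_last(2)[OF D, of I] I by auto
      then show "Phi (Suc m) c (\<lambda>l. r l + shift I l) = 0" using r c by (intro Phi_last_zero) auto
    qed
  qed (use D in auto)
  also have "\<dots> = raise {p \<in> D. snd p < m} (Phi m c) r"
    unfolding raise_def
  proof (rule sum.cong[OF refl])
    fix I assume I: "I \<in> Pow {p \<in> D. snd p < m}"
    then have "{p \<in> I. fst p = m} = {}" "{p \<in> I. snd p = m} = {}" using D(2) by fastforce+
    then have "shift I m = 0" by (simp only: shift_def card.empty)
    then show "Phi (Suc m) c (\<lambda>l. r l + shift I l) = Phi m c (\<lambda>l. r l + shift I l)"
      using r c by (intro Phi_last_unit) auto
  qed
  finally show ?thesis .
qed

lemma Phi_schur_pf: "schur_pf (map (\<lambda>i. (c i, r i)) [0..<m]) = Phi m c r"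
  by (simp add: Phi_def schur_pf_eq_bpf bpf_map)

section \<open>Left descents of \<open>k\<close>-Grassmannian elements\<close>

definition row_pos :: "nat \<Rightarrow> nat \<Rightarrow> int" where
  "row_pos k j = int (k + 1 + j)"

definition row_chi :: "nat \<Rightarrow> (int \<Rightarrow> int) \<Rightarrow> nat \<Rightarrow> int" where
  "row_chi k w j = (let a = w (row_pos k j) in if a < 0 then - a - 1 else - a)"

text \<open>Both cases of \<open>shape\<close> in one formula: for k-Grassmannian w, all k of the
  v_p are counted at a negative value, since they are positive.\<close>

definition row_lam :: "nat \<Rightarrow> (int \<Rightarrow> int) \<Rightarrow> nat \<Rightarrow> int" where
  "row_lam k w j = (let a = w (row_pos k j) in max (- a) 0 + int (card {p \<in> {1..k}. w (int p) > a}))"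

lemma W_kD:
  assumes "w \<in> W_k k n"
  shows "w \<in> W_inf" "\<And>p. p > int n \<Longrightarrow> w p = p" "\<And>i. i \<noteq> k \<Longrightarrow> ascent w i"
  using assms len_less_comp_gen_s(1)[of w] by (auto simp: W_k_def W_fin_def W_inf_k_def)

lemma W_kI:
  assumes "w \<in> W_inf" "\<And>p. p > int n \<Longrightarrow> w p = p" "\<And>i. i \<noteq> k \<Longrightarrow> ascent w i"
  shows "w \<in> W_k k n"
  using assms len_less_comp_gen_s(1)[OF assms(1)] by (auto simp: W_k_def W_fin_def W_inf_k_def)

locale grassmannian =
  fixes k n :: nat and w :: "int \<Rightarrow> int"
  assumes w: "w \<in> W_k k n" and kn: "k \<le> n"
begin

lemma wW: "w \<in> W_inf"
  using w by (rule W_kD)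

abbreviation g :: "int \<Rightarrow> int" where "g \<equiv> winv w"

lemma gW: "g \<in> W_inf"
  by (rule inv_W_inf[OF wW])

lemma w_g [simp]: "w (g x) = x"
  using W_infD(1)[OF wW] by (simp add: bij_is_surj surj_f_inv_f)

lemma g_w [simp]: "g (w x) = x"
  using W_infD(2)[OF wW] by simp

lemma w_eq_iff: "w x = y \<longleftrightarrow> x = g y"
  by auto

lemmas w_neg = W_infD(4)[OF wW] and w_zero = W_infD(5)[OF wW]
lemmas g_neg = W_infD(4)[OF gW] and g_zero = W_infD(5)[OF gW]

lemma g_neg_Suc: "g (- int i - 1) = - g (int i + 1)"
proof -
  have "- int i - 1 = - (int i + 1)" by simp
  then show ?thesis by (simp only: g_neg)
qed

lemma increasing_gen:
  assumes "\<And>i. a \<le> i \<Longrightarrow> i < b \<Longrightarrow> w (int i) < w (int i + 1)" "a \<le> p" "p < q" "q \<le> b"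
  shows "w (int p) < w (int q)"
  using assms(3,4)
proof (induction q)
  case (Suc q)
  have "w (int q) < w (int q + 1)" using Suc.prems assms(2) by (intro assms(1)) auto
  then have step: "w (int q) < w (int (Suc q))" by (simp add: add.commute)
  show ?case
  proof (cases "p = q")
    case True
    then show ?thesis using step by simp
  next
    case False
    then have "w (int p) < w (int q)" using Suc by simp
    then show ?thesis using step by simp
  qed
qed simp

lemma left_increasing:
  assumes "1 \<le> p" "p < q" "q \<le> int k"
  shows "w p < w q"
proof -
  have "w (int i) < w (int i + 1)" if "nat p \<le> i" "i < nat q" for i
    using W_kD(3)[OF w, of i] that assms by (auto simp: ascent_def)
  then have "w (int (nat p)) < w (int (nat q))"
    by (rule increasing_gen[where a = "nat p" and b = "nat q"]) (use assms in auto)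
  then show ?thesis using assms by simp
qed

lemma right_increasing:
  assumes "int k < p" "p < q"
  shows "w p < w q"
proof -
  have "w (int i) < w (int i + 1)" if "nat p \<le> i" "i < nat q" for i
    using W_kD(3)[OF w, of i] that assms by (auto simp: ascent_def)
  then have "w (int (nat p)) < w (int (nat q))"
    by (rule increasing_gen[where a = "nat p" and b = "nat q"]) (use assms in auto)
  then show ?thesis using assms by simp
qed

lemma left_positive:
  assumes "1 \<le> p" "p \<le> int k"
  shows "w p > 0"
proof -
  have "w 1 > 0" using W_kD(3)[OF w, of 0] assms by (auto simp: ascent_def)
  then show ?thesis using left_increasing[of 1 p] assms by (cases "p = 1") auto
qed

lemma right_increasing_iff:
  "int k < p \<Longrightarrow> int k < q \<Longrightarrow> w p < w q \<longleftrightarrow> p < q"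
  using right_increasing[of p q] right_increasing[of q p] by (cases p q rule: linorder_cases) auto

lemma w_fixed: "\<bar>p\<bar> > int n \<Longrightarrow> w p = p"
  using W_kD(2)[OF w, of p] W_kD(2)[OF w, of "- p"] w_neg[of p] by (cases "p > 0") auto

lemma g_fixed: "\<bar>p\<bar> > int n \<Longrightarrow> g p = p"
  using w_fixed[of p] by (metis g_w)

lemma g_bound: "\<bar>b\<bar> \<le> int n \<Longrightarrow> \<bar>g b\<bar> \<le> int n"
  using w_fixed[of "g b"] by (metis w_g not_le)

lemma w_bound: "\<bar>b\<bar> \<le> int n \<Longrightarrow> \<bar>w b\<bar> \<le> int n"
  using g_fixed[of "w b"] by (metis g_w not_le)

lemma row_pos_gt: "row_pos k j > int k"
  by (simp add: row_pos_def)

lemma row_pos_le: "j < n - k \<Longrightarrow> row_pos k j \<le> int n"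
  by (simp add: row_pos_def)

lemma row_pos_inj [simp]: "row_pos k j = row_pos k l \<longleftrightarrow> j = l"
  by (simp add: row_pos_def)

lemma ex_row:
  assumes "int k < p" "p \<le> int n"
  obtains j where "j < n - k" "p = row_pos k j"
proof
  show "nat (p - int k - 1) < n - k" "p = row_pos k (nat (p - int k - 1))"
    using assms by (auto simp: row_pos_def)
qed

lemma row_chi_decreasing: "i < j \<Longrightarrow> row_chi k w i > row_chi k w j"
proof -
  assume "i < j"
  then have "w (row_pos k i) < w (row_pos k j)"
    by (intro right_increasing) (auto simp: row_pos_def)
  moreover have "w (row_pos k i) \<noteq> 0" "w (row_pos k j) \<noteq> 0"
    by (simp_all add: w_zero row_pos_def)
  ultimately show ?thesis by (auto simp: row_chi_def Let_def)
qed

text \<open>These are the two values at which \<open>gen_s i\<close> lowers chi by one: -(i+1) moves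
  up to the next nonzero integer, and i becomes i + 1.\<close>

lemma abs_row_chi:
  "\<bar>row_chi k w j\<bar> = int i \<longleftrightarrow> w (row_pos k j) = - int i - 1 \<or> w (row_pos k j) = int i"
  by (auto simp: row_chi_def Let_def)

lemma row_chi_eq:
  "w (row_pos k j) = - int i - 1 \<Longrightarrow> row_chi k w j = int i"
  "w (row_pos k j) = int i \<Longrightarrow> row_chi k w j = - int i"
  by (auto simp: row_chi_def Let_def)

lemma row_lam_neg:
  assumes "w (row_pos k j) < 0"
  shows "row_lam k w j = - w (row_pos k j) + int k"
proof -
  have "{p \<in> {1..k}. w (int p) > w (row_pos k j)} = {1..k}"
  proof -
    have "w (int p) > w (row_pos k j)" if "p \<in> {1..k}" for p
      using left_positive[of "int p"] that assms by auto
    then show ?thesis by blast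
  qed
  then have "card {p \<in> {1..k}. w (int p) > w (row_pos k j)} = k" by (simp only: card_atLeastAtMost diff_Suc_1)
  then show ?thesis using assms by (simp only: row_lam_def Let_def)
qed

lemma row_lam_pos:
  "w (row_pos k j) > 0 \<Longrightarrow> row_lam k w j = int (card {p \<in> {1..k}. w (int p) > w (row_pos k j)})"
  by (simp add: row_lam_def Let_def)

lemma row_lam_nonneg: "row_lam k w j \<ge> 0"
  by (simp add: row_lam_def Let_def)

lemma descent_bound:
  assumes "\<not> ascent g i"
  shows "i < n"
proof (rule ccontr)
  assume i: "\<not> i < n"
  then have "g (int i + 1) = int i + 1" by (intro g_fixed) auto
  moreover have "g (int i) \<le> int i"
    using g_fixed[of "int i"] g_bound[of "int i"] i by (cases "i = n") auto
  ultimately show False using assms by (auto simp: ascent_def split: if_splits)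
qed

text \<open>Left multiplication destroys a right ascent at a only if the values at a and a + 1 form
  a pair exchanged by \<open>gen_s i\<close>; increasing order of these would make i an ascent of
  \<open>winv w\<close>.\<close>

lemma descent_W_k:
  assumes desc: "\<not> ascent g i"
  shows "gen_s i \<circ> w \<in> W_k k n"
proof (rule W_kI)
  show "gen_s i \<circ> w \<in> W_inf" by (intro comp_W_inf gen_s_W_inf wW)
  show "(gen_s i \<circ> w) p = p" if "p > int n" for p
    using that descent_bound[OF desc] W_kD(2)[OF w that] by (auto simp: gen_s_apply)
  fix a assume a: "a \<noteq> k"
  note asc = W_kD(3)[OF w a]
  show "ascent (gen_s i \<circ> w) a"
  proof (cases "a = 0")
    case True
    then have "w 1 > 0" using asc by (simp add: ascent_def)
    moreover have "\<not> (i = 0 \<and> w 1 = 1)"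
    proof
      assume "i = 0 \<and> w 1 = 1"
      then have "g 1 = 1" "i = 0" by (metis g_w)+
      then show False using desc by (simp add: ascent_def)
    qed
    ultimately show ?thesis using True by (auto simp: ascent_def gen_s_apply)
  next
    case False
    then have less: "w (int a) < w (int a + 1)" using asc by (simp add: ascent_def)
    have "(w (int a), w (int a + 1)) \<notin> (if i = 0 then {(- 1, 1)} else {(int i, int i + 1), (- int i - 1, - int i)})"
    proof
      assume "(w (int a), w (int a + 1)) \<in> (if i = 0 then {(- 1, 1)} else {(int i, int i + 1), (- int i - 1, - int i)})"
      then consider "i = 0" "w (int a) = - 1" "w (int a + 1) = 1"
        | "i \<noteq> 0" "w (int a) = int i" "w (int a + 1) = int i + 1"
        | "i \<noteq> 0" "w (int a) = - int i - 1" "w (int a + 1) = - int i" by (auto split: if_splits)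
      then show False
      proof cases
        case 1
        then have "int a = - g 1" "int a + 1 = g 1" using g_neg[of 1] by (auto simp: w_eq_iff)
        then show False by simp
      next
        case 2
        then have "int a = g (int i)" "int a + 1 = g (int i + 1)" by (auto simp: w_eq_iff)
        then show False using desc 2(1) by (simp add: ascent_def)
      next
        case 3
        then have "int a = - g (int i + 1)" "int a + 1 = - g (int i)"
          using g_neg[of "int i"] by (auto simp: w_eq_iff g_neg_Suc)
        then show False using desc 3(1) by (simp add: ascent_def)
      qed
    qed
    then have "gen_s i (w (int a)) < gen_s i (w (int a + 1))"
      using less False by (intro gen_s_mono) (auto simp: w_zero)
    then show ?thesis using False by (simp add: ascent_def)
  qed
qed

text \<open>Values in the rows increase with the position, while a descent of the inverse at i puts
  i to the right of i + 1. So i + 1 in a row would be followed by the smaller i, and -i by the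
  smaller -(i+1).\<close>

lemma descent_rows:
  assumes desc: "\<not> ascent g i" and "i \<ge> 1"
  shows "w (row_pos k j) \<noteq> int i + 1" "w (row_pos k j) \<noteq> - int i"
proof -
  have PQ: "g (int i) > g (int i + 1)"
    using assms W_infD(2)[OF gW] by (auto simp: ascent_def inj_eq not_less le_less)
  show "w (row_pos k j) \<noteq> int i + 1"
  proof
    assume "w (row_pos k j) = int i + 1"
    then have "g (int i + 1) > int k" using row_pos_gt[of j] by (simp add: w_eq_iff)
    then have "w (g (int i + 1)) < w (g (int i))" using PQ by (intro right_increasing) auto
    then show False by simp
  qed
  show "w (row_pos k j) \<noteq> - int i"
  proof
    assume "w (row_pos k j) = - int i"
    then have "- g (int i) > int k" using row_pos_gt[of j] g_neg[of "int i"] by (simp add: w_eq_iff)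
    then have "w (- g (int i)) < w (- g (int i + 1))" using PQ by (intro right_increasing) auto
    then show False by (simp add: w_neg)
  qed
qed

lemma descent_row_chi:
  assumes desc: "\<not> ascent g i"
  shows "row_chi k (gen_s i \<circ> w) j = (if \<bar>row_chi k w j\<bar> = int i then row_chi k w j - 1 else row_chi k w j)"
proof -
  let ?a = "w (row_pos k j)"
  have nz: "?a \<noteq> 0" by (simp add: w_zero row_pos_def)
  have "?a \<noteq> 1" if "i = 0"
  proof
    assume "?a = 1"
    then have "g 1 = row_pos k j" by (simp add: w_eq_iff)
    then show False using desc that by (simp add: ascent_def row_pos_def)
  qed
  then show ?thesis
    using nz descent_rows[OF desc, of j]
    by (cases "i = 0") (auto simp: row_chi_def Let_def gen_s_apply)
qed

text \<open>A row with value -(i+1) loses one from its zeta. A row with value i becomes i + 1, and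
  its count of larger v_p drops exactly when i + 1 was one of them; if -(i+1) sits in a row instead,
  that row alone gets smaller.\<close>

lemma descent_row_lam:
  assumes desc: "\<not> ascent g i"
  shows "row_lam k (gen_s i \<circ> w) j =
    (if w (row_pos k j) = - int i - 1 \<or> (w (row_pos k j) = int i \<and> 1 \<le> g (int i + 1) \<and> g (int i + 1) \<le> int k)
     then row_lam k w j - 1 else row_lam k w j)"
proof -
  let ?a = "w (row_pos k j)" and ?s = "gen_s i"
  let ?V = "\<lambda>a. {p \<in> {1..k}. w (int p) > a}" and ?V' = "\<lambda>a. {p \<in> {1..k}. ?s (w (int p)) > a}"
  have nz: "?a \<noteq> 0" by (simp add: w_zero row_pos_def)
  have i0: "g 1 < 0" if "i = 0" using desc that g_zero[of 1] by (auto simp: ascent_def)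
  have v1: "w (int p) > 1" if "i = 0" "p \<in> {1..k}" for p
  proof -
    have "w (int p) \<noteq> 1" using i0 that by (auto simp: w_eq_iff)
    then show ?thesis using left_positive[of "int p"] that by force
  qed
  have lam: "row_lam k w j = max (- ?a) 0 + int (card (?V ?a))"
    by (simp add: row_lam_def Let_def)
  have lam': "row_lam k (?s \<circ> w) j = max (- ?s ?a) 0 + int (card (?V' (?s ?a)))"
    by (simp add: row_lam_def Let_def)
  have pos: "w (int p) > 0" if "p \<in> {1..k}" for p
    using left_positive[of "int p"] that by simp
  show ?thesis
  proof (cases "i = 0")
    case True
    have sv: "?s (w (int p)) = w (int p)" if "p \<in> {1..k}" for p
      using v1[OF True that] True by (simp add: gen_s_apply)
    have a1: "?a \<noteq> 1"
      using i0[OF True] by (auto simp: w_eq_iff row_pos_def)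
    show ?thesis
    proof (cases "?a = - 1")
      case a: True
      have "?V ?a = ?V' (?s ?a)"
      proof -
        have "w (int p) > ?a" "?s (w (int p)) > ?s ?a" if "p \<in> {1..k}" for p
          using sv[OF that] v1[OF True that] a True by (auto simp: gen_s_apply[of 0 "- 1"])
        then show ?thesis by blast
      qed
      then show ?thesis unfolding lam lam' using a True by (simp add: gen_s_apply)
    next
      case False
      have sa: "?s ?a = ?a" using False a1 True by (simp add: gen_s_apply)
      have "?V ?a = ?V' (?s ?a)" unfolding sa using sv by auto
      then show ?thesis unfolding lam lam' sa using False True nz by simp
    qed
  next
    case i: False
    then have rows: "?a \<noteq> int i + 1" "?a \<noteq> - int i" using descent_rows[OF desc, of j] by auto
    consider "?a = - int i - 1" | "?a = int i" | "?a \<noteq> - int i - 1" "?a \<noteq> int i" by blast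
    then show ?thesis
    proof cases
      case 1
      have spos: "?s (w (int p)) > 0" if "p \<in> {1..k}" for p
        using pos[OF that] i by (auto simp: gen_s_apply)
      have "w (int p) > ?a" "?s (w (int p)) > ?s ?a" if "p \<in> {1..k}" for p
        using pos[OF that] spos[OF that] 1 i by (auto simp: gen_s_apply[of i "- int i - 1"])
      then have "?V ?a = {1..k}" "?V' (?s ?a) = {1..k}" by blast+
      then show ?thesis unfolding lam lam' using 1 i by (simp add: gen_s_apply)
    next
      case 2
      have V': "?V' (?s ?a) = {p \<in> {1..k}. w (int p) > int i + 1}"
      proof -
        have "?s (w (int p)) > ?s ?a \<longleftrightarrow> w (int p) > int i + 1" if "p \<in> {1..k}" for p
          using pos[OF that] 2 i by (auto simp: gen_s_apply)
        then show ?thesis by blast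
      qed
      show ?thesis
      proof (cases "1 \<le> g (int i + 1) \<and> g (int i + 1) \<le> int k")
        case True
        define p where "p = nat (g (int i + 1))"
        have p: "p \<in> {1..k}" "w (int p) = int i + 1" using True by (auto simp: p_def)
        have "?V ?a = insert p {p \<in> {1..k}. w (int p) > int i + 1}"
        proof -
          have "w (int q) > ?a \<longleftrightarrow> q = p \<or> w (int q) > int i + 1" for q
          proof (cases "q = p")
            case True
            then show ?thesis using p(2) 2 by simp
          next
            case False
            have "w (int q) \<noteq> w (int p)" using False W_infD(2)[OF wW] by (simp add: inj_eq)
            then show ?thesis using False p(2) 2 by auto
          qed
          then show ?thesis using p(1) by blast
        qed
        then have "card (?V ?a) = Suc (card (?V' (?s ?a)))"
          unfolding V' using p(2) by simp
        then show ?thesis unfolding lam lam' using 2 i True by (simp add: gen_s_apply)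
      next
        case False
        have ne: "w (int q) \<noteq> int i + 1" if "q \<in> {1..k}" for q
          using that False by (auto simp: w_eq_iff)
        have "w (int q) > int i \<longleftrightarrow> w (int q) > int i + 1" if "q \<in> {1..k}" for q
          using ne[OF that] by arith
        then have "?V (int i) = {p \<in> {1..k}. w (int p) > int i + 1}" by blast
        then have "?V ?a = ?V' (?s ?a)" unfolding V' by (simp only: 2)
        then show ?thesis unfolding lam lam' using 2 i False by (simp add: gen_s_apply)
      qed
    next
      case 3
      have sa: "?s ?a = ?a" using 3 rows i by (simp add: gen_s_apply)
      have "?s (w (int p)) > ?a \<longleftrightarrow> w (int p) > ?a" if "p \<in> {1..k}" for p
        using pos[OF that] 3 rows i by (auto simp: gen_s_apply)
      then have "?V ?a = ?V' (?s ?a)" unfolding sa by blast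
      then show ?thesis unfolding lam lam' sa using 3 by simp
    qed
  qed
qed

lemma adjacent_rows:
  assumes "int k < p" "p < q" "w q = w p + 1"
  shows "q = p + 1"
proof (rule ccontr)
  assume "q \<noteq> p + 1"
  then have "p + 1 < q" using assms by simp
  then have "w p < w (p + 1)" "w (p + 1) < w q"
    using assms(1) right_increasing[of p "p + 1"] right_increasing[of "p + 1" q] by simp_all
  then show False using assms by simp
qed

text \<open>The rows concerned sit at the positions of the values -(i+1) and i. At a descent one or
  both exist. At an ascent with such a row, the neighbouring value -i or i + 1 occupies the next row
  (\<open>equal_zeta\<close>, \<open>equal_u\<close>), or i = n stands in the last row and its
  successor n + 1 lies beyond the rows (\<open>last\<close>).\<close>

lemma left_descent_cases:
  fixes i :: nat
  defines "\<chi> \<equiv> row_chi k w" and "Lm \<equiv> row_lam k w" and "m \<equiv> n - k" and "w' \<equiv> gen_s i \<circ> w"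
  obtains (none) "ascent g i" "\<And>l. l < m \<Longrightarrow> \<bar>\<chi> l\<bar> \<noteq> int i"
  | (single) j where "\<not> ascent g i" "j < m" "\<bar>\<chi> j\<bar> = int i" "\<And>l. l < m \<Longrightarrow> \<bar>\<chi> l\<bar> = int i \<Longrightarrow> l = j"
      "\<And>l. l < m \<Longrightarrow> row_chi k w' l = (\<chi>(j := \<chi> j - 1)) l"
      "\<And>l. l < m \<Longrightarrow> row_lam k w' l = (Lm(j := Lm j - 1)) l"
  | (double) j j' where "\<not> ascent g i" "i \<ge> 1" "j < j'" "j' < m" "\<chi> j = int i" "\<chi> j' = - int i"
      "\<And>l. l < m \<Longrightarrow> \<bar>\<chi> l\<bar> = int i \<Longrightarrow> l = j \<or> l = j'"
      "\<And>l. l < m \<Longrightarrow> row_chi k w' l = (\<chi>(j := int i - 1, j' := - int i - 1)) l"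
      "\<And>l. l < m \<Longrightarrow> row_lam k w' l = (Lm(j := Lm j - 1)) l"
  | (equal_zeta) j where "ascent g i" "i \<ge> 1" "Suc j < m" "\<chi> j = int i" "\<chi> (Suc j) = int i - 1"
      "\<And>l. l < m \<Longrightarrow> \<bar>\<chi> l\<bar> = int i \<Longrightarrow> l = j"
      "Lm j = int i + 1 + int k" "Lm (Suc j) = int i + int k"
  | (equal_u) j where "ascent g i" "i \<ge> 1" "Suc j < m" "\<chi> j = - int i" "\<chi> (Suc j) = - int i - 1"
      "\<And>l. l < m \<Longrightarrow> \<bar>\<chi> l\<bar> = int i \<Longrightarrow> l = j" "Lm (Suc j) = Lm j"
  | (last) j where "ascent g i" "i \<ge> 1" "Suc j = m" "\<chi> j = - int i"
      "\<And>l. l < m \<Longrightarrow> \<bar>\<chi> l\<bar> = int i \<Longrightarrow> l = j" "Lm j = 0"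
proof -
  let ?P = "g (int i)" and ?Q = "g (int i + 1)"
  have chi_iff: "\<bar>\<chi> l\<bar> = int i \<longleftrightarrow> row_pos k l = - ?Q \<or> row_pos k l = ?P" for l
    unfolding \<chi>_def abs_row_chi w_eq_iff g_neg_Suc ..
  have wQ: "w (- ?Q) = - int i - 1" by (simp add: w_neg)
  have Qn: "- ?Q \<le> int n" if "- ?Q > 0"
  proof (rule ccontr)
    assume "\<not> ?thesis"
    then have "\<bar>- ?Q\<bar> > int n" by simp
    then have "w (- ?Q) = - ?Q" by (rule w_fixed)
    then show False using wQ that by simp
  qed
  have Qk: "- ?Q > int k" if "?Q < 0"
    using left_positive[of "- ?Q"] wQ that by (cases "- ?Q > int k") auto
  have Q0: "?Q \<noteq> 0" by (simp add: g_zero)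
  note row_lam_changed = descent_row_lam[of i, folded w'_def Lm_def]
    and row_chi_changed = descent_row_chi[of i, folded w'_def \<chi>_def]
  show thesis
  proof (cases "ascent g i")
    case desc: False
    then have PQ: "?P > ?Q" if "i \<ge> 1"
      using that W_infD(2)[OF gW] by (auto simp: ascent_def inj_eq not_less le_less)
    have in_: "i < n" by (rule descent_bound[OF desc])
    show thesis
    proof (cases "?Q < 0")
      case Q: True
      obtain j where j: "j < m" "- ?Q = row_pos k j"
        using ex_row[of "- ?Q"] Qk[OF Q] Qn Q unfolding m_def by auto
      have wj: "w (row_pos k j) = - int i - 1" using wQ j(2) by simp
      have chij: "\<chi> j = int i" using row_chi_eq(1)[OF wj] by (simp add: \<chi>_def)
      show thesis
      proof (cases "i \<ge> 1 \<and> ?P > int k")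
        case True
        then have i1: "i \<ge> 1" and Pk: "?P > int k" by auto
        have "?P \<le> int n" using g_bound[of "int i"] in_ by auto
        then obtain j' where j': "j' < m" "?P = row_pos k j'"
          using ex_row[of ?P] Pk unfolding m_def by auto
        have wj': "w (row_pos k j') = int i" using j'(2) by (metis w_g)
        have chij': "\<chi> j' = - int i" using row_chi_eq(2)[OF wj'] by (simp add: \<chi>_def)
        have "row_pos k j < row_pos k j'"
          using right_increasing_iff[OF row_pos_gt[of j] row_pos_gt[of j']] wj wj' by simp
        then have jj': "j < j'" by (simp add: row_pos_def)
        have only: "l = j \<or> l = j'" if "l < m" "\<bar>\<chi> l\<bar> = int i" for l
          using that unfolding chi_iff j(2) j'(2) by simp
        have lam: "row_lam k w' l = (Lm(j := Lm j - 1)) l" if "l < m" for l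
        proof -
          have "w (row_pos k l) = - int i - 1 \<longleftrightarrow> l = j"
            using j(2) by (auto simp: w_eq_iff g_neg_Suc)
          moreover have "\<not> 1 \<le> ?Q" using Q by simp
          ultimately show ?thesis unfolding row_lam_changed[OF desc] by simp
        qed
        have chi: "row_chi k w' l = (\<chi>(j := int i - 1, j' := - int i - 1)) l" if "l < m" for l
          unfolding row_chi_changed[OF desc] using only[OF that] chij chij' jj' by auto
        show thesis by (rule double[OF desc i1 jj' j'(1) chij chij' only chi lam])
      next
        case False
        have only: "l = j" if "l < m" "\<bar>\<chi> l\<bar> = int i" for l
        proof -
          have "row_pos k l \<noteq> ?P"
          proof
            assume "row_pos k l = ?P"
            then have "?P > int k" using row_pos_gt[of l] by simp
            moreover from this have "i \<noteq> 0" using g_zero[of 0] by (auto intro: ccontr)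
            ultimately show False using False by simp
          qed
          then show ?thesis using that unfolding chi_iff j(2) by simp
        qed
        have lam: "row_lam k w' l = (Lm(j := Lm j - 1)) l" if "l < m" for l
        proof -
          have "w (row_pos k l) = - int i - 1 \<longleftrightarrow> l = j"
            using j(2) by (auto simp: w_eq_iff g_neg_Suc)
          moreover have "\<not> 1 \<le> ?Q" using Q by simp
          ultimately show ?thesis unfolding row_lam_changed[OF desc] by simp
        qed
        have chi: "row_chi k w' l = (\<chi>(j := \<chi> j - 1)) l" if "l < m" for l
          proof (cases "l = j")
            case True
            then show ?thesis unfolding row_chi_changed[OF desc] by (simp add: chij)
          next
            case False
            then have "\<bar>\<chi> l\<bar> \<noteq> int i" using only[OF that] by blast
            then show ?thesis unfolding row_chi_changed[OF desc] using False by simp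
          qed
        show thesis by (rule single[OF desc j(1) _ only chi lam]) (simp_all add: chij)
      qed
    next
      case Q: False
      then have Qpos: "?Q > 0" using Q0 by simp
      then have i1: "i \<ge> 1" using desc by (cases "i = 0") (auto simp: ascent_def)
      note PQ = PQ[OF i1]
      have Qle: "?Q \<le> int k"
      proof (rule ccontr)
        assume "\<not> ?thesis"
        then have "w ?Q < w ?P" using PQ by (intro right_increasing) auto
        then show False by simp
      qed
      have Pk: "?P > int k"
      proof (rule ccontr)
        assume "\<not> ?thesis"
        then have "w ?Q < w ?P" using PQ Qpos by (intro left_increasing) auto
        then show False by simp
      qed
      have "?P \<le> int n" using g_bound[of "int i"] in_ by auto
      then obtain j where j: "j < m" "?P = row_pos k j"
        using ex_row[of ?P] Pk unfolding m_def by auto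
      have wj: "w (row_pos k j) = int i" using j(2) by (metis w_g)
      have chij: "\<chi> j = - int i" using row_chi_eq(2)[OF wj] by (simp add: \<chi>_def)
      have only: "l = j" if "l < m" "\<bar>\<chi> l\<bar> = int i" for l
        using that Qpos row_pos_gt[of l] unfolding chi_iff j(2) by auto
      have lam: "row_lam k w' l = (Lm(j := Lm j - 1)) l" if "l < m" for l
      proof -
        have "w (row_pos k l) \<noteq> - int i - 1"
          using Qpos row_pos_gt[of l] by (auto simp: w_eq_iff g_neg_Suc)
        moreover have "w (row_pos k l) = int i \<longleftrightarrow> l = j"
          using j(2) by (auto simp: w_eq_iff)
        moreover have "1 \<le> ?Q" using Qpos by simp
        ultimately show ?thesis unfolding row_lam_changed[OF desc] using Qle by simp
      qed
      have chi: "row_chi k w' l = (\<chi>(j := \<chi> j - 1)) l" if "l < m" for l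
        proof (cases "l = j")
            case True
            then show ?thesis unfolding row_chi_changed[OF desc] by (simp add: chij)
          next
            case False
            then have "\<bar>\<chi> l\<bar> \<noteq> int i" using only[OF that] by blast
            then show ?thesis unfolding row_chi_changed[OF desc] using False by simp
          qed
      show thesis by (rule single[OF desc j(1) _ only chi lam]) (simp_all add: chij)
    qed
  next
    case asc: True
    show thesis
    proof (cases "i = 0")
      case True
      then have "?Q > 0" "?P = 0" using asc g_zero[of 0] by (auto simp: ascent_def)
      then have "\<bar>\<chi> l\<bar> \<noteq> int i" if "l < m" for l
        unfolding chi_iff using row_pos_gt[of l] by auto
      then show thesis by (rule none[OF asc])
    next
      case False
      then have i1: "i \<ge> 1" and PQ: "?P < ?Q" using asc by (auto simp: ascent_def)
      consider "?Q < 0" | "?Q > 0" "?P > int k" "?P \<le> int n" | "?Q > 0" "\<not> (?P > int k \<and> ?P \<le> int n)"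
        using Q0 by linarith
      then show thesis
      proof cases
        case 1
        obtain j where j: "j < m" "- ?Q = row_pos k j"
          using ex_row[of "- ?Q"] Qk[OF 1] Qn 1 unfolding m_def by auto
        have wj: "w (row_pos k j) = - int i - 1" using wQ j(2) by simp
        have chij: "\<chi> j = int i" using row_chi_eq(1)[OF wj] by (simp add: \<chi>_def)
        have adj: "- ?P = - ?Q + 1"
          by (rule adjacent_rows) (use Qk[OF 1] PQ in \<open>simp_all add: w_neg\<close>)
        then have pos: "- ?P = row_pos k (Suc j)" using j(2) by (simp add: row_pos_def)
        have wj': "w (row_pos k (Suc j)) = - int i" unfolding pos[symmetric] by (simp add: w_neg)
        have "i < n"
        proof (rule ccontr)
          assume "\<not> i < n"
          then have "?Q = int i + 1" by (intro g_fixed) auto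
          then show False using 1 by simp
        qed
        then have "- ?P \<le> int n" using g_bound[of "int i"] by auto
        then have jm: "Suc j < m" unfolding pos by (simp add: row_pos_def m_def)
        have chij': "\<chi> (Suc j) = int i - 1" using row_chi_eq(1)[of "Suc j" "i - 1"] wj' i1 by (simp add: \<chi>_def of_nat_diff)
        have only: "l = j" if "l < m" "\<bar>\<chi> l\<bar> = int i" for l
          using that PQ 1 row_pos_gt[of l] unfolding chi_iff j(2) by auto
        have lam: "Lm j = int i + 1 + int k" "Lm (Suc j) = int i + int k"
          using row_lam_neg[of j] row_lam_neg[of "Suc j"] wj wj' i1 by (simp_all add: Lm_def)
        show thesis by (rule equal_zeta[OF asc i1 jm chij chij' only lam])
      next
        case 2
        then obtain j where j: "j < m" "?P = row_pos k j"
          using ex_row[of ?P] unfolding m_def by auto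
        have wj: "w (row_pos k j) = int i" using j(2) by (metis w_g)
        have chij: "\<chi> j = - int i" using row_chi_eq(2)[OF wj] by (simp add: \<chi>_def)
        have adj: "?Q = ?P + 1" by (rule adjacent_rows) (use 2 PQ in simp_all)
        then have pos: "?Q = row_pos k (Suc j)" using j(2) by (simp add: row_pos_def)
        have wj': "w (row_pos k (Suc j)) = int i + 1" unfolding pos[symmetric] by simp
        have only: "l = j" if "l < m" "\<bar>\<chi> l\<bar> = int i" for l
          using that 2 row_pos_gt[of l] unfolding chi_iff j(2) by auto
        show thesis
        proof (cases "Suc j < m")
          case True
          have chij': "\<chi> (Suc j) = - int i - 1" using row_chi_eq(2)[of "Suc j" "i + 1"] wj' by (simp add: \<chi>_def)
          have ne: "w (int p) \<noteq> int i + 1" if "p \<in> {1..k}" for p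
            using that 2 adj by (auto simp: w_eq_iff)
          have "{p \<in> {1..k}. w (int p) > int i + 1} = {p \<in> {1..k}. w (int p) > int i}"
            using ne by force
          then have lam: "Lm (Suc j) = Lm j"
            unfolding Lm_def using row_lam_pos[of j] row_lam_pos[of "Suc j"] wj wj' i1 by simp
          show thesis by (rule equal_u[OF asc i1 True chij chij' only lam])
        next
          case F: False
          then have jm: "Suc j = m" using j by simp
          \<comment> \<open>The value i + 1 follows i immediately, hence at position n + 1, where w
            is the identity; so i = n, and no v_p exceeds it.\<close>
          then have "row_pos k j = int n" using j(1) kn by (auto simp: row_pos_def m_def)
          then have "?Q = int n + 1" using pos by (simp add: row_pos_def)
          then have "int i = int n" using w_fixed[of "int n + 1"] w_g[of "int i + 1"] by simp
          moreover have "w (int p) \<le> int n" if "p \<in> {1..k}" for p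
            using w_bound[of "int p"] that kn by auto
          ultimately have "{p \<in> {1..k}. w (int p) > int i} = {}" by force
          then have "card {p \<in> {1..k}. w (int p) > int i} = 0" by (simp only: card.empty)
          then have lam: "Lm j = 0" unfolding Lm_def using row_lam_pos[of j] wj i1 by simp
          show thesis by (rule last[OF asc i1 jm chij only lam])
        qed
      next
        case 3
        have "\<bar>\<chi> l\<bar> \<noteq> int i" if "l < m" for l
          unfolding chi_iff using 3 row_pos_gt[of l] row_pos_le[of l] that by (auto simp: m_def)
        then show thesis by (rule none[OF asc])
      qed
    qed
  qed
qed

end

section \<open>The raised Pfaffian\<close>

definition decr :: "nat \<Rightarrow> (nat \<Rightarrow> int) \<Rightarrow> nat \<Rightarrow> int" where
  "decr j r = (\<lambda>l. r l + (if l = j then - 1 else 0))"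

lemma decr_eq: "decr j r = r(j := r j - 1)"
  by (auto simp: decr_def)

lemma raise_decr: "raise D (\<lambda>r. \<Phi> (decr j r)) r = raise D \<Phi> (decr j r)"
  unfolding decr_def by (rule raise_translate)

lemma Phi_theta_fixed:
  assumes "\<And>l. l < m \<Longrightarrow> \<bar>\<chi> l\<bar> \<noteq> int i"
  shows "s_t i (Phi m (\<lambda>l. theta k (\<chi> l)) r) = Phi m (\<lambda>l. theta k (\<chi> l)) r"
  unfolding Phi_hom[OF rhom_s_t]
proof (rule Phi_cong)
  show "(\<lambda>x. s_t i (theta k (\<chi> l) x)) = theta k (\<chi> l)" if "l < m" for l
    using theta_s_t_fixed[OF assms[OF that]] by (simp add: fun_eq_iff)
qed simp

lemma Phi_theta_single:
  assumes j: "j < m" "\<bar>\<chi> j\<bar> = int i" and only: "\<And>l. l < m \<Longrightarrow> \<bar>\<chi> l\<bar> = int i \<Longrightarrow> l = j"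
  shows "s_t i (Phi m (\<lambda>l. theta k (\<chi> l)) r) =
    Phi m (\<lambda>l. theta k (\<chi> l)) r - alpha i * Phi m (\<lambda>l. theta k ((\<chi>(j := \<chi> j - 1)) l)) (decr j r)"
proof -
  define c where "c l = (if l = j then (\<lambda>x. theta k (\<chi> j) x + (- alpha i) * theta k (\<chi> j - 1) (x - 1)) else theta k (\<chi> l))" for l
  have "s_t i (Phi m (\<lambda>l. theta k (\<chi> l)) r) = Phi m c r"
    unfolding Phi_hom[OF rhom_s_t]
  proof (rule Phi_cong)
    show "(\<lambda>x. s_t i (theta k (\<chi> l) x)) = c l" if "l < m" for l
    proof (cases "l = j")
      case True
      then show ?thesis using theta_s_t_diff[OF j(2), of k] by (simp add: c_def fun_eq_iff)
    next
      case False
      then have "\<bar>\<chi> l\<bar> \<noteq> int i" using only[OF that] by blast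
      then show ?thesis using False theta_s_t_fixed[of "\<chi> l" i k] by (simp add: c_def fun_eq_iff)
    qed
  qed simp
  also have "\<dots> = Phi m (c(j := theta k (\<chi> j))) r + (- alpha i) * Phi m (c(j := theta k (\<chi> j - 1))) (r(j := r j - 1))"
    using j(1) by (rule Phi_linear) (simp_all add: c_def)
  also have "c(j := theta k (\<chi> j)) = (\<lambda>l. theta k (\<chi> l))"
    by (auto simp: c_def fun_eq_iff)
  also have "c(j := theta k (\<chi> j - 1)) = (\<lambda>l. theta k ((\<chi>(j := \<chi> j - 1)) l))"
    by (auto simp: c_def fun_eq_iff)
  finally show ?thesis by (simp only: decr_eq mult_minus_left add_uminus_conv_diff)
qed

text \<open>Both rows are expanded in indices fixed by s_i, with coefficients -t_i and t_(i+1),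
  which s_i turns into -t_(i+1) and t_i. Their product is unchanged, so the term with both rows
  lowered cancels; the two terms with one lowered row each change by alpha_i.\<close>

lemma Phi_theta_double:
  fixes k m :: nat and \<chi> :: "nat \<Rightarrow> int"
  assumes i: "i \<ge> 1" and j: "j < m" "j' < m" "j \<noteq> j'" "\<chi> j = int i" "\<chi> j' = - int i"
    and only: "\<And>l. l < m \<Longrightarrow> \<bar>\<chi> l\<bar> = int i \<Longrightarrow> l = j \<or> l = j'"
  defines "\<Psi> \<equiv> Phi m (\<lambda>l. theta k ((\<chi>(j := int i - 1, j' := - int i - 1)) l))"
  shows "s_t i (Phi m (\<lambda>l. theta k (\<chi> l)) r) =
    Phi m (\<lambda>l. theta k (\<chi> l)) r - alpha i * (\<Psi> (decr j r) + \<Psi> (decr j' r))"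
proof -
  let ?A = "theta k (int i - 1)" and ?B = "theta k (- int i - 1)"
  define c where "c a b l = (if l = j then (\<lambda>x. ?A x + a * ?A (x - 1))
     else if l = j' then (\<lambda>x. ?B x + b * ?B (x - 1)) else theta k (\<chi> l))" for a b l
  have expand: "Phi m (c a b) r = \<Psi> r + b * \<Psi> (decr j' r) + a * (\<Psi> (decr j r) + b * \<Psi> (decr j' (decr j r)))" for a b
  proof -
    have e1: "Phi m (c a b) r = Phi m ((c a b)(j := ?A)) r + a * Phi m ((c a b)(j := ?A)) (r(j := r j - 1))"
      using j(1) by (rule Phi_linear) (simp_all add: c_def)
    have "Phi m ((c a b)(j := ?A)) q = \<Psi> q + b * \<Psi> (decr j' q)" for q
    proof -
      have "Phi m ((c a b)(j := ?A)) q = Phi m ((c a b)(j := ?A, j' := ?B)) q + b * Phi m ((c a b)(j := ?A, j' := ?B)) (q(j' := q j' - 1))"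
        using j(2) by (rule Phi_linear) (use j in \<open>simp_all add: c_def\<close>)
      moreover have "(c a b)(j := ?A, j' := ?B) = (\<lambda>l. theta k ((\<chi>(j := int i - 1, j' := - int i - 1)) l))"
        using j(3) by (auto simp: c_def fun_eq_iff)
      ultimately show ?thesis by (simp only: \<Psi>_def decr_eq)
    qed
    then show ?thesis using e1 by (simp only: decr_eq[symmetric])
  qed
  have ne: "\<bar>\<chi> l\<bar> \<noteq> int i" if "l < m" "l \<noteq> j" "l \<noteq> j'" for l
    using only[OF that(1)] that by blast
  have 1: "Phi m (\<lambda>l. theta k (\<chi> l)) r = Phi m (c (- tvar i) (tvar (Suc i))) r"
  proof (rule Phi_cong)
    show "theta k (\<chi> l) = c (- tvar i) (tvar (Suc i)) l" for l
      using j(3-5) theta_pos[OF i, of k] theta_nonpos[of k i] by (auto simp: c_def fun_eq_iff)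
  qed simp
  have 2: "s_t i (Phi m (\<lambda>l. theta k (\<chi> l)) r) = Phi m (c (- tvar (Suc i)) (tvar i)) r"
    unfolding Phi_hom[OF rhom_s_t]
  proof (rule Phi_cong)
    show "(\<lambda>x. s_t i (theta k (\<chi> l) x)) = c (- tvar (Suc i)) (tvar i) l" if "l < m" for l
      using j(3-5) s_t_theta_pos[OF i, of k] s_t_theta_nonpos[OF i, of k] theta_s_t_fixed[OF ne[OF that], of k]
      by (auto simp: c_def fun_eq_iff)
  qed simp
  have al: "alpha i = tvar (Suc i) - tvar i" using i by (simp add: alpha_def)
  show ?thesis unfolding 2 unfolding 1 expand al by (simp add: algebra_simps)
qed

definition Dset :: "nat \<Rightarrow> (nat \<Rightarrow> int) \<Rightarrow> (nat \<times> nat) set" where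
  "Dset m \<chi> = {(i, j). i < j \<and> j < m \<and> \<chi> i + \<chi> j < 0}"

lemma finite_Dset: "finite (Dset m \<chi>)"
  by (rule finite_subset[of _ "{..<m} \<times> {..<m}"]) (auto simp: Dset_def)

lemma Dset_less: "p \<in> Dset m \<chi> \<Longrightarrow> fst p < snd p"
  by (auto simp: Dset_def)

definition raised_pf :: "nat \<Rightarrow> nat \<Rightarrow> (nat \<Rightarrow> int) \<Rightarrow> (nat \<Rightarrow> int) \<Rightarrow> rinf" where
  "raised_pf k m \<chi> r = raise (Dset m \<chi>) (Phi m (\<lambda>l. theta k (\<chi> l))) r"

lemma raised_pf_cong:
  assumes "\<And>l. l < m \<Longrightarrow> \<chi> l = \<chi>' l" "\<And>l. l < m \<Longrightarrow> r l = r' l"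
  shows "raised_pf k m \<chi> r = raised_pf k m \<chi>' r'"
proof -
  have "Dset m \<chi> = Dset m \<chi>'" using assms(1) by (auto simp: Dset_def)
  then show ?thesis unfolding raised_pf_def
    by (simp only:) (rule raise_cong, rule Phi_cong, simp_all add: assms)
qed

lemma raised_pf_none:
  assumes "\<And>l. l < m \<Longrightarrow> \<bar>\<chi> l\<bar> \<noteq> int i"
  shows "s_t i (raised_pf k m \<chi> r) = raised_pf k m \<chi> r"
  unfolding raised_pf_def raise_hom[OF rhom_s_t] by (simp only: Phi_theta_fixed[OF assms])

text \<open>D does not change: a sum of \<open>\<chi> j\<close> with another entry is never 0, as
  this would give a second row with |chi| = i, so lowering \<open>\<chi> j\<close> by one crosses no
  sign.\<close>

lemma raised_pf_single:
  assumes j: "j < m" "\<bar>\<chi> j\<bar> = int i" and only: "\<And>l. l < m \<Longrightarrow> \<bar>\<chi> l\<bar> = int i \<Longrightarrow> l = j"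
  shows "s_t i (raised_pf k m \<chi> r) = raised_pf k m \<chi> r - alpha i * raised_pf k m (\<chi>(j := \<chi> j - 1)) (decr j r)"
proof -
  have "\<chi> j + \<chi> l \<noteq> 0" if "l < m" "l \<noteq> j" for l
    using only[OF that(1)] that(2) j(2) by fastforce
  note nz = this
  have "\<chi> a + \<chi> b < 0 \<longleftrightarrow> (\<chi>(j := \<chi> j - 1)) a + (\<chi>(j := \<chi> j - 1)) b < 0" if "a < b" "b < m" for a b
  proof (cases "a = j")
    case True
    then show ?thesis using nz[of b] that by auto
  next
    case False
    then show ?thesis using nz[of a] that by (cases "b = j") auto
  qed
  then have D: "Dset m (\<chi>(j := \<chi> j - 1)) = Dset m \<chi>" unfolding Dset_def by blast
  have step: "s_t i (Phi m (\<lambda>l. theta k (\<chi> l)) q) = Phi m (\<lambda>l. theta k (\<chi> l)) q -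
      alpha i * Phi m (\<lambda>l. theta k ((\<chi>(j := \<chi> j - 1)) l)) (decr j q)" for q
    using j only by (rule Phi_theta_single)
  show ?thesis unfolding raised_pf_def D raise_hom[OF rhom_s_t]
    unfolding step raise_diff raise_scale raise_decr ..
qed

text \<open>The sum of the two entries drops from 0 to -2, so exactly the pair (j, j') enters D. Its
  factor 1 + R, applied to the vector with row j lowered, adds the vector with row j' lowered: these
  are the two terms of \<open>Phi_theta_double\<close>.\<close>

lemma raised_pf_double:
  assumes i: "i \<ge> 1" and j: "j < j'" "j' < m" "\<chi> j = int i" "\<chi> j' = - int i"
    and only: "\<And>l. l < m \<Longrightarrow> \<bar>\<chi> l\<bar> = int i \<Longrightarrow> l = j \<or> l = j'"
  shows "s_t i (raised_pf k m \<chi> r) = raised_pf k m \<chi> r -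
    alpha i * raised_pf k m (\<chi>(j := int i - 1, j' := - int i - 1)) (decr j r)"
proof -
  let ?\<chi> = "\<chi>(j := int i - 1, j' := - int i - 1)"
  define \<Psi> where "\<Psi> = Phi m (\<lambda>l. theta k (?\<chi> l))"
  have jm: "j < m" "j \<noteq> j'" using j by auto
  have nz: "\<chi> a + \<chi> b \<noteq> 0" if "a < b" "b < m" "(a, b) \<noteq> (j, j')" "a = j \<or> a = j' \<or> b = j \<or> b = j'" for a b
  proof
    assume "\<chi> a + \<chi> b = 0"
    then have "\<bar>\<chi> a\<bar> = int i" "\<bar>\<chi> b\<bar> = int i" using that(4) j(3,4) by auto
    then have "a = j \<or> a = j'" "b = j \<or> b = j'" using only[of a] only[of b] that(1,2) by auto
    then show False using that(1,3) j(1) by auto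
  qed
  have "\<chi> a + \<chi> b < 0 \<longleftrightarrow> ?\<chi> a + ?\<chi> b < 0" if ab: "a < b" "b < m" "(a, b) \<noteq> (j, j')" for a b
  proof (cases "a = j \<or> a = j' \<or> b = j \<or> b = j'")
    case True
    then have "\<not> ((a = j \<or> a = j') \<and> (b = j \<or> b = j'))" using ab j(1) by auto
    then show ?thesis using True nz[OF ab True] j(3,4) jm(2) by auto
  qed simp
  note same = this
  have "(a, b) \<in> Dset m ?\<chi> \<longleftrightarrow> (a, b) = (j, j') \<or> (a, b) \<in> Dset m \<chi>" for a b
  proof (cases "(a, b) = (j, j')")
    case True
    then show ?thesis using j jm(2) by (simp add: Dset_def)
  next
    case False
    then show ?thesis using same[of a b] unfolding Dset_def by blast
  qed
  then have D: "Dset m ?\<chi> = insert (j, j') (Dset m \<chi>)" by auto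
  have notin: "(j, j') \<notin> Dset m \<chi>" using j by (simp add: Dset_def)
  have "raise (insert (j, j') (Dset m \<chi>)) \<Psi> (decr j r) =
    raise (Dset m \<chi>) (\<lambda>r. \<Psi> r + \<Psi> (\<lambda>l. r l + (if l = j then 1 else 0) - (if l = j' then 1 else 0))) (decr j r)"
    by (rule raise_insert[OF finite_Dset notin])
  also have "\<dots> = raise (Dset m \<chi>) (\<lambda>r. \<Psi> (decr j r) + \<Psi> (decr j' r)) r"
  proof -
    have "(\<lambda>l. decr j r l + (if l = j then 1 else 0) - (if l = j' then 1 else 0)) = decr j' r" for r
      by (auto simp: decr_def)
    then show ?thesis
      using raise_decr[of "Dset m \<chi>" "\<lambda>r. \<Psi> r + \<Psi> (\<lambda>l. r l + (if l = j then 1 else 0) - (if l = j' then 1 else 0))" j r]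
      by simp
  qed
  finally have raise: "raised_pf k m ?\<chi> (decr j r) = raise (Dset m \<chi>) (\<lambda>r. \<Psi> (decr j r) + \<Psi> (decr j' r)) r"
    unfolding raised_pf_def D \<Psi>_def .
  have step: "s_t i (Phi m (\<lambda>l. theta k (\<chi> l)) q) = Phi m (\<lambda>l. theta k (\<chi> l)) q -
      alpha i * (\<Psi> (decr j q) + \<Psi> (decr j' q))" for q
    unfolding \<Psi>_def using i jm(1) j(2) jm(2) j(3,4) only by (rule Phi_theta_double)
  show ?thesis unfolding raise
    unfolding raised_pf_def raise_hom[OF rhom_s_t] step raise_diff raise_scale ..
qed

section \<open>Vanishing of the shifted raised Pfaffians at ascents\<close>

lemma alt_conv_theta:
  assumes "l \<ge> 0" "n > 2 * (int k + l)"
  shows "alt_conv (theta k l) n = 0"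
proof -
  define N where "N = nat n"
  have n: "n = int N" using assms by (simp add: N_def)
  have "alt_conv (theta k l) n = (\<Sum>a\<in>{0..N}. (-1) ^ a * fps_nth (theta_ser k l) a * fps_nth (theta_ser k l) (N - a))"
    unfolding alt_conv_def
    by (rule sum.reindex_bij_witness[of _ int nat])
      (auto simp: n theta_def alt_sign_power nat_diff_distrib')
  also have "\<dots> = fps_nth (theta_ser k l * fps_alt (theta_ser k l)) N"
    by (subst mult.commute) (simp add: fps_mult_nth)
  also have "\<dots> = 0"
    using theta_ser_alt[OF assms(1), of k] assms by (simp add: fps_deg_le_def N_def)
  finally show ?thesis .
qed

lemma swap_pairs_Dset:
  assumes eq: "\<chi> j = \<chi> (Suc j)" and j: "Suc j < m"
  shows "swap_pairs j ` (Dset m \<chi> - {(j, Suc j)}) = Dset m \<chi> - {(j, Suc j)}"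
proof -
  let ?t = "transpose j (Suc j)" and ?D = "Dset m \<chi> - {(j, Suc j)}"
  have chi: "\<chi> (?t l) = \<chi> l" for l using eq by (auto simp: transpose_def)
  have sub: "swap_pairs j ` ?D \<subseteq> ?D"
  proof
    fix p assume "p \<in> swap_pairs j ` ?D"
    then obtain q where q: "p = swap_pairs j q" "q \<in> ?D" by blast
    obtain a b where "q = (a, b)" by (cases q)
    with q have ab: "p = (?t a, ?t b)" "(a, b) \<in> Dset m \<chi>" "(a, b) \<noteq> (j, Suc j)"
      by (simp_all add: swap_pairs_def)
    then have "a < b" "b < m" "\<chi> a + \<chi> b < 0" by (auto simp: Dset_def)
    moreover have "?t a < ?t b" using \<open>a < b\<close> ab(3) by (auto simp: transpose_def)
    moreover have "?t b < m" using \<open>b < m\<close> j by (auto simp: transpose_def)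
    moreover have "(?t a, ?t b) \<noteq> (j, Suc j)"
    proof
      assume "(?t a, ?t b) = (j, Suc j)"
      then have "a = Suc j" "b = j" by (auto simp: transpose_def split: if_splits)
      then show False using \<open>a < b\<close> by simp
    qed
    ultimately show "p \<in> ?D" by (simp add: ab(1) Dset_def chi)
  qed
  then have "swap_pairs j ` swap_pairs j ` ?D \<subseteq> swap_pairs j ` ?D" by (rule image_mono)
  then have "?D \<subseteq> swap_pairs j ` ?D" by (simp add: image_image)
  with sub show ?thesis by blast
qed

text \<open>All rows up to j + 1 have chi \<ge> 0, so no pair of D ends in j or j + 1, and raising
  can only increase the two indices. Their sum exceeds 2 (k + chi), the degree of theta(u)
  theta(-u), so the Pfaffian is antisymmetric in the two rows.\<close>

lemma raised_pf_equal_positive: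
  assumes j: "Suc j < m" "\<chi> (Suc j) = \<chi> j" "\<chi> j \<ge> 0" "r (Suc j) = r j" "r j > int k + \<chi> j"
    and dec: "\<And>l. l < j \<Longrightarrow> \<chi> l \<ge> 0"
  shows "raised_pf k m \<chi> r = 0"
  unfolding raised_pf_def
proof (rule raise_antisymmetric[of j])
  let ?t = "transpose j (Suc j)" and ?\<Phi> = "Phi m (\<lambda>l. theta k (\<chi> l))"
  have "(j, Suc j) \<notin> Dset m \<chi>" using j by (simp add: Dset_def)
  then show "swap_pairs j ` Dset m \<chi> = Dset m \<chi>"
    using swap_pairs_Dset[of \<chi> j m] j by simp
  fix I assume I: "I \<subseteq> Dset m \<chi>"
  have nonneg: "shift I l \<ge> 0" if "l = j \<or> l = Suc j" for l
  proof -
    have "\<chi> a \<ge> 0" if "a \<le> j" for a using dec[of a] j(3) that by (cases "a = j") auto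
    note nn = this
    have "False" if p: "p \<in> I" "snd p = l" for p
    proof -
      have "p \<in> Dset m \<chi>" using p(1) I by blast
      then have "fst p < l" "\<chi> (fst p) + \<chi> l < 0" using p(2) by (auto simp: Dset_def)
      moreover have "\<chi> l = \<chi> j" using \<open>l = j \<or> l = Suc j\<close> j(2) by auto
      moreover have "fst p \<le> j" using \<open>fst p < l\<close> \<open>l = j \<or> l = Suc j\<close> by auto
      ultimately show False using nn[of "fst p"] j(3) by linarith
    qed
    then have "{p \<in> I. snd p = l} = {}" by blast
    then show ?thesis by (simp add: shift_def del: Collect_empty_eq)
  qed
  define \<rho> where "\<rho> = (\<lambda>l. r l + shift I l)"
  have rt: "r (?t l) = r l" for l using j(4) by (auto simp: transpose_def)
  have swap: "(\<lambda>l. r l + shift I (?t l)) = (\<lambda>l. \<rho> (?t l))" by (simp add: \<rho>_def rt)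
  have "\<rho> j + \<rho> (Suc j) > 2 * (int k + \<chi> j)"
    using nonneg[of j] nonneg[of "Suc j"] j(4,5) by (simp add: \<rho>_def)
  then have "pf_entry (theta k (\<chi> j), \<rho> j) (theta k (\<chi> j), \<rho> (Suc j)) + pf_entry (theta k (\<chi> j), \<rho> (Suc j)) (theta k (\<chi> j), \<rho> j) = 0"
    by (subst pf_entry_symmetrized) (simp_all add: alt_conv_theta j(3))
  then show "?\<Phi> (\<lambda>l. r l + shift I l) + ?\<Phi> (\<lambda>l. r l + shift I (?t l)) = 0"
    unfolding swap \<rho>_def[symmetric] using Phi_swap[OF j(1), of "\<lambda>l. theta k (\<chi> l)" \<rho>] j(2) by simp
qed

text \<open>Here (j, j + 1) lies in D. Its operator R sends the indices (r, r + 1) to (r + 1, r),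
  hence acts like the exchange of the two rows. It keeps the sum of the indices and flips the parity
  of the first, so the antisymmetry defects of the two terms of 1 + R are opposite.\<close>

lemma raised_pf_equal_negative:
  assumes j: "Suc j < m" "\<chi> (Suc j) = \<chi> j" "\<chi> j < 0" "r (Suc j) = r j + 1"
  shows "raised_pf k m \<chi> r = 0"
proof -
  let ?t = "transpose j (Suc j)" and ?c = "\<lambda>l. theta k (\<chi> l)"
  let ?\<Phi> = "Phi m ?c"
  let ?e = "\<lambda>r l. r l + (if l = j then 1 else 0) - (if l = Suc j then 1 else 0) :: int"
  define D where "D = Dset m \<chi> - {(j, Suc j)}"
  have "(j, Suc j) \<in> Dset m \<chi>" using j by (simp add: Dset_def)
  then have D: "Dset m \<chi> = insert (j, Suc j) D" "(j, Suc j) \<notin> D" "finite D"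
    using finite_Dset by (auto simp: D_def)
  have "raise D (\<lambda>r. ?\<Phi> r + ?\<Phi> (?e r)) r = 0"
  proof (rule raise_antisymmetric[of j])
    show "swap_pairs j ` D = D" unfolding D_def using j by (intro swap_pairs_Dset) auto
    fix I
    define \<rho> where "\<rho> = (\<lambda>l. r l + shift I l)"
    define \<rho>' where "\<rho>' = (\<lambda>l. r l + shift I (?t l))"
    have s1: "?e \<rho>' = (\<lambda>l. \<rho> (?t l))" using j(4) by (auto simp: \<rho>_def \<rho>'_def transpose_def fun_eq_iff)
    have s2: "\<rho>' = (\<lambda>l. ?e \<rho> (?t l))" using j(4) by (auto simp: \<rho>_def \<rho>'_def transpose_def fun_eq_iff)
    let ?R = "\<lambda>\<rho>. bpf (\<lambda>i j. pf_entry (?c i, \<rho> i) (?c j, \<rho> j)) (\<lambda>i. ?c i (\<rho> i)) ([0..<j] @ [Suc (Suc j)..<m])"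
    have R: "?R (?e \<rho>) = ?R \<rho>" by (rule bpf_cong) auto
    have pf: "?\<Phi> q + ?\<Phi> (\<lambda>l. q (?t l)) = 2 * (alt_sign (q j) * alt_conv (?c j) (q j + q (Suc j))) * ?R q" for q
      using Phi_swap[OF j(1), of ?c q] pf_entry_symmetrized[of "?c j" "q j" "q (Suc j)"] j(2) by simp
    note p1 = pf[of \<rho>] and p2 = pf[of "?e \<rho>"]
    have sgn: "alt_sign (?e \<rho> j) = - (alt_sign (\<rho> j) :: rinf)" by (simp add: alt_sign_def)
    have sm: "?e \<rho> j + ?e \<rho> (Suc j) = \<rho> j + \<rho> (Suc j)" by simp
    have "(?\<Phi> \<rho> + ?\<Phi> (\<lambda>l. \<rho> (?t l))) + (?\<Phi> (?e \<rho>) + ?\<Phi> (\<lambda>l. ?e \<rho> (?t l))) = 0"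
      unfolding p1 p2 sgn sm R by simp
    then have "?\<Phi> \<rho> + ?\<Phi> (?e \<rho>) + (?\<Phi> \<rho>' + ?\<Phi> (?e \<rho>')) = 0"
      unfolding s1 s2[symmetric] by (simp add: add_ac)
    then show "?\<Phi> (\<lambda>l. r l + shift I l) + ?\<Phi> (?e (\<lambda>l. r l + shift I l)) +
      (?\<Phi> (\<lambda>l. r l + shift I (?t l)) + ?\<Phi> (?e (\<lambda>l. r l + shift I (?t l)))) = 0"
      by (simp only: \<rho>_def \<rho>'_def)
  qed
  then show ?thesis unfolding raised_pf_def D(1) raise_insert[OF D(3,2)] .
qed

lemma raised_pf_last_negative:
  assumes "r m < 0"
  shows "raised_pf k (Suc m) \<chi> r = 0"
  unfolding raised_pf_def
proof (rule raise_zero)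
  fix I assume I: "I \<subseteq> Dset (Suc m) \<chi>"
  have "shift I m \<le> 0" by (rule shift_last(1)[OF finite_Dset _ I]) (auto simp: Dset_def)
  then show "Phi (Suc m) (\<lambda>l. theta k (\<chi> l)) (\<lambda>l. r l + shift I l) = 0"
    using assms by (intro Phi_last_zero) auto
qed

text \<open>Raising operators never lower the first index, so every entry of the first row stays
  beyond the degree bound for localized theta series.\<close>

lemma ev_raised_pf:
  assumes "m > 0" "\<chi> 0 \<ge> - int k" "r 0 > int k + \<chi> 0"
  shows "ev (raised_pf k m \<chi> r) = 0"
  unfolding raised_pf_def raise_hom[OF rhom_ev]
proof (rule raise_zero)
  fix I assume I: "I \<subseteq> Dset m \<chi>"
  have "shift I 0 \<ge> 0" by (rule shift_first_nonneg[OF Dset_less I])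
  then show "ev (Phi m (\<lambda>l. theta k (\<chi> l)) (\<lambda>l. r l + shift I l)) = 0"
    unfolding Phi_hom[OF rhom_ev] using assms by (intro Phi_first_zero ev_theta_vanish) auto
qed

lemma raise_trailing_zeros:
  assumes "\<And>p. p \<in> D \<Longrightarrow> fst p < snd p \<and> snd p < m + d" "finite D"
    and "\<And>l. c l 0 = 1" "\<And>l x. x < 0 \<Longrightarrow> c l x = 0" "\<And>l. m \<le> l \<Longrightarrow> l < m + d \<Longrightarrow> r l = 0"
  shows "raise D (Phi (m + d) c) r = raise {p \<in> D. snd p < m} (Phi m c) r"
  using assms
proof (induction d arbitrary: D)
  case 0
  then have "{p \<in> D. snd p < m} = D" by auto
  then show ?case by simp
next
  case (Suc d)
  have "raise D (Phi (Suc (m + d)) c) r = raise {p \<in> D. snd p < m + d} (Phi (m + d) c) r"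
    by (rule raise_last_unit) (use Suc.prems in \<open>auto simp: less_Suc_eq_le\<close>)
  also have "\<dots> = raise {p \<in> {p \<in> D. snd p < m + d}. snd p < m} (Phi m c) r"
    by (rule Suc.IH) (use Suc.prems in auto)
  also have "{p \<in> {p \<in> D. snd p < m + d}. snd p < m} = {p \<in> D. snd p < m}" by auto
  finally show ?case by simp
qed

text \<open>If every pair of D ends in a zero row, dropping these rows leaves no operator. The same
  reduction with the empty set of pairs turns the full Pfaffian into the Pfaffian of the first s
  rows, so the two agree.\<close>

lemma raised_pf_trailing_zeros:
  assumes "s \<le> m" "\<And>l. s \<le> l \<Longrightarrow> l < m \<Longrightarrow> r l = 0" "\<And>i j. i < j \<Longrightarrow> j < s \<Longrightarrow> \<chi> i + \<chi> j \<ge> 0"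
  shows "raised_pf k m \<chi> r = Phi m (\<lambda>l. theta k (\<chi> l)) r"
proof -
  have m: "m = s + (m - s)" using assms(1) by simp
  have e: "{p \<in> Dset m \<chi>. snd p < s} = {}" using assms(3) by (fastforce simp: Dset_def)
  have "raise D (Phi m (\<lambda>l. theta k (\<chi> l))) r = raise {p \<in> D. snd p < s} (Phi s (\<lambda>l. theta k (\<chi> l))) r"
    if "D \<subseteq> Dset m \<chi>" for D
    by (subst m, rule raise_trailing_zeros)
      (use that assms in \<open>auto simp: Dset_def intro: finite_subset[OF that finite_Dset]\<close>)
  from this[OF order_refl] this[of "{}"] show ?thesis by (simp add: raised_pf_def e)
qed

section \<open>Every \<open>k\<close>-strict partition is a shape\<close>

lemma sorted_wrt_less_card_greater:
  fixes xs :: "nat list"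
  assumes "sorted_wrt (<) xs" "p < length xs"
  shows "card {x \<in> set xs. x > xs ! p} = length xs - Suc p"
proof -
  have lt: "xs ! i < xs ! j \<longleftrightarrow> i < j" if "i < length xs" "j < length xs" for i j
    using that assms(1) by (metis linorder_neqE_nat order_less_asym sorted_wrt_nth_less nat_neq_iff)
  have "{x \<in> set xs. x > xs ! p} = (!) xs ` {Suc p..<length xs}"
    using lt[OF assms(2)] by (auto simp: in_set_conv_nth image_iff Suc_le_eq)
  moreover have "inj_on ((!) xs) {Suc p..<length xs}"
    using lt by (intro inj_onI) (metis atLeastLessThan_iff nat_neq_iff less_irrefl)
  ultimately show ?thesis by (simp add: card_image)
qed

definition one_line :: "int list \<Rightarrow> int \<Rightarrow> int" where
  "one_line L x = (if 1 \<le> x \<and> x \<le> int (length L) then L ! nat (x - 1)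
     else if 1 \<le> - x \<and> - x \<le> int (length L) then - (L ! nat (- x - 1)) else x)"

lemma one_line_neg: "one_line L (- x) = - one_line L x"
  by (auto simp: one_line_def)

lemma one_line_beyond: "x > int (length L) \<Longrightarrow> one_line L x = x"
  by (auto simp: one_line_def)

lemma one_line_nth: "i < length L \<Longrightarrow> one_line L (int i + 1) = L ! i"
  by (simp add: one_line_def)

lemma one_line_W_fin:
  assumes d: "distinct (map abs L)" and s: "abs ` set L = {1..int (length L)}"
  shows "one_line L \<in> W_fin (length L)"
proof -
  let ?n = "int (length L)" and ?w = "one_line L"
  have cases: "x \<in> {1..?n} \<or> - x \<in> {1..?n} \<or> x = 0 \<or> \<bar>x\<bar> > ?n" for x by auto
  have inside: "\<bar>?w x\<bar> \<in> {1..?n}" if x: "x \<in> {1..?n} \<or> - x \<in> {1..?n}" for x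
  proof -
    have "\<exists>i<length L. \<bar>?w x\<bar> = \<bar>L ! i\<bar>"
      using x by (elim disjE) (force simp: one_line_def intro: exI[of _ "nat (x - 1)"] exI[of _ "nat (- x - 1)"])+
    then show ?thesis using s by (metis image_eqI nth_mem)
  qed
  have fixed: "?w x = x" if "\<not> (x \<in> {1..?n} \<or> - x \<in> {1..?n})" for x
    using that by (auto simp: one_line_def)
  have abs_inj: "x = y" if "x \<in> {1..?n}" "y \<in> {1..?n}" "\<bar>?w x\<bar> = \<bar>?w y\<bar>" for x y
  proof -
    have "map abs L ! nat (x - 1) = map abs L ! nat (y - 1)"
      using that by (simp add: one_line_def nat_less_iff)
    then have "nat (x - 1) = nat (y - 1)"
      using d that by (subst (asm) nth_eq_iff_index_eq) (auto simp: nat_less_iff)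
    then have "int (nat (x - 1)) = int (nat (y - 1))" by simp
    then show ?thesis using that by simp
  qed
  have inj: "inj ?w"
  proof (rule injI)
    fix x y assume eq: "?w x = ?w y"
    let ?in = "\<lambda>x. x \<in> {1..?n} \<or> - x \<in> {1..?n}"
    show "x = y"
    proof (cases "?in x"; cases "?in y")
      assume x: "?in x" and y: "?in y"
      have abs_w: "\<bar>?w \<bar>z\<bar>\<bar> = \<bar>?w z\<bar>" for z by (cases "z \<ge> 0") (simp_all add: one_line_neg)
      have "\<bar>?w \<bar>x\<bar>\<bar> = \<bar>?w \<bar>y\<bar>\<bar>" unfolding abs_w eq ..
      then have "\<bar>x\<bar> = \<bar>y\<bar>" by (rule abs_inj[rotated 2]) (use x y in auto)
      then consider "x = y" | "x = - y" by (auto simp: abs_eq_iff)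
      then show "x = y"
      proof cases
        case 2
        then have "?w y = 0" using eq one_line_neg[of L y] by simp
        then show ?thesis using inside[OF y] by simp
      qed
    next
      assume x: "?in x" and y: "\<not> ?in y"
      have "\<bar>y\<bar> \<in> {1..?n}" using inside[OF x] unfolding eq fixed[OF y] .
      then have False using y by (cases "y \<ge> 0") simp_all
      then show "x = y" ..
    next
      assume x: "\<not> ?in x" and y: "?in y"
      have "\<bar>x\<bar> \<in> {1..?n}" using inside[OF y] unfolding eq[symmetric] fixed[OF x] .
      then have False using x by (cases "x \<ge> 0") simp_all
      then show "x = y" ..
    next
      assume x: "\<not> ?in x" and y: "\<not> ?in y"
      show "x = y" using eq unfolding fixed[OF x] fixed[OF y] .
    qed
  qed
  have map: "?w ` {- ?n..?n} \<subseteq> {- ?n..?n}"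
  proof
    fix y assume "y \<in> ?w ` {- ?n..?n}"
    then obtain x where x: "y = ?w x" "- ?n \<le> x" "x \<le> ?n" by auto
    show "y \<in> {- ?n..?n}"
    proof (cases "x \<in> {1..?n} \<or> - x \<in> {1..?n}")
      case True
      then show ?thesis using inside[OF True] x by auto
    next
      case False
      then show ?thesis using fixed[OF False] x by auto
    qed
  qed
  have surj_in: "?w ` {- ?n..?n} = {- ?n..?n}"
    by (rule endo_inj_surj[OF _ map]) (auto intro: inj_on_subset[OF inj])
  have "surj ?w"
  proof (rule surjI[of _ "\<lambda>y. if y \<in> {- ?n..?n} then inv_into {- ?n..?n} ?w y else y"])
    fix y show "?w (if y \<in> {- ?n..?n} then inv_into {- ?n..?n} ?w y else y) = y"
      using surj_in fixed[of y] by (auto intro: f_inv_into_f)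
  qed
  have "?w \<in> W_inf"
  proof (rule W_infI)
    show "bij ?w" using inj \<open>surj ?w\<close> by (rule bijI)
    show "?w (- a) = - ?w a" for a by (rule one_line_neg)
    have "{i. ?w i \<noteq> i} \<subseteq> {- ?n..?n}" using fixed by force
    then show "finite {i. ?w i \<noteq> i}" by (rule finite_subset) simp
  qed
  then show ?thesis using one_line_beyond by (auto simp: W_fin_def)
qed

lemma ex_split:
  fixes R :: "nat set" and \<mu> :: "nat list"
  assumes R: "finite R" "card R = k + length \<mu>" and \<mu>: "sorted_wrt (\<ge>) \<mu>" "\<forall>x\<in>set \<mu>. x \<le> k"
  obtains us vs where "sorted_wrt (<) us" "sorted_wrt (<) vs" "set us \<union> set vs = R" "set us \<inter> set vs = {}"
    "length us = length \<mu>" "length vs = k" "\<And>j. j < length \<mu> \<Longrightarrow> card {v \<in> set vs. v > us ! j} = \<mu> ! j"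
proof -
  define q where "q = length \<mu>"
  define rs where "rs = sorted_list_of_set R"
  have rs: "sorted_wrt (<) rs" "set rs = R" "length rs = k + q"
    using R by (simp_all add: rs_def q_def strict_sorted_list_of_set)
  \<comment> \<open>The place of u_j in the increasing list of R: below it lie j of the u and, since
    \<open>\<mu> ! j\<close> of the k elements v shall be larger, k - \<open>\<mu> ! j\<close> of
    the v.\<close>
  define pos where "pos j = k - \<mu> ! j + j" for j
  have mu_le: "\<mu> ! j \<le> k" if "j < q" for j using \<mu>(2) that by (simp add: q_def)
  have mu_dec: "\<mu> ! j \<le> \<mu> ! i" if "i < j" "j < q" for i j
    using \<mu>(1) that by (auto simp: q_def sorted_wrt_iff_nth_less)
  have pos_mono: "pos i < pos j" if "i < j" "j < q" for i j
    using mu_dec[OF that] that(1) by (simp add: pos_def)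
  have pos_lt: "pos j < length rs" if "j < q" for j
    using that by (simp add: pos_def rs)
  have nth_less: "rs ! i < rs ! j" if "i < j" "j < length rs" for i j
    using rs(1) that by (simp add: sorted_wrt_iff_nth_less)
  define us where "us = map (\<lambda>j. rs ! pos j) [0..<q]"
  define vs where "vs = sorted_list_of_set (R - set us)"
  have us: "sorted_wrt (<) us" "length us = q"
    by (auto simp: us_def sorted_wrt_iff_nth_less intro!: nth_less pos_mono pos_lt)
  have usR: "set us \<subseteq> R" using pos_lt by (auto simp: us_def rs(2)[symmetric])
  have dus: "distinct us" using us(1) strict_sorted_iff by blast
  have cus: "card (set us) = q" using dus us(2) by (simp add: distinct_card)
  have vs: "sorted_wrt (<) vs" "set vs = R - set us"
    using R by (simp_all add: vs_def strict_sorted_list_of_set)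
  have lvs: "length vs = k"
    using R cus usR by (simp add: vs_def card_Diff_subset q_def)
  have "card {v \<in> set vs. v > us ! j} = \<mu> ! j" if j: "j < q" for j
  proof -
    have uj: "us ! j = rs ! pos j" using j by (simp add: us_def)
    have 1: "card {x \<in> R. x > us ! j} = k + q - Suc (pos j)"
      using sorted_wrt_less_card_greater[OF rs(1) pos_lt[OF j]] by (simp add: uj rs)
    have 2: "card {x \<in> set us. x > us ! j} = q - Suc j"
      using sorted_wrt_less_card_greater[OF us(1), of j] j by (simp add: us)
    have "{x \<in> R. x > us ! j} = {v \<in> set vs. v > us ! j} \<union> {x \<in> set us. x > us ! j}"
      using usR by (auto simp: vs(2))
    moreover have "{v \<in> set vs. v > us ! j} \<inter> {x \<in> set us. x > us ! j} = {}"
      by (auto simp: vs(2))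
    ultimately have "card {x \<in> R. x > us ! j} = card {v \<in> set vs. v > us ! j} + card {x \<in> set us. x > us ! j}"
      by (simp add: card_Un_disjoint)
    then show ?thesis using 1 2 j mu_le[OF j] by (simp add: pos_def)
  qed
  then show ?thesis
    using that[OF us(1) vs(1)] us(2) lvs usR vs(2) by (auto simp: q_def)
qed

lemma map_upt_nth: "j < m \<Longrightarrow> map f [1..<m + 1] ! j = f (1 + j)"
  by (subst nth_map) (simp_all add: nth_upt del: upt_Suc)

lemma shape_nth:
  assumes "j < n - k"
  shows "shape k n w ! j = (if w (int (k + 1 + j)) < 0 then nat (- w (int (k + 1 + j))) + k
    else card {p \<in> {1..k}. w (int p) > w (int (k + 1 + j))})"
  unfolding shape_def map_upt_nth[OF assms] by (simp only: Let_def add.assoc)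

lemma length_shape: "length (shape k n w) = n - k"
  by (simp add: shape_def del: upt_Suc)

text \<open>Parts above k give zeta_i = lambda_i - k, distinct by k-strictness and at most n by the
  rectangle. The remaining numbers in 1..n are divided between the u_j and the v_p by
  \<open>ex_split\<close>, as the parts of size at most k demand.\<close>

lemma shape_surj:
  assumes kn: "k \<le> n" and lam: "lam \<in> P_set k n"
  shows "\<exists>w\<in>W_k k n. shape k n w = lam"
proof -
  define m where "m = n - k"
  have len: "length lam = m" and strict: "k_strict_partition k lam" and diag: "diagram lam \<subseteq> rectangle (n - k) (n + k)"
    using lam by (auto simp: P_set_def m_def)
  have dec: "sorted_wrt (\<ge>) lam" and dist: "distinct (filter (\<lambda>p. p > k) lam)"
    using strict by (auto simp: k_strict_partition_def)
  have le: "x \<le> n + k" if "x \<in> set lam" for x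
  proof (cases "x = 0")
    case False
    obtain i where i: "i < length lam" "x = lam ! i" using \<open>x \<in> set lam\<close> by (auto simp: in_set_conv_nth)
    then have "(Suc i, x) \<in> diagram lam" using False by (auto simp: diagram_def)
    then show ?thesis using diag by (auto simp: rectangle_def)
  qed simp
  define big where "big = takeWhile (\<lambda>p. p > k) lam"
  define \<mu> where "\<mu> = dropWhile (\<lambda>p. p > k) lam"
  have split: "lam = big @ \<mu>" by (simp add: big_def \<mu>_def)
  have big: "p > k" if "p \<in> set big" for p
    using that unfolding big_def by (rule set_takeWhileD[THEN conjunct2])
  have dec\<mu>: "sorted_wrt (\<ge>) \<mu>" and decbig: "sorted_wrt (\<ge>) big"
    using dec unfolding split sorted_wrt_append by simp_all
  have \<mu>: "p \<le> k" if p: "p \<in> set \<mu>" for p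
  proof -
    have ne: "\<mu> \<noteq> []" using p by auto
    then have "hd \<mu> \<le> k" unfolding \<mu>_def by (metis hd_dropWhile not_less)
    moreover have "p \<le> hd \<mu>" using dec\<mu> ne p by (cases \<mu>) auto
    ultimately show ?thesis by simp
  qed
  have "filter (\<lambda>p. p > k) lam = big @ filter (\<lambda>p. p > k) \<mu>"
    unfolding split filter_append using big by (simp add: filter_id_conv)
  then have dbig: "distinct big" using dist by simp
  define zs where "zs = map (\<lambda>p. p - k) big"
  define s where "s = length zs"
  have zs_lt: "zs ! j < zs ! i" if "i < j" "j < s" for i j
  proof -
    have l: "i < length big" "j < length big" using that by (simp_all add: s_def zs_def)
    have "big ! j \<le> big ! i" using decbig that(1) l by (simp add: sorted_wrt_iff_nth_less)
    moreover have "big ! j \<noteq> big ! i" using dbig l that(1) by (simp add: nth_eq_iff_index_eq)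
    moreover have "big ! j > k" using big l by simp
    ultimately show ?thesis using l by (simp add: zs_def)
  qed
  have zs_range: "set zs \<subseteq> {1..n}"
  proof
    fix z assume "z \<in> set zs"
    then obtain p where p: "p \<in> set big" "z = p - k" by (auto simp: zs_def)
    have "p \<le> n + k" by (rule le) (simp add: split p(1))
    then show "z \<in> {1..n}" using big[OF p(1)] p(2) by auto
  qed
  have dzs: "distinct zs"
    unfolding distinct_conv_nth s_def[symmetric] using zs_lt by (metis nat_neq_iff)
  have czs: "card (set zs) = s" using dzs by (simp add: distinct_card s_def)
  have lens: "s + length \<mu> = m" using len split by (simp add: s_def zs_def)
  define R where "R = {1..n} - set zs"
  have "card R = k + length \<mu>"
    using zs_range czs lens kn by (simp add: R_def card_Diff_subset m_def)
  then obtain us vs where us: "sorted_wrt (<) us" and vs: "sorted_wrt (<) vs" and uv: "set us \<union> set vs = R" "set us \<inter> set vs = {}"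
    and l: "length us = length \<mu>" "length vs = k"
    and card: "\<And>j. j < length \<mu> \<Longrightarrow> card {v \<in> set vs. v > us ! j} = \<mu> ! j"
    using ex_split[of R k \<mu>] dec\<mu> \<mu> by (auto simp: R_def)
  define tl where "tl = map (\<lambda>z. - int z) zs @ map int us"
  define L where "L = map int vs @ tl"
  have lt: "length tl = m" using lens l by (simp add: tl_def s_def)
  have lL: "length L = n" using lt l kn by (simp add: L_def m_def)
  have rng: "set us \<subseteq> {1..n}" "set vs \<subseteq> {1..n}" using uv(1) by (auto simp: R_def)
  have absL: "map abs L = map int (vs @ zs @ us)" by (simp add: L_def tl_def)
  have un: "set vs \<union> set zs \<union> set us = {1..n}" using uv(1) zs_range by (auto simp: R_def)
  have "distinct (vs @ zs @ us)"
    using us vs dzs uv zs_range by (auto simp: strict_sorted_iff R_def)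
  then have dL: "distinct (map abs L)" unfolding absL distinct_map by (intro conjI) (auto intro: inj_onI)
  have "abs ` set L = int ` (set vs \<union> set zs \<union> set us)"
    using arg_cong[OF absL, of set] by (simp add: Un_assoc image_Un)
  then have sL: "abs ` set L = {1..int (length L)}"
    unfolding un lL by (simp add: image_int_atLeastAtMost)
  define w where "w = one_line L"
  have wfin: "w \<in> W_fin n" using one_line_W_fin[OF dL sL] by (simp add: w_def lL)
  have w_v: "w (int i + 1) = int (vs ! i)" if "i < k" for i
    using that one_line_nth[of i L] lL kn l by (simp add: w_def L_def nth_append)
  have w_t: "w (int (k + 1 + j)) = tl ! j" if "j < m" for j
    using that one_line_nth[of "k + j" L] lL l lt kn by (simp add: w_def L_def nth_append m_def add_ac)
  have vs_pos: "vs ! i \<ge> 1" if "i < k" for i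
    using that rng(2) l by (metis atLeastAtMost_iff nth_mem subsetD)
  have us_pos: "us ! i \<ge> 1" if "i < length us" for i
    using that rng(1) by (metis atLeastAtMost_iff nth_mem subsetD)
  have tl_less: "tl ! i < tl ! j" if "i < j" "j < m" for i j
  proof -
    consider "j < s" | "i < s" "s \<le> j" | "s \<le> i" using that by linarith
    then show ?thesis
    proof cases
      case 1
      then show ?thesis using zs_lt[OF that(1) 1] that by (simp add: tl_def nth_append s_def)
    next
      case 2
      have "us ! (j - s) \<ge> 1" using that 2 lens l by (intro us_pos) simp
      then show ?thesis using 2 that lens l by (simp add: tl_def nth_append s_def)
    next
      case 3
      then have "us ! (i - s) < us ! (j - s)" using that us lens l by (simp add: sorted_wrt_iff_nth_less)
      then show ?thesis using 3 that lens l by (simp add: tl_def nth_append s_def)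
    qed
  qed
  have wW: "w \<in> W_inf" using wfin by (simp add: W_fin_def)
  have wk: "w \<in> W_k k n"
  proof (rule W_kI[OF wW])
    show fixed: "w p = p" if "p > int n" for p using wfin that by (simp add: W_fin_def)
    fix a assume a: "a \<noteq> k"
    consider "a = 0" | "1 \<le> a" "a < k" | "k < a" "a < n" | "k < a" "a = n" | "n < a"
      using a by linarith
    then show "ascent w a"
    proof cases
      case 1
      then have "w 1 > 0" using w_v[of 0] vs_pos[of 0] a by simp
      then show ?thesis using 1 by (simp add: ascent_def)
    next
      case 2
      then have "vs ! (a - 1) < vs ! a" using vs l by (simp add: sorted_wrt_iff_nth_less)
      moreover have "w (int a) = int (vs ! (a - 1))" using w_v[of "a - 1"] 2 by (simp add: of_nat_diff)
      moreover have "w (int a + 1) = int (vs ! a)" using w_v[of a] 2 by simp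
      ultimately show ?thesis using 2 by (simp add: ascent_def)
    next
      case 3
      have "tl ! (a - k - 1) < tl ! (a - k)" using 3 by (intro tl_less) (auto simp: m_def)
      moreover have "k + 1 + (a - k - 1) = a" "a - k - 1 < m" using 3 by (auto simp: m_def)
      then have "w (int a) = tl ! (a - k - 1)" using w_t[of "a - k - 1"] by (simp only:)
      moreover have "int (k + 1 + (a - k)) = int a + 1" "a - k < m" using 3 by (auto simp: m_def)
      then have "w (int a + 1) = tl ! (a - k)" using w_t[of "a - k"] by (simp only:)
      ultimately show ?thesis using 3 by (simp add: ascent_def)
    next
      case 4
      have "w (int a) = L ! (n - 1)" using one_line_nth[of "n - 1" L] lL 4 by (simp add: w_def of_nat_diff)
      moreover have "L ! (n - 1) \<in> set L" using lL 4 by simp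
      then have "\<bar>L ! (n - 1)\<bar> \<in> {1..int n}" using sL lL by blast
      ultimately have "w (int a) \<le> int n" by auto
      moreover have "w (int a + 1) = int a + 1" using 4 by (intro fixed) simp
      ultimately show ?thesis using 4 by (simp add: ascent_def)
    next
      case 5
      then show ?thesis using fixed[of "int a"] fixed[of "int a + 1"] by (simp add: ascent_def)
    qed
  qed
  moreover have "shape k n w = lam"
  proof (rule nth_equalityI)
    show "length (shape k n w) = length lam" by (simp add: length_shape len m_def)
    fix j assume "j < length (shape k n w)"
    then have j: "j < m" by (simp add: length_shape m_def)
    have "shape k n w ! j = (if tl ! j < 0 then nat (- (tl ! j)) + k else card {p \<in> {1..k}. w (int p) > tl ! j})"
      unfolding shape_nth[OF j[unfolded m_def]] w_t[OF j] ..
    also have "\<dots> = lam ! j"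
    proof (cases "j < s")
      case True
      then have tj: "tl ! j = - int (zs ! j)" by (simp add: tl_def nth_append s_def)
      have b: "j < length big" using True by (simp add: s_def zs_def)
      then have zj: "zs ! j = big ! j - k" "big ! j > k" using big by (simp_all add: zs_def)
      then show ?thesis using tj b by (simp add: split nth_append)
    next
      case False
      define u where "u = us ! (j - s)"
      have ju: "j - s < length \<mu>" using j lens False by simp
      have tj: "tl ! j = int u" using False j ju l by (simp add: tl_def nth_append s_def u_def)
      have dvs: "distinct vs" using vs by (simp add: strict_sorted_iff)
      have wp: "w (int p) = int (vs ! (p - 1))" if "p \<in> {1..k}" for p
      proof -
        have "p - 1 < k" using that by auto
        from w_v[OF this] show ?thesis using that by (simp add: of_nat_diff)
      qed
      have "bij_betw (\<lambda>p. vs ! (p - 1)) {p \<in> {1..k}. w (int p) > int u} {v \<in> set vs. v > u}"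
      proof (rule bij_betwI')
        fix x y assume "x \<in> {p \<in> {1..k}. w (int p) > int u}" "y \<in> {p \<in> {1..k}. w (int p) > int u}"
        then show "vs ! (x - 1) = vs ! (y - 1) \<longleftrightarrow> x = y"
          using dvs l by (auto simp: nth_eq_iff_index_eq)
      next
        fix x assume "x \<in> {p \<in> {1..k}. w (int p) > int u}"
        then show "vs ! (x - 1) \<in> {v \<in> set vs. v > u}" using wp[of x] l by auto
      next
        fix v assume v: "v \<in> {v \<in> set vs. v > u}"
        then obtain i where i: "i < k" "v = vs ! i" using l by (auto simp: in_set_conv_nth)
        then show "\<exists>x\<in>{p \<in> {1..k}. w (int p) > int u}. v = vs ! (x - 1)"
          using v wp[of "Suc i"] by (intro bexI[of _ "Suc i"]) auto
      qed
      then have "card {p \<in> {1..k}. w (int p) > int u} = \<mu> ! (j - s)"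
        using card[OF ju] by (simp add: bij_betw_same_card u_def)
      moreover have "lam ! j = \<mu> ! (j - s)" using False by (simp add: split nth_append s_def zs_def)
      ultimately show ?thesis by (simp add: tj)
    qed
    finally show "shape k n w ! j = lam ! j" .
  qed
  ultimately show ?thesis by blast
qed

section \<open>Double Schubert polynomials of \<open>k\<close>-Grassmannian elements\<close>

definition theta_det :: "nat \<Rightarrow> nat \<Rightarrow> (nat \<Rightarrow> int) \<Rightarrow> (nat \<Rightarrow> int) \<Rightarrow> rinf" where
  "theta_det k m \<chi> r = det (mat m m (\<lambda>(i, j). theta k (\<chi> i) (r i + int j - int i)))"

lemma theta_det_expand:
  "theta_det k m \<chi> r = (\<Sum>p\<in>{p. p permutes {0..<m}}. of_int (sign p) * (\<Prod>i=0..<m. theta k (\<chi> i) (r i + int (p i) - int i)))"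
proof -
  have "theta_det k m \<chi> r = (\<Sum>p\<in>{p. p permutes {0..<m}}. of_int (sign p) *
      (\<Prod>i=0..<m. mat m m (\<lambda>(i, j). theta k (\<chi> i) (r i + int j - int i)) $$ (i, p i)))"
    unfolding theta_det_def by (rule det_def') simp
  also have "\<dots> = (\<Sum>p\<in>{p. p permutes {0..<m}}. of_int (sign p) * (\<Prod>i=0..<m. theta k (\<chi> i) (r i + int (p i) - int i)))"
  proof (rule sum.cong[OF refl])
    fix p assume "p \<in> {p. p permutes {0..<m}}"
    then have "p i < m" if "i < m" for i using that permutes_in_image[of p "{0..<m}" i] by auto
    then have "(\<Prod>i=0..<m. mat m m (\<lambda>(i, j). theta k (\<chi> i) (r i + int j - int i)) $$ (i, p i)) =
        (\<Prod>i=0..<m. theta k (\<chi> i) (r i + int (p i) - int i))"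
      by (intro prod.cong) simp_all
    then show "of_int (sign p) * (\<Prod>i=0..<m. mat m m (\<lambda>(i, j). theta k (\<chi> i) (r i + int j - int i)) $$ (i, p i)) =
      of_int (sign p) * (\<Prod>i=0..<m. theta k (\<chi> i) (r i + int (p i) - int i))" by (simp only:)
  qed
  finally show ?thesis .
qed

lemma rhom_sign: "rhom h \<Longrightarrow> h (of_int (sign p)) = of_int (sign p)"
  by (auto simp: sign_def rhom_simps)

lemma theta_det_cong:
  assumes "\<And>l. l < m \<Longrightarrow> \<chi> l = \<chi>' l" "\<And>l. l < m \<Longrightarrow> r l = r' l"
  shows "theta_det k m \<chi> r = theta_det k m \<chi>' r'"
  unfolding theta_det_expand using assms by (intro sum.cong refl arg_cong2[of _ _ _ _ "(*)"] prod.cong) auto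

lemma hom_theta_det:
  assumes "rhom h"
  shows "h (theta_det k m \<chi> r) = (\<Sum>p\<in>{p. p permutes {0..<m}}. of_int (sign p) * (\<Prod>i=0..<m. h (theta k (\<chi> i) (r i + int (p i) - int i))))"
  unfolding theta_det_expand by (simp add: rhom_sum[OF assms] rhom_mult[OF assms] rhom_sign[OF assms] rhom_prod[OF assms])

lemma theta_det_none:
  assumes "\<And>l. l < m \<Longrightarrow> \<bar>\<chi> l\<bar> \<noteq> int i"
  shows "s_t i (theta_det k m \<chi> r) = theta_det k m \<chi> r"
  unfolding hom_theta_det[OF rhom_s_t] unfolding theta_det_expand
  by (rule sum.cong[OF refl], rule arg_cong2[of _ _ _ _ "(*)"], rule refl, rule prod.cong[OF refl])
    (simp add: theta_s_t_fixed assms)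

lemma theta_det_single:
  assumes j: "j < m" "\<bar>\<chi> j\<bar> = int i" and only: "\<And>l. l < m \<Longrightarrow> \<bar>\<chi> l\<bar> = int i \<Longrightarrow> l = j"
  shows "s_t i (theta_det k m \<chi> r) = theta_det k m \<chi> r - alpha i * theta_det k m (\<chi>(j := \<chi> j - 1)) (decr j r)"
proof -
  let ?\<chi> = "\<chi>(j := \<chi> j - 1)"
  let ?f = "\<lambda>p i. theta k (\<chi> i) (r i + int (p i) - int i)" and ?g = "\<lambda>p i. theta k (?\<chi> i) (decr j r i + int (p i) - int i)"
  have ne: "\<bar>\<chi> l\<bar> \<noteq> int i" if "l < m" "l \<noteq> j" for l
    using only[OF that(1)] that by blast
  have prod: "(\<Prod>l=0..<m. s_t i (?f p l)) = (\<Prod>l=0..<m. ?f p l) - alpha i * (\<Prod>l=0..<m. ?g p l)" for p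
  proof -
    let ?rest = "\<Prod>l\<in>{0..<m} - {j}. ?f p l"
    have split: "(\<Prod>l=0..<m. F l) = F j * (\<Prod>l\<in>{0..<m} - {j}. F l)" for F :: "nat \<Rightarrow> rinf"
      using j(1) by (intro prod.remove) auto
    have "(\<Prod>l\<in>{0..<m} - {j}. s_t i (?f p l)) = ?rest"
      using theta_s_t_fixed[OF ne] by (intro prod.cong) auto
    moreover have "(\<Prod>l\<in>{0..<m} - {j}. ?g p l) = ?rest"
      by (intro prod.cong) (auto simp: decr_def)
    moreover have "s_t i (?f p j) = ?f p j - alpha i * ?g p j"
      by (simp add: theta_s_t_diff[OF j(2)] decr_def algebra_simps)
    ultimately show ?thesis unfolding split by (simp only: left_diff_distrib mult.assoc)
  qed
  show ?thesis
    unfolding hom_theta_det[OF rhom_s_t] prod unfolding theta_det_expand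
    by (simp add: sum_distrib_left right_diff_distrib sum_subtractf mult_ac)
qed

lemma theta_det_zero_row:
  assumes "j < m" "\<And>c. c < m \<Longrightarrow> h (theta k (\<chi> j) (r j + int c - int j)) = 0" and h: "rhom h"
  shows "h (theta_det k m \<chi> r) = 0"
  unfolding hom_theta_det[OF h]
proof (rule sum.neutral, rule ballI)
  fix p assume "p \<in> {p. p permutes {0..<m}}"
  then have "p j < m" using assms(1) permutes_in_image[of p "{0..<m}" j] by auto
  then have "(\<Prod>i=0..<m. h (theta k (\<chi> i) (r i + int (p i) - int i))) = 0"
    using assms(2)[of "p j"] assms(1) by (intro prod_zero bexI[of _ j]) simp_all
  then show "of_int (sign p) * (\<Prod>i=0..<m. h (theta k (\<chi> i) (r i + int (p i) - int i))) = 0" by simp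
qed

text \<open>The entries of a row depend on r j - j, which here takes the same value in both
  rows.\<close>

lemma theta_det_equal_rows:
  assumes "Suc j < m" "\<chi> (Suc j) = \<chi> j" "r (Suc j) = r j + 1"
  shows "theta_det k m \<chi> r = 0"
  unfolding theta_det_def
  by (rule det_identical_rows[of _ m j "Suc j"]) (use assms in \<open>auto simp: row_def algebra_simps intro!: eq_vecI\<close>)

lemma theta_det_zero:
  assumes "\<And>l. l < m \<Longrightarrow> r l = 0"
  shows "theta_det k m \<chi> r = 1"
proof -
  let ?A = "mat m m (\<lambda>(i, j). theta k (\<chi> i) (r i + int j - int i))"
  have "upper_triangular ?A" using assms by (auto simp: upper_triangular_def)
  then have "det ?A = prod_list (diag_mat ?A)" by (rule det_upper_triangular[where n = m]) simp
  also have "diag_mat ?A = map (\<lambda>_. 1) [0..<m]"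
    using assms by (auto simp: diag_mat_def)
  also have "prod_list (map (\<lambda>_. 1 :: rinf) [0..<m]) = 1"
    by (induction m) auto
  finally show ?thesis by (simp add: theta_det_def)
qed

section \<open>Left recursion of the raised Pfaffian and of the determinant\<close>

context grassmannian
begin

lemma raised_pf_step:
  fixes i :: nat
  defines "F \<equiv> \<lambda>w. raised_pf k (n - k) (row_chi k w) (row_lam k w)"
  shows "if ascent g i then s_t i (F w) = F w else F w - s_t i (F w) = alpha i * F (gen_s i \<circ> w)"
proof (cases rule: left_descent_cases[of i])
  case none
  have "s_t i (F w) = F w" unfolding F_def using none(2) by (rule raised_pf_none)
  then show ?thesis using none(1) by simp
next
  case (single j)
  have "raised_pf k (n - k) ((row_chi k w)(j := row_chi k w j - 1)) (decr j (row_lam k w)) = F (gen_s i \<circ> w)"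
    unfolding F_def by (rule raised_pf_cong) (simp_all only: single(5,6) decr_eq)
  note eq = this
  have st: "s_t i (F w) = F w - alpha i * raised_pf k (n - k) ((row_chi k w)(j := row_chi k w j - 1)) (decr j (row_lam k w))"
    unfolding F_def using single(2-4) by (rule raised_pf_single)
  show ?thesis unfolding st eq using single(1) by simp
next
  case (double j j')
  have "raised_pf k (n - k) ((row_chi k w)(j := int i - 1, j' := - int i - 1)) (decr j (row_lam k w)) = F (gen_s i \<circ> w)"
    unfolding F_def by (rule raised_pf_cong) (simp_all only: double(8,9) decr_eq)
  note eq = this
  have st: "s_t i (F w) = F w - alpha i * raised_pf k (n - k) ((row_chi k w)(j := int i - 1, j' := - int i - 1)) (decr j (row_lam k w))"
    unfolding F_def using double(2-7) by (rule raised_pf_double)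
  show ?thesis unfolding st eq using double(1) by simp
next
  case (equal_zeta j)
  have "raised_pf k (n - k) ((row_chi k w)(j := row_chi k w j - 1)) (decr j (row_lam k w)) = 0"
  proof (rule raised_pf_equal_positive[OF equal_zeta(3)])
    show "0 \<le> ((row_chi k w)(j := row_chi k w j - 1)) l" if "l < j" for l
      using row_chi_decreasing[OF that] that equal_zeta(4) by simp
  qed (use equal_zeta(2,4,5,7,8) in \<open>simp_all add: decr_def\<close>)
  note eq = this
  have abs_j: "\<bar>row_chi k w j\<bar> = int i" and jm: "j < n - k" using equal_zeta(2-4) by auto
  have st: "s_t i (F w) = F w - alpha i * raised_pf k (n - k) ((row_chi k w)(j := row_chi k w j - 1)) (decr j (row_lam k w))"
    unfolding F_def using jm abs_j equal_zeta(6) by (rule raised_pf_single)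
  show ?thesis unfolding st eq using equal_zeta(1) by simp
next
  case (equal_u j)
  have "raised_pf k (n - k) ((row_chi k w)(j := row_chi k w j - 1)) (decr j (row_lam k w)) = 0"
    by (rule raised_pf_equal_negative[OF equal_u(3)]) (use equal_u(2,4,5,7) in \<open>simp_all add: decr_def\<close>)
  note eq = this
  have abs_j: "\<bar>row_chi k w j\<bar> = int i" and jm: "j < n - k" using equal_u(2-4) by auto
  have st: "s_t i (F w) = F w - alpha i * raised_pf k (n - k) ((row_chi k w)(j := row_chi k w j - 1)) (decr j (row_lam k w))"
    unfolding F_def using jm abs_j equal_u(6) by (rule raised_pf_single)
  show ?thesis unfolding st eq using equal_u(1) by simp
next
  case (last j)
  have "raised_pf k (n - k) ((row_chi k w)(j := row_chi k w j - 1)) (decr j (row_lam k w)) = 0"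
    unfolding last(3)[symmetric] by (rule raised_pf_last_negative) (simp add: decr_def last(6))
  note eq = this
  have abs_j: "\<bar>row_chi k w j\<bar> = int i" and jm: "j < n - k" using last(2-4) by auto
  have st: "s_t i (F w) = F w - alpha i * raised_pf k (n - k) ((row_chi k w)(j := row_chi k w j - 1)) (decr j (row_lam k w))"
    unfolding F_def using jm abs_j last(5) by (rule raised_pf_single)
  show ?thesis unfolding st eq using last(1) by simp
qed

text \<open>The cases \<open>double\<close> and \<open>equal_zeta\<close> contain a pair of rows
  whose chi have sum \<ge> 0, so they are excluded; raising operators are needed only for the
  former, the degree bound for the latter.\<close>

lemma theta_det_step:
  fixes i :: nat
  defines "F \<equiv> \<lambda>w. theta_det k (n - k) (row_chi k w) (row_lam k w)"
  assumes neg: "\<And>a b. a < b \<Longrightarrow> b < n - k \<Longrightarrow> row_chi k w a + row_chi k w b < 0"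
  shows "if ascent g i then s_t i (F w) = F w else F w - s_t i (F w) = alpha i * F (gen_s i \<circ> w)"
proof (cases rule: left_descent_cases[of i])
  case none
  have "s_t i (F w) = F w" unfolding F_def using none(2) by (rule theta_det_none)
  then show ?thesis using none(1) by simp
next
  case (single j)
  have "theta_det k (n - k) ((row_chi k w)(j := row_chi k w j - 1)) (decr j (row_lam k w)) = F (gen_s i \<circ> w)"
    unfolding F_def by (rule theta_det_cong) (simp_all only: single(5,6) decr_eq)
  note eq = this
  have st: "s_t i (F w) = F w - alpha i * theta_det k (n - k) ((row_chi k w)(j := row_chi k w j - 1)) (decr j (row_lam k w))"
    unfolding F_def using single(2-4) by (rule theta_det_single)
  show ?thesis unfolding st eq using single(1) by simp
next
  case (double j j')
  show ?thesis using neg[OF double(3,4)] double(5,6) by simp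
next
  case (equal_zeta j)
  show ?thesis using neg[OF lessI equal_zeta(3)] equal_zeta(2,4,5) by simp
next
  case (equal_u j)
  have "theta_det k (n - k) ((row_chi k w)(j := row_chi k w j - 1)) (decr j (row_lam k w)) = 0"
    by (rule theta_det_equal_rows[OF equal_u(3)]) (simp_all add: decr_def equal_u(4,5,7))
  note eq = this
  have abs_j: "\<bar>row_chi k w j\<bar> = int i" and jm: "j < n - k" using equal_u(2-4) by auto
  have st: "s_t i (F w) = F w - alpha i * theta_det k (n - k) ((row_chi k w)(j := row_chi k w j - 1)) (decr j (row_lam k w))"
    unfolding F_def using jm abs_j equal_u(6) by (rule theta_det_single)
  show ?thesis unfolding st eq using equal_u(1) by simp
next
  case (last j)
  have "theta_det k (n - k) ((row_chi k w)(j := row_chi k w j - 1)) (decr j (row_lam k w)) = 0"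
    by (rule theta_det_zero_row[OF _ _ rhom_id, of j]) (use last(3,6) in \<open>auto simp: decr_def\<close>)
  note eq = this
  have abs_j: "\<bar>row_chi k w j\<bar> = int i" and jm: "j < n - k" using last(2-4) by auto
  have st: "s_t i (F w) = F w - alpha i * theta_det k (n - k) ((row_chi k w)(j := row_chi k w j - 1)) (decr j (row_lam k w))"
    unfolding F_def using jm abs_j last(5) by (rule theta_det_single)
  show ?thesis unfolding st eq using last(1) by simp
qed

text \<open>Supplies the bounds for localization. The only right descent of w is at k. If w(k+1) <
  0, lambda_1 is k + zeta_1 and chi_1 is zeta_1 - 1. If b = w(k+1) > 0, then w(k) > b forces the
  values 1..b-1 into the positions 1..k-1; hence b \<le> k, and at least k - b + 1 of the v_p exceed
  b, while chi_1 = -b.\<close>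

lemma first_row:
  assumes "w \<noteq> id"
  shows "n - k > 0" "row_chi k w 0 \<ge> - int k" "row_lam k w 0 > int k + row_chi k w 0"
proof -
  have desc: "\<not> ascent w k"
  proof
    assume asc: "ascent w k"
    have "ascent w i" for i using W_kD(3)[OF w, of i] asc by (cases "i = k") auto
    then have "w = id" by (rule all_ascents_id[OF wW])
    then show False using assms by contradiction
  qed
  show nk: "n - k > 0"
  proof (rule ccontr)
    assume "\<not> n - k > 0"
    then have "k = n" using kn by simp
    moreover have "w (int n + 1) = int n + 1" by (rule w_fixed) simp
    moreover have "w (int n) \<le> int n" using w_bound[of "int n"] by simp
    ultimately have "ascent w k" by (auto simp: ascent_def)
    with desc show False by simp
  qed
  let ?a = "w (row_pos k 0)"
  have a: "?a = w (int k + 1)" by (simp add: row_pos_def add.commute)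
  have a0: "?a \<noteq> 0" by (simp add: w_zero row_pos_def)
  have "row_chi k w 0 \<ge> - int k \<and> row_lam k w 0 > int k + row_chi k w 0"
  proof (cases "?a < 0")
    case True
    then show ?thesis using row_lam_neg[OF True] by (simp add: row_chi_def Let_def)
  next
    case False
    then have apos: "?a > 0" using a0 by simp
    have k: "k > 0"
    proof (rule ccontr)
      assume "\<not> k > 0"
      then show False using desc apos a by (simp add: ascent_def)
    qed
    then have wk: "w (int k) > ?a"
      using desc a W_infD(2)[OF wW] by (auto simp: ascent_def not_less le_less inj_eq)
    define b where "b = nat ?a"
    have b: "?a = int b" "b \<ge> 1" using apos by (simp_all add: b_def)
    have "(\<lambda>x. nat (g (int x))) ` {1..<b} \<subseteq> {1..<k} \<and> inj_on (\<lambda>x. nat (g (int x))) {1..<b}"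
    proof -
      have pos: "1 \<le> g (int x) \<and> g (int x) < int k" if x: "x \<in> {1..<b}" for x
      proof -
        let ?p = "g (int x)"
        have wp: "w ?p = int x" by simp
        have "?p \<noteq> 0" using x by (simp add: g_zero)
        moreover have "\<not> ?p > int k"
        proof
          assume p: "?p > int k"
          then have "\<not> w ?p < ?a" using right_increasing_iff[OF p row_pos_gt[of 0]] by (simp add: row_pos_def)
          then show False using wp b x by simp
        qed
        moreover have "\<not> ?p < 0"
        proof
          assume p: "?p < 0"
          have wn: "w (- ?p) = - int x" by (simp add: w_neg)
          have "- ?p > int k" using left_positive[of "- ?p"] p wn by (cases "- ?p > int k") auto
          then have "\<not> w (- ?p) < ?a" using right_increasing_iff[OF _ row_pos_gt[of 0], of "- ?p"] by (simp add: row_pos_def)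
          then show False using wn apos by simp
        qed
        moreover have "?p \<noteq> int k"
        proof
          assume "?p = int k"
          with w_g[of "int x"] have "w (int k) = int x" by (simp only:)
          then show False using wk b x by simp
        qed
        ultimately show ?thesis by linarith
      qed
      have "inj_on (\<lambda>x. nat (g (int x))) {1..<b}"
      proof (rule inj_onI)
        fix x y assume xy: "x \<in> {1..<b}" "y \<in> {1..<b}" "nat (g (int x)) = nat (g (int y))"
        then have "g (int x) = g (int y)" using pos[OF xy(1)] pos[OF xy(2)] by (simp add: nat_eq_iff)
        then have "w (g (int x)) = w (g (int y))" by (simp only:)
        then show "x = y" by simp
      qed
      moreover have "(\<lambda>x. nat (g (int x))) ` {1..<b} \<subseteq> {1..<k}"
      proof (rule image_subsetI)
        show "nat (g (int x)) \<in> {1..<k}" if "x \<in> {1..<b}" for x using pos[OF that] by auto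
      qed
      ultimately show ?thesis by blast
    qed
    then have "card {1..<b} \<le> card {1..<k}" using card_inj_on_le finite_atLeastLessThan by blast
    then have bk: "b \<le> k" using b(2) k by simp
    have "(\<lambda>p. nat (w (int p))) ` {p \<in> {1..k}. w (int p) < ?a} \<subseteq> {1..<b}"
    proof (rule image_subsetI)
      fix p assume p: "p \<in> {p \<in> {1..k}. w (int p) < ?a}"
      then have "w (int p) > 0" by (intro left_positive) auto
      then show "nat (w (int p)) \<in> {1..<b}" using p b(1) by auto
    qed
    moreover have "inj_on (\<lambda>p. nat (w (int p))) {p \<in> {1..k}. w (int p) < ?a}"
    proof (rule inj_onI)
      fix x y assume xy: "x \<in> {p \<in> {1..k}. w (int p) < ?a}" "y \<in> {p \<in> {1..k}. w (int p) < ?a}" "nat (w (int x)) = nat (w (int y))"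
      then have "w (int x) = w (int y)" using left_positive[of "int x"] left_positive[of "int y"] by (simp add: nat_eq_iff)
      then show "x = y" using W_infD(2)[OF wW] by (simp add: inj_eq)
    qed
    ultimately have "card {p \<in> {1..k}. w (int p) < ?a} \<le> card {1..<b}"
      by (intro card_inj_on_le) auto
    moreover have "card {1..k} = card {p \<in> {1..k}. w (int p) < ?a} + card {p \<in> {1..k}. w (int p) > ?a}"
    proof -
      have "w (int p) \<noteq> ?a" if "p \<in> {1..k}" for p
        using that W_infD(2)[OF wW] by (auto simp: inj_eq row_pos_def)
      then have "{1..k} = {p \<in> {1..k}. w (int p) < ?a} \<union> {p \<in> {1..k}. w (int p) > ?a}" by force
      moreover have "{p \<in> {1..k}. w (int p) < ?a} \<inter> {p \<in> {1..k}. w (int p) > ?a} = {}" by auto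
      ultimately show ?thesis by (metis (no_types, lifting) card_Un_disjoint finite_Un finite_atLeastAtMost)
    qed
    ultimately have "card {p \<in> {1..k}. w (int p) > ?a} \<ge> k - (b - 1)" by simp
    then show ?thesis using row_lam_pos[OF apos] b bk by (simp add: row_chi_def Let_def)
  qed
  then show "row_chi k w 0 \<ge> - int k" "row_lam k w 0 > int k + row_chi k w 0" by blast+
qed

end

lemma row_lam_id: "row_lam k id l = 0"
proof -
  have "{p \<in> {1..k}. id (int p) > id (row_pos k l)} = {}" by (auto simp: row_pos_def)
  then have "card {p \<in> {1..k}. id (int p) > id (row_pos k l)} = 0" by (simp only: card.empty)
  then show ?thesis by (simp only: row_lam_def Let_def) (simp add: row_pos_def)
qed

lemma raised_pf_zero:
  assumes "\<And>l. l < m \<Longrightarrow> r l = 0"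
  shows "raised_pf k m \<chi> r = 1"
proof -
  have "raised_pf k m \<chi> r = raise {p \<in> Dset m \<chi>. snd p < 0} (Phi 0 (\<lambda>l. theta k (\<chi> l))) r"
    unfolding raised_pf_def using raise_trailing_zeros[of "Dset m \<chi>" 0 m "\<lambda>l. theta k (\<chi> l)" r] assms
    by (auto simp: Dset_def finite_Dset[unfolded Dset_def])
  then show ?thesis by (simp add: Phi_def)
qed

section \<open>Identification with double Schubert polynomials\<close>

context schubert
begin

lemma C_eq_raised_pf:
  assumes kn: "k \<le> n" and w: "w \<in> W_k k n"
  shows "C w = raised_pf k (n - k) (row_chi k w) (row_lam k w)"
proof (rule C_family[where S = "W_k k n", OF _ _ _ _ _ w])
  show "W_k k n \<subseteq> W_inf" using W_kD(1) by blast
  show "raised_pf k (n - k) (row_chi k id) (row_lam k id) = 1"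
    by (rule raised_pf_zero) (rule row_lam_id)
  fix w i assume "w \<in> W_k k n"
  then interpret grassmannian k n w using kn by unfold_locales
  have step: "if ascent g i then s_t i (raised_pf k (n - k) (row_chi k w) (row_lam k w)) = raised_pf k (n - k) (row_chi k w) (row_lam k w)
     else raised_pf k (n - k) (row_chi k w) (row_lam k w) - s_t i (raised_pf k (n - k) (row_chi k w) (row_lam k w)) =
       alpha i * raised_pf k (n - k) (row_chi k (gen_s i \<circ> w)) (row_lam k (gen_s i \<circ> w))"
    by (rule raised_pf_step)
  show "gen_s i \<circ> w \<in> W_k k n \<and>
      raised_pf k (n - k) (row_chi k w) (row_lam k w) - s_t i (raised_pf k (n - k) (row_chi k w) (row_lam k w)) =
      alpha i * raised_pf k (n - k) (row_chi k (gen_s i \<circ> w)) (row_lam k (gen_s i \<circ> w))"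
    if "len (gen_s i \<circ> w) < len w"
    using that step descent_W_k[of i] unfolding len_gen_s_comp(1)[OF wW] by presburger
  show "s_t i (raised_pf k (n - k) (row_chi k w) (row_lam k w)) = raised_pf k (n - k) (row_chi k w) (row_lam k w)"
    if "\<not> len (gen_s i \<circ> w) < len w"
    using that step unfolding len_gen_s_comp(1)[OF wW] by presburger
next
  fix w assume "w \<in> W_k k n"
  then interpret grassmannian k n w using kn by unfold_locales
  show "ev (raised_pf k (n - k) (row_chi k w) (row_lam k w)) = 0" if "w \<noteq> id"
    using first_row[OF that] by (rule ev_raised_pf)
qed

lemma C_eq_theta_det:
  assumes kn: "k \<le> n" and w: "w \<in> W_k k n"
    and neg: "\<And>a b. a < b \<Longrightarrow> b < n - k \<Longrightarrow> row_chi k w a + row_chi k w b < 0"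
  shows "C w = theta_det k (n - k) (row_chi k w) (row_lam k w)"
proof -
  \<comment> \<open>Closed under left descents, because a descent lowers entries of chi and never
    raises one.\<close>
  define S where "S = {w \<in> W_k k n. \<forall>b<n - k. \<forall>a<b. row_chi k w a + row_chi k w b < 0}"
  have "w \<in> S" using w neg by (simp add: S_def)
  then show ?thesis
  proof (rule C_family[rotated 5])
    show "S \<subseteq> W_inf" using W_kD(1) by (auto simp: S_def)
    show "theta_det k (n - k) (row_chi k id) (row_lam k id) = 1"
      by (rule theta_det_zero) (rule row_lam_id)
    fix w i assume wS: "w \<in> S"
    then interpret grassmannian k n w using kn by unfold_locales (simp_all add: S_def)
    have step: "if ascent g i then s_t i (theta_det k (n - k) (row_chi k w) (row_lam k w)) = theta_det k (n - k) (row_chi k w) (row_lam k w)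
       else theta_det k (n - k) (row_chi k w) (row_lam k w) - s_t i (theta_det k (n - k) (row_chi k w) (row_lam k w)) =
         alpha i * theta_det k (n - k) (row_chi k (gen_s i \<circ> w)) (row_lam k (gen_s i \<circ> w))"
      using wS by (intro theta_det_step) (simp add: S_def)
    have closed: "gen_s i \<circ> w \<in> S" if "\<not> ascent g i"
    proof -
      have "row_chi k (gen_s i \<circ> w) l \<le> row_chi k w l" for l
        unfolding descent_row_chi[OF that] by simp
      then have "row_chi k (gen_s i \<circ> w) a + row_chi k (gen_s i \<circ> w) b < 0" if "b < n - k" "a < b" for a b
        using wS that unfolding S_def by (smt (verit) mem_Collect_eq)
      then show ?thesis unfolding S_def using descent_W_k[OF that] by blast
    qed
    show "gen_s i \<circ> w \<in> S \<and>
        theta_det k (n - k) (row_chi k w) (row_lam k w) - s_t i (theta_det k (n - k) (row_chi k w) (row_lam k w)) =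
        alpha i * theta_det k (n - k) (row_chi k (gen_s i \<circ> w)) (row_lam k (gen_s i \<circ> w))"
      if "len (gen_s i \<circ> w) < len w"
      using that step closed unfolding len_gen_s_comp(1)[OF wW] by presburger
    show "s_t i (theta_det k (n - k) (row_chi k w) (row_lam k w)) = theta_det k (n - k) (row_chi k w) (row_lam k w)"
      if "\<not> len (gen_s i \<circ> w) < len w"
      using that step unfolding len_gen_s_comp(1)[OF wW] by presburger
  next
    fix w assume "w \<in> S"
    then interpret grassmannian k n w using kn by unfold_locales (simp_all add: S_def)
    show "ev (theta_det k (n - k) (row_chi k w) (row_lam k w)) = 0" if "w \<noteq> id"
      using first_row[OF that]
      by (intro theta_det_zero_row[OF _ _ rhom_ev, of 0]) (auto intro!: ev_theta_vanish)
  qed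
qed

end

theorem corollary1p5:
  fixes k n :: nat and lam :: "nat list" and C :: "(int \<Rightarrow> int) \<Rightarrow> rinf"
  assumes schubert: "double_schubert C"
    and kn: "k \<le> n" and n: "1 \<le> n"
    and lam: "lam \<in> P_set k n"
  shows
    "(D_set k n lam = Delta (n - k) \<or> diagram lam \<subseteq> rectangle (n - k) k \<longrightarrow>
        C (w_of k n lam) =
          det (mat (n - k) (n - k)
            (\<lambda>(i, j). theta k (chi k n lam ! i) (int (lam ! i) + int j - int i)))) \<and>
     (diagram lam \<subseteq> rectangle (n - k) k \<longrightarrow> D_set k n lam = Delta (n - k)) \<and>
     (D_set k n lam = {} \<or>
      strict_partition lam \<and> rectangle (n - k) k \<subseteq> diagram lam \<and> (k = 0 \<or> k \<notin> set lam) \<longrightarrow>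
        C (w_of k n lam) =
          schur_pf (map (\<lambda>i. (theta k (chi k n lam ! i), int (lam ! i))) [0..<n - k])) \<and>
     (strict_partition lam \<and> rectangle (n - k) k \<subseteq> diagram lam \<and> k \<notin> set lam \<longrightarrow>
        D_set k n lam = {})"
proof -
  interpret schubert C by unfold_locales (rule schubert)
  define w where "w = w_of k n lam"
  \<comment> \<open>\<open>w_of\<close> inverts \<open>shape\<close> by choice; surjectivity
    guarantees that the chosen element lies in \<open>W_k k n\<close> and has shape
    \<open>lam\<close>.\<close>
  have "lam \<in> shape k n ` W_k k n" using shape_surj[OF kn lam] by blast
  then have wk: "w \<in> W_k k n" and shape: "shape k n w = lam"
    unfolding w_def w_of_def by (rule inv_into_into, rule f_inv_into_f)
  interpret grassmannian k n w using wk kn by unfold_locales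
  define m where "m = n - k"
  have len: "length lam = m" using lam by (simp add: P_set_def m_def)
  have chi: "chi k n lam ! j = row_chi k w j" if "j < m" for j
    unfolding chi_def map_upt_nth[OF that[unfolded m_def]] by (simp only: row_chi_def row_pos_def w_def Let_def add.assoc)
  have lam_eq: "int (lam ! j) = row_lam k w j" if "j < m" for j
  proof -
    let ?a = "w (row_pos k j)"
    have "lam ! j = (if ?a < 0 then nat (- ?a) + k else card {p \<in> {1..k}. w (int p) > ?a})"
      using shape_nth[OF that[unfolded m_def], of w] unfolding shape row_pos_def .
    then show ?thesis using row_lam_neg[of j] by (cases "?a < 0") (auto simp: row_lam_def Let_def)
  qed
  have D: "D_set k n lam = {(i, j) \<in> Delta m. row_chi k w (i - 1) + row_chi k w (j - 1) < 0}"
    unfolding D_set_def m_def[symmetric] by (auto simp: Delta_def chi)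
  have D_full: "D_set k n lam = Delta m \<longleftrightarrow> (\<forall>b<m. \<forall>a<b. row_chi k w a + row_chi k w b < 0)"
  proof
    assume full: "D_set k n lam = Delta m"
    show "\<forall>b<m. \<forall>a<b. row_chi k w a + row_chi k w b < 0"
    proof (intro allI impI)
      fix a b assume "b < m" "a < b"
      then have "(Suc a, Suc b) \<in> D_set k n lam" unfolding full by (simp add: Delta_def)
      then show "row_chi k w a + row_chi k w b < 0" unfolding D by simp
    qed
  next
    assume all: "\<forall>b<m. \<forall>a<b. row_chi k w a + row_chi k w b < 0"
    show "D_set k n lam = Delta m"
      unfolding D using all by (auto simp: Delta_def)
  qed
  have D_empty: "row_chi k w a + row_chi k w b \<ge> 0" if "D_set k n lam = {}" "a < b" "b < m" for a b
  proof (rule ccontr)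
    assume "\<not> ?thesis"
    then have "(Suc a, Suc b) \<in> D_set k n lam" unfolding D using that by (simp add: Delta_def)
    then show False using that by simp
  qed
  have D_emptyI: "D_set k n lam = {}" if "\<And>l. l < m \<Longrightarrow> row_chi k w l \<ge> 0"
  proof -
    have "row_chi k w (i - 1) + row_chi k w (j - 1) \<ge> 0" if "(i, j) \<in> Delta m" for i j
      using \<open>\<And>l. l < m \<Longrightarrow> row_chi k w l \<ge> 0\<close>[of "i - 1"] \<open>\<And>l. l < m \<Longrightarrow> row_chi k w l \<ge> 0\<close>[of "j - 1"] that
      by (auto simp: Delta_def)
    then show ?thesis unfolding D by force
  qed
  have nz: "w (row_pos k l) \<noteq> 0" for l by (simp add: w_zero row_pos_def)
  have lam_le: "row_lam k w l \<le> int k" if "w (row_pos k l) > 0" for l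
  proof -
    have "card {p \<in> {1..k}. w (int p) > w (row_pos k l)} \<le> card {1..k}" by (rule card_mono) auto
    then show ?thesis using row_lam_pos[OF that] by simp
  qed
  \<comment> \<open>A negative value in a row would give a part larger than k. So all values are
    positive and every chi is negative.\<close>
  have part2: "D_set k n lam = Delta m" if rect: "diagram lam \<subseteq> rectangle (n - k) k"
  proof -
    have "row_chi k w l < 0" if l: "l < m" for l
    proof -
      have "lam ! l \<le> k"
      proof (cases "lam ! l = 0")
        case False
        then have "(Suc l, lam ! l) \<in> diagram lam" using l len by (simp add: diagram_def)
        then show ?thesis using rect by (auto simp: rectangle_def)
      qed simp
      then have "row_lam k w l \<le> int k" using lam_eq[OF l] by simp
      then have "\<not> w (row_pos k l) < 0" using row_lam_neg[of l] by auto
      then show ?thesis using nz[of l] by (simp add: row_chi_def Let_def)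
    qed
    then show ?thesis unfolding D_full by (metis add_neg_neg less_trans)
  qed
  have part1: "C w = det (mat m m (\<lambda>(i, j). theta k (chi k n lam ! i) (int (lam ! i) + int j - int i)))"
    if "D_set k n lam = Delta m"
  proof -
    have "C w = theta_det k m (row_chi k w) (row_lam k w)"
      unfolding m_def using that[unfolded D_full] by (intro C_eq_theta_det kn wk) (simp add: m_def)
    also have "\<dots> = theta_det k m (\<lambda>i. chi k n lam ! i) (\<lambda>i. int (lam ! i))"
      by (rule theta_det_cong) (simp_all add: chi lam_eq)
    finally show ?thesis by (simp add: theta_det_def)
  qed
  have ge: "lam ! l \<ge> k" if "rectangle (n - k) k \<subseteq> diagram lam" "l < m" for l
  proof (cases "k = 0")
    case False
    then have "(Suc l, k) \<in> rectangle (n - k) k" using that by (simp add: rectangle_def m_def)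
    then show ?thesis using that by (auto simp: diagram_def)
  qed simp
  \<comment> \<open>Every part exceeds k, whereas a positive value in a row gives a part of size at
    most k. So all values are negative and every chi is nonnegative.\<close>
  have part4: "D_set k n lam = {}" if "rectangle (n - k) k \<subseteq> diagram lam" "k \<notin> set lam"
  proof (rule D_emptyI)
    fix l assume l: "l < m"
    have "lam ! l \<noteq> k" using that(2) l len by (metis nth_mem)
    then have "row_lam k w l > int k" using ge[OF that(1) l] lam_eq[OF l] by simp
    then have "w (row_pos k l) < 0" using lam_le[of l] nz[of l] by force
    then show "row_chi k w l \<ge> 0" by (simp add: row_chi_def Let_def)
  qed
  have pf: "C w = schur_pf (map (\<lambda>i. (theta k (chi k n lam ! i), int (lam ! i))) [0..<m])"
    if "raised_pf k m (row_chi k w) (row_lam k w) = Phi m (\<lambda>l. theta k (row_chi k w l)) (row_lam k w)"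
  proof -
    have "C w = Phi m (\<lambda>l. theta k (row_chi k w l)) (row_lam k w)"
      using C_eq_raised_pf[OF kn wk] that by (simp add: m_def)
    also have "\<dots> = Phi m (\<lambda>i. theta k (chi k n lam ! i)) (\<lambda>i. int (lam ! i))"
      by (rule Phi_cong) (simp_all add: chi lam_eq)
    finally show ?thesis by (simp add: Phi_schur_pf)
  qed
  have part3: "C w = schur_pf (map (\<lambda>i. (theta k (chi k n lam ! i), int (lam ! i))) [0..<m])"
    if "D_set k n lam = {}"
    using D_empty[OF that] by (intro pf raised_pf_trailing_zeros[of m]) auto
  \<comment> \<open>For k = 0 there are no v_p to count, so rows with positive value have part 0,
    and they come last. Every pair of D ends in such a row, so
    \<open>raised_pf_trailing_zeros\<close> applies although D may be nonempty.\<close>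
  have part3': "C w = schur_pf (map (\<lambda>i. (theta k (chi k n lam ! i), int (lam ! i))) [0..<m])"
    if k0: "k = 0"
  proof (rule pf)
    \<comment> \<open>The rows with negative value form an initial segment, since values increase; s
      is its length.\<close>
    define s where "s = card {l. l < m \<and> w (row_pos k l) < 0}"
    have down: "w (row_pos k l) < 0" if "w (row_pos k l') < 0" "l \<le> l'" for l l'
      using right_increasing[OF row_pos_gt[of l], of "row_pos k l'"] that by (cases "l = l'") (auto simp: row_pos_def)
    have s: "l < s \<longleftrightarrow> w (row_pos k l) < 0" if "l < m" for l
    proof
      assume neg: "w (row_pos k l) < 0"
      have "{..l} \<subseteq> {l. l < m \<and> w (row_pos k l) < 0}" using down[OF neg] that by auto
      then have "card {..l} \<le> s" unfolding s_def by (intro card_mono) auto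
      then show "l < s" by simp
    next
      assume ls: "l < s"
      show "w (row_pos k l) < 0"
      proof (rule ccontr)
        assume "\<not> w (row_pos k l) < 0"
        then have "{l. l < m \<and> w (row_pos k l) < 0} \<subseteq> {..<l}" using down[of _ l] by (force simp: not_less)
        then have "s \<le> card {..<l}" unfolding s_def by (intro card_mono) auto
        then show False using ls by simp
      qed
    qed
    show "raised_pf k m (row_chi k w) (row_lam k w) = Phi m (\<lambda>l. theta k (row_chi k w l)) (row_lam k w)"
    proof (rule raised_pf_trailing_zeros[of s])
      have "s \<le> card {..<m}" unfolding s_def by (intro card_mono) auto
      then show sm: "s \<le> m" by simp
      show "row_lam k w l = 0" if "s \<le> l" "l < m" for l
        using lam_le[of l] row_lam_nonneg[of l] s[OF that(2)] that nz[of l] k0 by force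
      show "0 \<le> row_chi k w i + row_chi k w j" if "i < j" "j < s" for i j
        using s[of i] s[of j] that sm by (simp add: row_chi_def Let_def)
    qed
  qed
  show ?thesis
    unfolding m_def[symmetric] w_def[symmetric] using part1 part2 part3 part3' part4 by (auto simp: m_def)
qed

end
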